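(* Let $\mathcal{H}=\mathcal{H}(a,-b_1,\dots,-b_p)$ be any stratum of meromorphic $1$-forms on $\mathbb{CP}^1$ with a unique zero ($a,b_1,\dots,b_p\geq 1$ integers, $a-\sum_jb_j=-2$). If $I$ and $J$ are secant subsets of $\{1,\dots,p\}$, then the monodromy actions of $\gamma_I$ and $\gamma_J$ on the isoresidual fibration commute (where $\gamma_I$ and $\gamma_J$ are the loops based at a point of a real chamber adjacent to both $A_I$ and $A_J$, acting on the fiber over that point).
   Context: The stratum $\mathcal{H}(a,-b_1,\dots,-b_p)$ is the space of meromorphic $1$-forms $\omega$ on $\mathbb{CP}^1$ having exactly one zero, of order $a$, and exactly $p$ poles, labeled by $1,\dots,p$, the $j$-th one of order $b_j$, considered up to biholomorphisms (pulling back forms and preserving the labels of the poles). The residue of $\omega$ at a pole is the period of $\omega$ over a positively oriented simple loop around it. The residual space is $\mathcal{R}_p=\{(\lambda_1,\dots,\lambda_p)\in\mathbb{C}^p : \sum_{j=1}^p\lambda_j=0\}$. The residual map $\operatorname{res}\colon\mathcal{H}\to\mathcal{R}_p$ sends $\omega$ to the tuple of its residues. The resonance hyperplanes are $A_I=\{\lambda\in\mathcal{R}_p:\sum_{j\in I}\lambda_j=0\}$ for nonempty proper $I\subset\{1,\dots,p\}$, and the resonance arrangement $\mathcal{A}_p$ is their union. Over $\mathcal{R}_p\setminus\mathcal{A}_p$ the residual map is an unramified cover, and $\pi_1(\mathcal{R}_p\setminus\mathcal{A}_p)$ acts on its fibers by monodromy (lifting loops). Two nonempty proper subsets $I,J\subset\{1,\dots,p\}$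 are secant if the four sets $I\cap J$, $I^{\complement}\cap J$, $I\cap J^{\complement}$, $I^{\complement}\cap J^{\complement}$ are all nonempty. A (real) chamber is a connected component $\mathcal{C}$ of $(\mathcal{R}_p\cap\mathbb{R}^p)\setminus\mathcal{A}_p$; it is adjacent to $A_I$ if $A_I\cap\mathbb{R}^p$ contains a codimension-one face of $\mathcal{C}$. Given a base point in a chamber $\mathcal{C}$ adjacent to $A_I$, $\gamma_I$ is the simple loop around $A_I$ obtained by moving inside $\mathcal{C}$ to a point close to a point of $A_I$ in the relative interior of that face, turning once around $A_I$ in a small disc transverse to $A_I$ (meeting no other resonance hyperplane) so that $\sum_{j\in I}\lambda_j$ makes one positive turn around $0$, and returning along the same path. *)

theory Defs
  imports "HOL-Complex_Analysis.Complex_Analysis"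
begin

section \<open>The Riemann sphere and its biholomorphisms\<close>

text \<open>
  The complex projective line is the one-point compactification of the complex plane, with
  \<open>None\<close> as the point at infinity. Its two standard charts are \<open>Some z \<mapsto> z\<close> and
  its composite with the inversion below.
\<close>

type_synonym cp1 = "complex option"

definition cp1_top :: "cp1 topology" where
  "cp1_top = Alexandroff_compactification euclidean"

definition cp1_inversion :: "cp1 \<Rightarrow> cp1" where
  "cp1_inversion P = (case P of None \<Rightarrow> Some 0 | Some z \<Rightarrow> if z = 0 then None else Some (inverse z))"

text \<open>
  Holomorphy in all four combinations of the standard charts of source and target. The openness
  of the domains of the local expressions makes continuity automatic.
\<close>

definition cp1_holomorphic :: "(cp1 \<Rightarrow> cp1) \<Rightarrow> bool" where
  "cp1_holomorphic \<phi> \<longleftrightarrow>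
     (\<forall>\<sigma>\<in>{id, cp1_inversion}. \<forall>\<tau>\<in>{id, cp1_inversion}.
        open {z. \<tau> (\<phi> (\<sigma> (Some z))) \<noteq> None} \<and>
        (\<lambda>z. the (\<tau> (\<phi> (\<sigma> (Some z))))) holomorphic_on {z. \<tau> (\<phi> (\<sigma> (Some z))) \<noteq> None})"

definition cp1_biholomorphic :: "(cp1 \<Rightarrow> cp1) \<Rightarrow> bool" where
  "cp1_biholomorphic \<phi> \<longleftrightarrow> bij \<phi> \<and> cp1_holomorphic \<phi> \<and> cp1_holomorphic (inv \<phi>)"


section \<open>Meromorphic 1-forms on the Riemann sphere\<close>

text \<open>
  A meromorphic 1-form is given by its coefficient \<open>f\<close> in \<open>f z dz\<close>. With \<open>z = 1/w\<close> one has
  \<open>dz = - dw / w\<^sup>2\<close>, whence the coefficient at infinity. The coefficient is taken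
  \<^const>\<open>nicely_meromorphic_on\<close> (value \<open>0\<close> at the poles), so that each form has exactly one
  representing function. Neither order nor residue depends on the value of the function at the
  point itself.
\<close>

definition coeff_at_infinity :: "(complex \<Rightarrow> complex) \<Rightarrow> complex \<Rightarrow> complex" where
  "coeff_at_infinity f = (\<lambda>w. - f (inverse w) / w ^ 2)"

definition meromorphic_form :: "(complex \<Rightarrow> complex) \<Rightarrow> bool" where
  "meromorphic_form f \<longleftrightarrow> f nicely_meromorphic_on UNIV \<and> coeff_at_infinity f meromorphic_on {0}"

definition form_order :: "(complex \<Rightarrow> complex) \<Rightarrow> cp1 \<Rightarrow> int" where
  "form_order f P = (case P of Some z \<Rightarrow> zorder f z | None \<Rightarrow> zorder (coeff_at_infinity f) 0)"

text \<open>
  The residue in the period normalisation: the integral over a small positively oriented loop,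
  that is, \<open>2 \<pi> \<i>\<close> times the coefficient of \<open>dz / z\<close>.
\<close>

definition form_residue :: "(complex \<Rightarrow> complex) \<Rightarrow> cp1 \<Rightarrow> complex" where
  "form_residue f P =
     2 * of_real pi * \<i> *
       (case P of Some z \<Rightarrow> residue f z | None \<Rightarrow> residue (coeff_at_infinity f) 0)"

text \<open>
  A point of the space below is a form with labelled poles \<open>(f, x)\<close>, where \<open>x j\<close> is the
  \<open>j\<close>-th pole. The labels \<open>1, \<dots>, p\<close> are the elements of the finite type \<open>'p\<close>.
\<close>

type_synonym 'p marked_form = "(complex \<Rightarrow> complex) \<times> ('p \<Rightarrow> cp1)"

definition marked_forms :: "nat \<Rightarrow> ('p::finite \<Rightarrow> nat) \<Rightarrow> 'p marked_form set" where
  "marked_forms a b =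
     {(f, x). meromorphic_form f \<and> f \<noteq> (\<lambda>_. 0) \<and> inj x \<and>
        (\<forall>j. form_order f (x j) = - int (b j)) \<and>
        (\<exists>z0. z0 \<notin> range x \<and> form_order f z0 = int a \<and>
              (\<forall>P. P \<notin> insert z0 (range x) \<longrightarrow> form_order f P = 0))}"

definition form_zero :: "(complex \<Rightarrow> complex) \<Rightarrow> cp1" where
  "form_zero f = (THE P. form_order f P > 0)"

text \<open>
  The usual topology: the zero and the labelled poles move continuously on the sphere, and the
  coefficient varies continuously for the compact-open topology away from the poles.
\<close>

definition marked_forms_top :: "nat \<Rightarrow> ('p::finite \<Rightarrow> nat) \<Rightarrow> 'p marked_form topology" where
  "marked_forms_top a b = topology_generated_by
     ({{(f, x) \<in> marked_forms a b. x j \<in> V} | j V. openin cp1_top V} \<union>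
      {{(f, x) \<in> marked_forms a b. form_zero f \<in> V} | V. openin cp1_top V} \<union>
      {{(f, x) \<in> marked_forms a b. Some ` K \<inter> range x = {} \<and> f ` K \<subseteq> U} | K U.
          compact K \<and> open U})"


section \<open>The stratum and the residual map\<close>

text \<open>
  \<open>(f, x)\<close> and \<open>(g, y)\<close> are isomorphic if \<open>f dz = \<phi>\<^sup>* (g dz)\<close> for a biholomorphism \<open>\<phi>\<close>
  respecting the labels. It is enough to compare the coefficients at the finite points with finite
  image, since only two points of the sphere are left out. At poles both sides are \<open>0\<close>.
\<close>

definition form_iso :: "nat \<Rightarrow> ('p::finite \<Rightarrow> nat) \<Rightarrow> ('p marked_form \<times> 'p marked_form) set" where
  "form_iso a b =
     {((f, x), (g, y)). (f, x) \<in> marked_forms a b \<and> (g, y) \<in> marked_forms a b \<and>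
        (\<exists>\<phi>. cp1_biholomorphic \<phi> \<and> (\<forall>j. \<phi> (x j) = y j) \<and>
           (\<forall>z u. \<phi> (Some z) = Some u \<longrightarrow>
              f z = g u * deriv (\<lambda>t. the (\<phi> (Some t))) z))}"

definition stratum :: "nat \<Rightarrow> ('p::finite \<Rightarrow> nat) \<Rightarrow> 'p marked_form set set" where
  "stratum a b = marked_forms a b // form_iso a b"

text \<open>The quotient topology.\<close>

definition stratum_top :: "nat \<Rightarrow> ('p::finite \<Rightarrow> nat) \<Rightarrow> 'p marked_form set topology" where
  "stratum_top a b =
     topology (\<lambda>U. U \<subseteq> stratum a b \<and> openin (marked_forms_top a b) {m \<in> marked_forms a b. form_iso a b `` {m} \<in> U})"

lemma openin_stratum_top:
  "openin (stratum_top a b) U \<longleftrightarrow>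
     U \<subseteq> stratum a b \<and> openin (marked_forms_top a b) {m \<in> marked_forms a b. form_iso a b `` {m} \<in> U}"
proof -
  let ?q = "\<lambda>U. {m \<in> marked_forms a b. form_iso a b `` {m} \<in> U}"
  have "istopology (\<lambda>U. U \<subseteq> stratum a b \<and> openin (marked_forms_top a b) (?q U))"
    unfolding istopology_def
  proof (intro conjI allI impI)
    fix S T assume S: "S \<subseteq> stratum a b \<and> openin (marked_forms_top a b) (?q S)"
      and T: "T \<subseteq> stratum a b \<and> openin (marked_forms_top a b) (?q T)"
    have "?q (S \<inter> T) = ?q S \<inter> ?q T" by auto
    then show "openin (marked_forms_top a b) (?q (S \<inter> T))"
      using S T openin_Int[of "marked_forms_top a b" "?q S" "?q T"] by simp
    show "S \<inter> T \<subseteq> stratum a b" using S by auto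
  next
    fix \<K> assume K: "\<forall>S\<in>\<K>. S \<subseteq> stratum a b \<and> openin (marked_forms_top a b) (?q S)"
    have "?q (\<Union>\<K>) = \<Union>(?q ` \<K>)" by auto
    moreover have "openin (marked_forms_top a b) (\<Union>(?q ` \<K>))"
    proof (rule openin_Union)
      fix W assume "W \<in> ?q ` \<K>"
      then obtain S where "S \<in> \<K>" "W = ?q S" by (rule imageE) simp
      then show "openin (marked_forms_top a b) W" using K by simp
    qed
    ultimately show "openin (marked_forms_top a b) (?q (\<Union>\<K>))" by (simp only:)
    show "\<Union>\<K> \<subseteq> stratum a b" using K by auto
  qed
  from topology_inverse'[OF this] show ?thesis unfolding stratum_top_def by (rule fun_cong)
qed

text \<open>
  The tuple of residues is the same for all representatives of a class, so that
  \<^const>\<open>the_elem\<close> picks the common value.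
\<close>

definition residual_map :: "'p::finite marked_form set \<Rightarrow> complex ^ 'p" where
  "residual_map c = the_elem ((\<lambda>(f, x). \<chi> j. form_residue f (x j)) ` c)"


section \<open>The resonance arrangement\<close>

definition residual_space :: "(complex ^ 'p::finite) set" where
  "residual_space = {l. (\<Sum>j\<in>UNIV. l $ j) = 0}"

definition resonance_hyperplane :: "'p::finite set \<Rightarrow> (complex ^ 'p) set" where
  "resonance_hyperplane I = {l \<in> residual_space. (\<Sum>j\<in>I. l $ j) = 0}"

definition resonance_arrangement :: "(complex ^ 'p::finite) set" where
  "resonance_arrangement = (\<Union>I\<in>{I. I \<noteq> {} \<and> I \<noteq> UNIV}. resonance_hyperplane I)"

definition real_points :: "(complex ^ 'p::finite) set" where
  "real_points = {l. \<forall>j. l $ j \<in> \<real>}"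

definition real_chambers :: "(complex ^ 'p::finite) set set" where
  "real_chambers = components (residual_space \<inter> real_points - resonance_arrangement)"

definition secant :: "'p set \<Rightarrow> 'p set \<Rightarrow> bool" where
  "secant I J \<longleftrightarrow> I \<noteq> {} \<and> I \<noteq> UNIV \<and> J \<noteq> {} \<and> J \<noteq> UNIV \<and>
     I \<inter> J \<noteq> {} \<and> - I \<inter> J \<noteq> {} \<and> I \<inter> - J \<noteq> {} \<and> - I \<inter> - J \<noteq> {}"

text \<open>
  \<^const>\<open>facet_of\<close> refers to the real affine dimension. The closure of a chamber is a convex cone
  of real dimension \<open>p - 1\<close> inside the real points, so its facets have real dimension \<open>p - 2\<close>.
\<close>

definition wall_of :: "(complex ^ 'p::finite) set \<Rightarrow> 'p set \<Rightarrow> (complex ^ 'p) set \<Rightarrow> bool" where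
  "wall_of C I F \<longleftrightarrow> F facet_of closure C \<and> F \<subseteq> resonance_hyperplane I \<inter> real_points"

definition adjacent :: "(complex ^ 'p::finite) set \<Rightarrow> 'p set \<Rightarrow> bool" where
  "adjacent C I \<longleftrightarrow> (\<exists>F. wall_of C I F)"


section \<open>The loops and their monodromy\<close>

text \<open>
  The transverse disc is \<open>{n + z v | \<bar>z\<bar> \<le> 1}\<close>, with centre \<open>n\<close> in the relative interior of
  the face and \<open>n + v\<close> in the chamber. Along the circle \<open>n + exp (2 \<pi> \<i> t) v\<close> the
  sum over \<open>I\<close> of the coordinates is \<open>exp (2 \<pi> \<i> t)\<close> times its value on \<open>v\<close>.
  The complement of \<open>I\<close> has the same hyperplane as \<open>I\<close>, so hyperplanes rather than index sets
  are compared. All choices allowed here give homotopic loops.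
\<close>

definition resonance_loop ::
  "(complex ^ 'p::finite) set \<Rightarrow> 'p set \<Rightarrow> complex ^ 'p \<Rightarrow> (real \<Rightarrow> complex ^ 'p) \<Rightarrow> bool" where
  "resonance_loop C I l0 \<gamma> \<longleftrightarrow>
     (\<exists>F n v \<alpha>. wall_of C I F \<and> n \<in> rel_interior F \<and>
        v \<in> residual_space \<and> (\<Sum>j\<in>I. v $ j) \<noteq> 0 \<and>
        (\<forall>K. K \<noteq> {} \<and> K \<noteq> UNIV \<and> resonance_hyperplane K \<noteq> resonance_hyperplane I \<longrightarrow>
           (\<forall>z. cmod z \<le> 1 \<longrightarrow> n + z *s v \<notin> resonance_hyperplane K)) \<and>
        path \<alpha> \<and> path_image \<alpha> \<subseteq> C \<and> pathstart \<alpha> = l0 \<and> pathfinish \<alpha> = n + v \<and>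
        \<gamma> = \<alpha> +++ (\<lambda>t. n + exp (2 * of_real pi * \<i> * of_real t) *s v) +++ reversepath \<alpha>)"

definition residual_fiber :: "nat \<Rightarrow> ('p::finite \<Rightarrow> nat) \<Rightarrow> complex ^ 'p \<Rightarrow> 'p marked_form set set" where
  "residual_fiber a b l = {c \<in> stratum a b. residual_map c = l}"

definition is_lift ::
  "nat \<Rightarrow> ('p::finite \<Rightarrow> nat) \<Rightarrow> (real \<Rightarrow> complex ^ 'p) \<Rightarrow> (real \<Rightarrow> 'p marked_form set) \<Rightarrow> bool" where
  "is_lift a b \<gamma> g \<longleftrightarrow>
     pathin (stratum_top a b) g \<and> (\<forall>t\<in>{0..1}. residual_map (g t) = \<gamma> t)"

text \<open>
  The end point of the lift of \<open>\<gamma>\<close> starting at \<open>c\<close>. It exists and is unique for loops outside the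
  resonance arrangement, over which the residual map is a covering.
\<close>

definition monodromy ::
  "nat \<Rightarrow> ('p::finite \<Rightarrow> nat) \<Rightarrow> (real \<Rightarrow> complex ^ 'p) \<Rightarrow> 'p marked_form set \<Rightarrow> 'p marked_form set" where
  "monodromy a b \<gamma> c = (THE d. \<exists>g. is_lift a b \<gamma> g \<and> g 0 = c \<and> g 1 = d)"

end

theory Submission
  imports Defs
begin

text \<open>
  An automorphism of the sphere moves the zero of a form to infinity and brings the form to the shape
  \<open>dz / (\<Prod>j. (z - x j) ^ b j)\<close>, where the poles \<open>x j\<close> are determined by the isomorphism class up
  to an affine map. On configurations \<open>x\<close> with one pole at \<open>0\<close>, the residue map over the complement
  of the resonance arrangement is locally injective, since a variation of the poles that keeps all
  residues is a translation, and proper, since rescaling around poles that collide or escape exhibits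
  a resonance in the limit. Hence it is a covering.

  The vectors whose real part lies in a chamber form a convex set free of resonance, to which the
  covering restricts trivially. Inside it the small circles around the two walls can be translated far
  in an imaginary direction lying in both hyperplanes and in no other one. There they can be deformed
  into the two coordinate circles of a torus that meets no resonance hyperplane, which commute.
\<close>

text \<open>Secancy enters through one fact: the only resonance hyperplanes containing the
  intersection of those of I and J are these two. For disjoint I and J that do not exhaust all
  labels, the sum over the union would vanish there too, and this third hyperplane would stand in
  the way of the torus. The stratum itself, a quotient with a topology given by generators, is a
  poor place for a covering argument; configurations of poles replace it. Over nonresonant residues
  a class fixes its configuration with one pole at 0 up to an (a + 1)-th root of unity. The residue
  at that pole is minus the sum of the others; putting the position of the pole in its place gives a
  map between open sets of one euclidean space, to which invariance of domain applies. The way back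
  needs paths of the stratum to lift to configurations. Cross ratios of the zero and the poles give
  the configuration up to scale, continuously, and the scale is an (a + 1)-th root of a nowhere
  vanishing function on an interval.\<close>

unbundle no Formal_Power_Series.fps_syntax

section \<open>Proper local injections\<close>

text \<open>
  Properness is phrased with sequences: a sequence in \<open>E\<close> whose image converges in \<open>B\<close> has a
  subsequence converging in \<open>E\<close>.
\<close>

locale proper_local_injection =
  fixes E :: "'a::euclidean_space set" and p :: "'a \<Rightarrow> 'a" and B :: "'a set"
  assumes open_E: "open E" and open_B: "open B" and cont: "continuous_on E p" and into: "p ` E \<subseteq> B"
    and loc_inj: "\<And>x. x \<in> E \<Longrightarrow> \<exists>U. open U \<and> x \<in> U \<and> U \<subseteq> E \<and> inj_on p U"
    and proper: "\<And>s y. (\<And>n. s n \<in> E) \<Longrightarrow> (\<lambda>n. p (s n)) \<longlonglongrightarrow> y \<Longrightarrow> y \<in> B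
       \<Longrightarrow> \<exists>x\<in>E. \<exists>r. strict_mono (r :: nat \<Rightarrow> nat) \<and> (s \<circ> r) \<longlonglongrightarrow> x"
begin

lemma tendsto_p: "x \<in> E \<Longrightarrow> s \<longlonglongrightarrow> x \<Longrightarrow> (\<lambda>n. p (s n)) \<longlonglongrightarrow> p x"
  by (rule isCont_tendsto_compose[of x p]) (use cont open_E continuous_on_eq_continuous_at in auto)

text \<open>Domain and target lie in the same euclidean space, so invariance of domain makes a
  continuous local injection open.\<close>

lemma open_image: "open U \<Longrightarrow> U \<subseteq> E \<Longrightarrow> open (p ` U)"
proof (subst open_subopen, clarify)
  fix x assume U: "open U" "U \<subseteq> E" "x \<in> U"
  then obtain V where V: "open V" "x \<in> V" "V \<subseteq> E" "inj_on p V" using loc_inj by blast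
  have "open (p ` (U \<inter> V))"
    by (rule invariance_of_domain) (use U V cont in \<open>auto intro: continuous_on_subset inj_on_subset\<close>)
  then show "\<exists>T. open T \<and> p x \<in> T \<and> T \<subseteq> p ` U" using U V by blast
qed

lemma closed_image:
  assumes "y \<in> B" "y \<in> closure (p ` E)" shows "y \<in> p ` E"
proof -
  obtain q where q: "\<And>n. q n \<in> p ` E" "q \<longlonglongrightarrow> y" using assms(2) closure_sequential by blast
  then have "\<forall>n. \<exists>s. s \<in> E \<and> q n = p s" by auto
  then obtain s where s: "\<And>n. s n \<in> E" "\<And>n. q n = p (s n)" by metis
  then have "q = (\<lambda>n. p (s n))" by auto
  with s q assms(1) obtain x r where x: "x \<in> E" "strict_mono (r :: nat \<Rightarrow> nat)" "(s \<circ> r) \<longlonglongrightarrow> x"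
    using proper[of s y] by auto
  have "(\<lambda>n. p ((s \<circ> r) n)) \<longlonglongrightarrow> p x" by (rule tendsto_p[OF x(1,3)])
  moreover have "(\<lambda>n. p ((s \<circ> r) n)) \<longlonglongrightarrow> y"
    using LIMSEQ_subseq_LIMSEQ[OF \<open>q \<longlonglongrightarrow> y\<close> x(2)] s by (simp add: o_def)
  ultimately have "p x = y" by (rule LIMSEQ_unique)
  with x show ?thesis by auto
qed

text \<open>Within S the image of E is open by invariance of domain and closed by properness, hence
  all of S once it meets S.\<close>

lemma connected_subset_image:
  assumes "connected S" "S \<subseteq> B" "S \<inter> p ` E \<noteq> {}"
  shows "S \<subseteq> p ` E"
proof -
  have "openin (top_of_set S) (S \<inter> p ` E)"
    using open_image[OF open_E order.refl] by (rule openin_open_Int)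
  moreover have "S \<inter> p ` E = S \<inter> closure (p ` E)"
    using closed_image assms(2) closure_subset by fastforce
  then have "closedin (top_of_set S) (S \<inter> p ` E)" by (simp add: closedin_closed_Int)
  ultimately show ?thesis using assms(1,3) unfolding connected_clopen by blast
qed

text \<open>By properness an infinite fibre would accumulate at a point of E, where local
  injectivity leaves room for only one point of the fibre.\<close>

lemma finite_fibre: "y \<in> B \<Longrightarrow> finite {x \<in> E. p x = y}"
proof (rule ccontr)
  assume y: "y \<in> B" and "infinite {x \<in> E. p x = y}"
  then obtain s :: "nat \<Rightarrow> 'a" where s: "inj s" "range s \<subseteq> {x \<in> E. p x = y}"
    using infinite_countable_subset by blast
  then obtain x r where x: "x \<in> E" "strict_mono (r :: nat \<Rightarrow> nat)" "(s \<circ> r) \<longlonglongrightarrow> x"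
    using proper[of s y] y by (auto simp: image_subset_iff)
  obtain U where U: "open U" "x \<in> U" "inj_on p U" using loc_inj x(1) by blast
  then have "\<forall>\<^sub>F n in sequentially. (s \<circ> r) n \<in> U" using x(3) topological_tendstoD by blast
  then obtain N where N: "(s \<circ> r) n \<in> U" if "n \<ge> N" for n by (auto simp: eventually_sequentially)
  have "(s \<circ> r) N = (s \<circ> r) (Suc N)"
    by (rule inj_onD[OF U(3)]) (use N[of N] N[of "Suc N"] s in \<open>auto simp: image_subset_iff\<close>)
  then have "r N = r (Suc N)" using s(1) by (simp add: inj_eq)
  then show False using x(2) by (metis n_not_Suc_n strict_mono_eq)
qed

text \<open>The sheets over y are small disjoint neighbourhoods of the finitely many preimages.
  Properness ensures that nothing else lies over a small ball: points outside all sheets with images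
  tending to y would accumulate at a point of the fibre, which is interior to a sheet.\<close>

lemma covering: "covering_space E p (p ` E)"
proof
  fix y assume y: "y \<in> p ` E"
  then have yB: "y \<in> B" using into by auto
  define X where "X = {x \<in> E. p x = y}"
  have finX: "finite X" unfolding X_def by (rule finite_fibre[OF yB])
  have "\<exists>U. open U \<and> x \<in> U \<and> U \<subseteq> E \<and> inj_on p U" if "x \<in> X" for x
    using loc_inj that by (auto simp: X_def)
  then obtain U0 where U0: "\<And>x. x \<in> X \<Longrightarrow> open (U0 x) \<and> x \<in> U0 x \<and> U0 x \<subseteq> E \<and> inj_on p (U0 x)"
    by metis
  obtain D where D: "\<And>u. D u > 0" "\<And>u v. v \<in> X \<Longrightarrow> v \<noteq> u \<Longrightarrow> D u \<le> dist u v"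
    using finite_set_avoid[OF finX] by metis
  define d where "d = Min (D ` X)"
  have "X \<noteq> {}" using y by (auto simp: X_def)
  then have d: "d > 0" "\<And>u v. u \<in> X \<Longrightarrow> v \<in> X \<Longrightarrow> u \<noteq> v \<Longrightarrow> d \<le> dist u v"
    using D finX by (auto simp: d_def intro: order.trans[OF Min_le])
  define U where "U = (\<lambda>x. U0 x \<inter> ball x (d / 2))"
  have U: "open (U x)" "x \<in> U x" "U x \<subseteq> E" "inj_on p (U x)" if "x \<in> X" for x
    using U0[OF that] d(1) by (auto simp: U_def intro: inj_on_subset)
  have disj: "U u \<inter> U v = {}" if "u \<in> X" "v \<in> X" "u \<noteq> v" for u v
    using d(2)[OF that] dist_triangle_half_r by (fastforce simp: U_def dist_commute)
  have "\<exists>e>0. ball y e \<subseteq> B \<and> E \<inter> p -` ball y e \<subseteq> (\<Union>x\<in>X. U x)"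
  proof (rule ccontr)
    assume neg: "\<not> ?thesis"
    obtain e0 where e0: "e0 > 0" "ball y e0 \<subseteq> B" using open_B yB openE by blast
    have "\<exists>x. x \<in> E \<and> dist y (p x) < min e0 (1 / Suc n) \<and> x \<notin> (\<Union>x\<in>X. U x)" for n :: nat
    proof -
      have "min e0 (1 / Suc n) > 0" "ball y (min e0 (1 / Suc n)) \<subseteq> B" using e0 by auto
      with neg show ?thesis by (metis IntE mem_ball subsetI vimage_eq)
    qed
    then obtain s where s: "\<And>n. s n \<in> E" "\<And>n. dist y (p (s n)) < 1 / Suc n" "\<And>n. s n \<notin> (\<Union>x\<in>X. U x)"
      by (metis min_less_iff_conj)
    have "(\<lambda>n. p (s n)) \<longlonglongrightarrow> y"
    proof (rule metric_LIMSEQ_I)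
      fix r :: real assume "r > 0"
      then obtain N where "1 / real (Suc N) < r" using nat_approx_posE by blast
      then have "dist (p (s n)) y < r" if "n \<ge> N" for n
        using s(2)[of n] that frac_le[of 1 1 "real (Suc N)" "real (Suc n)"] by (simp add: dist_commute)
      then show "\<exists>no. \<forall>n\<ge>no. dist (p (s n)) y < r" by blast
    qed
    then obtain x r where x: "x \<in> E" "strict_mono (r :: nat \<Rightarrow> nat)" "(s \<circ> r) \<longlonglongrightarrow> x"
      using proper[of s y] s yB by auto
    have "(\<lambda>n. p ((s \<circ> r) n)) \<longlonglongrightarrow> p x" by (rule tendsto_p[OF x(1,3)])
    moreover have "(\<lambda>n. p ((s \<circ> r) n)) \<longlonglongrightarrow> y"
      using LIMSEQ_subseq_LIMSEQ[OF \<open>(\<lambda>n. p (s n)) \<longlonglongrightarrow> y\<close> x(2)] by (simp add: o_def)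
    ultimately have "x \<in> X" using x(1) LIMSEQ_unique by (auto simp: X_def)
    then have "\<forall>\<^sub>F n in sequentially. (s \<circ> r) n \<in> U x" using x(3) U topological_tendstoD by blast
    then have "\<exists>n. (s \<circ> r) n \<in> U x" by (meson eventually_happens' sequentially_bot)
    with s(3) \<open>x \<in> X\<close> show False by auto
  qed
  then obtain e where e: "e > 0" "ball y e \<subseteq> B" "E \<inter> p -` ball y e \<subseteq> (\<Union>x\<in>X. U x)" by blast
  \<comment> \<open>Intersecting the ball with the images of all sheets makes every sheet, cut down
    to the preimage of T, map onto T.\<close>
  define T where "T = ball y e \<inter> (\<Inter>x\<in>X. p ` U x) \<inter> p ` E"
  have openT: "open T"
    unfolding T_def using finX U open_image open_E by (intro open_Int open_INT) auto
  have yT: "y \<in> T"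
    proof -
    have "y \<in> p ` U x" if "x \<in> X" for x using U(2)[OF that] that by (auto simp: X_def)
    then show ?thesis unfolding T_def using e(1) y by auto
  qed
  define v where "v = (\<lambda>x. U x \<inter> p -` T) ` X"
  have openU: "open (U x \<inter> p -` T)" if "x \<in> X" for x
    using continuous_open_preimage[of "U x" p T] U[OF that] openT cont continuous_on_subset
    by (metis)
  have 1: "\<Union>v = E \<inter> p -` T"
    unfolding v_def using e(3) U(3) by (fastforce simp: T_def)
  have 2: "\<forall>u\<in>v. openin (top_of_set E) u"
    unfolding v_def using openU U(3) by (auto intro!: open_subset)
  have 3: "pairwise disjnt v"
    unfolding v_def using disj by (fastforce simp: pairwise_def disjnt_def)
  have 4: "\<forall>u\<in>v. \<exists>q. homeomorphism u T p q"
  proof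
    fix u assume "u \<in> v"
    then obtain x where x: "x \<in> X" "u = U x \<inter> p -` T" by (auto simp: v_def)
    have "T \<subseteq> p ` U x" using x(1) by (auto simp: T_def)
    then have im: "p ` u = T" unfolding x(2) by blast
    have "continuous_on u p" "inj_on p u" "open u"
      using x U[OF x(1)] openU cont by (auto intro: continuous_on_subset inj_on_subset)
    then obtain q where "homeomorphism u (p ` u) p q"
      using invariance_of_domain_homeomorphism by blast
    with im show "\<exists>q. homeomorphism u T p q" by auto
  qed
  have "openin (top_of_set (p ` E)) T" using openT by (intro open_subset) (auto simp: T_def)
  with yT 1 2 3 4 show "\<exists>T. y \<in> T \<and> openin (top_of_set (p ` E)) T \<and> (\<exists>v. \<Union>v = E \<inter> p -` T \<and>
      (\<forall>u\<in>v. openin (top_of_set E) u) \<and> pairwise disjnt v \<and> (\<forall>u\<in>v. \<exists>q. homeomorphism u T p q))"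
    by blast
qed (use cont in auto)

text \<open>A convex set is simply connected and locally path connected, so the lifting criterion
  for coverings puts no condition on H beyond its image. The free choice of the space around Z lets
  the lemma serve intervals, squares and tubes alike.\<close>

lemma lift_convex:
  fixes H :: "'c::real_normed_vector \<Rightarrow> 'a"
  assumes "convex Z" "continuous_on Z H" "H ` Z \<subseteq> B" "z0 \<in> Z" "x0 \<in> E" "p x0 = H z0"
  shows "\<exists>h. continuous_on Z h \<and> h ` Z \<subseteq> E \<and> h z0 = x0 \<and> (\<forall>z\<in>Z. p (h z) = H z)"
proof -
  have "H ` Z \<subseteq> p ` E"
    by (rule connected_subset_image)
       (use assms in \<open>auto intro: connected_continuous_image convex_connected\<close>)
  then have "H \<in> Z \<rightarrow> p ` E" by blast
  show ?thesis
  proof (rule covering_space_lift_strong[OF covering assms(5,4) convex_imp_simply_connected[OF assms(1)]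
      convex_imp_locally_path_connected[OF assms(1)] assms(2) \<open>H \<in> Z \<rightarrow> p ` E\<close> assms(6)[symmetric]])
    fix h assume "continuous_on Z h" "h \<in> Z \<rightarrow> E" "h z0 = x0" "\<And>y. y \<in> Z \<Longrightarrow> p (h y) = H y"
    then show ?thesis by (intro exI[of _ h]) auto
  qed
qed

lemma lift_unique:
  fixes g h :: "'c::real_normed_vector \<Rightarrow> 'a"
  assumes "convex Z" "continuous_on Z g" "g ` Z \<subseteq> E" "continuous_on Z h" "h ` Z \<subseteq> E"
    "\<And>z. z \<in> Z \<Longrightarrow> p (g z) = p (h z)" "z0 \<in> Z" "g z0 = h z0" "z \<in> Z"
  shows "g z = h z"
proof (rule covering_space_lift_unique[OF covering, of g z0 h Z "\<lambda>z. p (g z)"])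
  show "continuous_on Z (\<lambda>z. p (g z))" using assms cont continuous_on_compose2 by blast
qed (use assms in \<open>auto intro: convex_connected[OF assms(1)]\<close>)

end

section \<open>Rational forms with vanishing residues\<close>

text \<open>Induction on the total multiplicity: subtracting a multiple of the product Q of the
  other factors makes the numerator vanish at one pole w0, where a linear factor then cancels.
  \<open>N = 0\<close> is listed separately because for total multiplicity 0 the strict degree bound
  has no solution.\<close>

lemma partial_fractions:
  fixes N :: "complex poly" and m :: "complex \<Rightarrow> nat"
  assumes "finite W" "N = 0 \<or> degree N < (\<Sum>w\<in>W. m w)"
  shows "\<exists>a. \<forall>z. z \<notin> W \<longrightarrow>
           poly N z / (\<Prod>w\<in>W. (z - w) ^ m w) = (\<Sum>w\<in>W. \<Sum>k=1..m w. a w k / (z - w) ^ k)"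
  using assms(2)
proof (induction "\<Sum>w\<in>W. m w" arbitrary: N m)
  case 0
  then have "N = 0" by auto
  then show ?case by (intro exI[of _ "\<lambda>_ _. 0"]) simp
next
  case (Suc M m N)
  have "\<exists>w\<in>W. m w > 0"
    by (rule ccontr) (use Suc(2) in simp)
  then obtain w0 where w0: "w0 \<in> W" "m w0 > 0" by blast
  define m' where "m' = m(w0 := m w0 - 1)"
  define Q where "Q = (\<Prod>v\<in>W - {w0}. [:-v, 1:] ^ m v)"
  have sumW: "(\<Sum>w\<in>W. h w) = h w0 + (\<Sum>w\<in>W - {w0}. h w)" for h :: "complex \<Rightarrow> nat"
    using w0 assms(1) by (simp add: sum.remove)
  have sumW': "(\<Sum>w\<in>W. h w) = h w0 + (\<Sum>w\<in>W - {w0}. h w)" for h :: "complex \<Rightarrow> complex"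
    using w0 assms(1) by (simp add: sum.remove)
  have prodW: "(\<Prod>w\<in>W. h w) = h w0 * (\<Prod>w\<in>W - {w0}. h w)" for h :: "complex \<Rightarrow> complex"
    using w0 assms(1) by (simp add: prod.remove)
  have m'sum: "(\<Sum>w\<in>W - {w0}. m' w) = (\<Sum>w\<in>W - {w0}. m w)"
    by (intro sum.cong) (auto simp: m'_def)
  have M: "M = (\<Sum>w\<in>W. m' w)"
    using Suc(2) w0 sumW[of m] sumW[of m'] m'sum by (simp add: m'_def)
  have degQ: "degree Q = (\<Sum>v\<in>W - {w0}. m v)"
    unfolding Q_def by (subst degree_prod_eq_sum_degree) (auto simp: degree_power_eq)
  have Qz: "poly Q z = (\<Prod>v\<in>W - {w0}. (z - v) ^ m v)" for z
    by (simp add: Q_def poly_prod)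
  have Qw0: "poly Q w0 \<noteq> 0"
    using assms(1) by (auto simp: Qz)
  define c where "c = poly N w0 / poly Q w0"
  have "poly (N - smult c Q) w0 = 0" using Qw0 by (simp add: c_def)
  then obtain N1 where N1: "N - smult c Q = [:-w0, 1:] * N1"
    using poly_eq_0_iff_dvd by blast
  have "N1 = 0 \<or> degree N1 < M"
  proof (cases "N1 = 0")
    case False
    have "degree (N - smult c Q) \<le> M"
    proof (rule degree_diff_le)
      show "degree N \<le> M" using Suc(2,3) by auto
      have "degree Q \<le> M" using Suc(2) w0 sumW[of m] degQ by simp
      then show "degree (smult c Q) \<le> M" using degree_smult_le order_trans by blast
    qed
    moreover have "degree (N - smult c Q) = 1 + degree N1"
      unfolding N1 using False by (subst degree_mult_eq) auto
    ultimately show ?thesis by simp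
  qed simp
  from Suc(1)[OF M, unfolded M[symmetric], OF this] obtain a' where a':
    "\<And>z. z \<notin> W \<Longrightarrow> poly N1 z / (\<Prod>w\<in>W. (z - w) ^ m' w) = (\<Sum>w\<in>W. \<Sum>k=1..m' w. a' w k / (z - w) ^ k)"
    by blast
  define a where "a = (\<lambda>w k. if w = w0 \<and> k = m w0 then c else a' w k)"
  show ?case
  proof (intro exI[of _ a] allI impI)
    fix z assume z: "z \<notin> W"
    then have zw0: "z \<noteq> w0" using w0 by auto
    have Qnz: "poly Q z \<noteq> 0" using assms(1) z by (auto simp: Qz)
    have "poly N z = poly (N - smult c Q) z + c * poly Q z" by simp
    also have "poly (N - smult c Q) z = (z - w0) * poly N1 z" unfolding N1 by (simp add: algebra_simps)
    finally have "poly N z / (\<Prod>w\<in>W. (z - w) ^ m w)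
        = (z - w0) * poly N1 z / ((z - w0) ^ m w0 * poly Q z) + c / (z - w0) ^ m w0"
      using Qnz by (simp add: prodW Qz[symmetric] add_divide_distrib)
    also have "(z - w0) ^ m w0 = (z - w0) * (z - w0) ^ m' w0"
      using w0 by (simp add: m'_def flip: power_Suc)
    also have "(z - w0) * poly N1 z / ((z - w0) * (z - w0) ^ m' w0 * poly Q z) =
        poly N1 z / ((z - w0) ^ m' w0 * poly Q z)"
      using zw0 by simp
    also have "(z - w0) ^ m' w0 * poly Q z = (\<Prod>w\<in>W. (z - w) ^ m' w)"
      unfolding prodW[of "\<lambda>w. (z - w) ^ m' w"] Qz
      by (intro arg_cong2[of _ _ _ _ "(*)"] prod.cong) (auto simp: m'_def)
    also have "poly N1 z / (\<Prod>w\<in>W. (z - w) ^ m' w) =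
       (\<Sum>k=1..m' w0. a' w0 k / (z - w0) ^ k) + (\<Sum>w\<in>W - {w0}. \<Sum>k=1..m' w. a' w k / (z - w) ^ k)"
      unfolding a'[OF z] sumW' ..
    also have "(\<Sum>w\<in>W - {w0}. \<Sum>k=1..m' w. a' w k / (z - w) ^ k) = (\<Sum>w\<in>W - {w0}. \<Sum>k=1..m w. a w k / (z - w) ^ k)"
      by (intro sum.cong) (auto simp: m'_def a_def)
    also have "(\<Sum>k=1..m' w0. a' w0 k / (z - w0) ^ k) = (\<Sum>k=1..m' w0. a w0 k / (z - w0) ^ k)"
      by (intro sum.cong) (auto simp: m'_def a_def)
    also have "(z - w0) * (z - w0) ^ m' w0 = (z - w0) ^ m w0"
      using w0 by (simp add: m'_def flip: power_Suc)
    finally show "poly N z / (\<Prod>w\<in>W. (z - w) ^ m w) = (\<Sum>w\<in>W. \<Sum>k=1..m w. a w k / (z - w) ^ k)"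
    proof -
      assume eq: "poly N z / (\<Prod>w\<in>W. (z - w) ^ m w) =
         (\<Sum>k = 1..m' w0. a w0 k / (z - w0) ^ k) +
         (\<Sum>w\<in>W - {w0}. \<Sum>k = 1..m w. a w k / (z - w) ^ k) + c / (z - w0) ^ m w0"
      have "{1..m w0} = insert (m w0) {1..m' w0}" "m w0 \<notin> {1..m' w0}"
        using w0 by (auto simp: m'_def)
      then have "(\<Sum>k=1..m w0. a w0 k / (z - w0) ^ k) = c / (z - w0) ^ m w0 + (\<Sum>k=1..m' w0. a w0 k / (z - w0) ^ k)"
        by (simp add: a_def)
      then show ?thesis
        unfolding eq sumW'[of "\<lambda>w. \<Sum>k = 1..m w. a w k / (z - w) ^ k"] by simp
    qed
  qed
qed

lemma residue_const_over_power:
  "residue (\<lambda>z. c / (z - w) ^ k) w' = (if w = w' \<and> k = 1 then c else 0)"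
proof (cases "w = w' \<and> k > 0")
  case False
  show ?thesis
  proof (cases "k = 0")
    case True
    then show ?thesis by (auto simp: residue_const)
  next
    case k: False
    with False have "w \<noteq> w'" by auto
    then have "residue (\<lambda>z. c / (z - w) ^ k) w' = 0"
      by (intro residue_holo[of "- {w}"]) (auto intro!: holomorphic_intros)
    with \<open>w \<noteq> w'\<close> show ?thesis by auto
  qed
next
  case True
  then obtain n where n: "k = Suc n" by (cases k) auto
  have d0: "(deriv ^^ n) (\<lambda>_. 0::complex) = (\<lambda>_. 0)" for n
    by (induction n) auto
  have "(deriv ^^ n) (\<lambda>_. c) w' = (if n = 0 then c else 0)"
    by (cases n) (auto simp: funpow_swap1 d0)
  then show ?thesis
    using residue_holomorphic_over_power[of UNIV w' "\<lambda>_. c" n] True n by auto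
qed

text \<open>In degree n + d - 1 the two products have as coefficients n and d times the same nonzero
  number, which cannot cancel for n < d. The polynomial is the numerator of the derivative of G /
  D.\<close>

lemma degree_wronskian_ge:
  fixes G D :: "complex poly"
  assumes "G \<noteq> 0" "degree G < degree D"
  shows "degree G + degree D - 1 \<le> degree (pderiv G * D - G * pderiv D)"
    and "pderiv G * D - G * pderiv D \<noteq> 0"
proof -
  let ?n = "degree G" and ?d = "degree D"
  have 1: "coeff (pderiv G * D) (?n + ?d - 1) = of_nat ?n * lead_coeff G * lead_coeff D"
  proof (cases "?n = 0")
    case True
    then have "pderiv G = 0" by (simp add: pderiv_eq_0_iff)
    with True show ?thesis by simp
  next
    case False
    have "coeff (pderiv G * D) (degree (pderiv G) + ?d) = coeff (pderiv G) (degree (pderiv G)) * lead_coeff D"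
      by (rule coeff_mult_degree_sum)
    moreover have "degree (pderiv G) + ?d = ?n + ?d - 1" using False by (simp add: degree_pderiv)
    moreover have "coeff (pderiv G) (degree (pderiv G)) = of_nat ?n * lead_coeff G"
      using False by (simp add: degree_pderiv coeff_pderiv)
    ultimately show ?thesis by simp
  qed
  have 2: "coeff (G * pderiv D) (?n + ?d - 1) = of_nat ?d * lead_coeff G * lead_coeff D"
  proof -
    have "coeff (G * pderiv D) (?n + degree (pderiv D)) = lead_coeff G * coeff (pderiv D) (degree (pderiv D))"
      by (rule coeff_mult_degree_sum)
    moreover have "?n + degree (pderiv D) = ?n + ?d - 1" using assms by (simp add: degree_pderiv)
    moreover have "coeff (pderiv D) (degree (pderiv D)) = of_nat ?d * lead_coeff D"
      using assms by (simp add: degree_pderiv coeff_pderiv)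
    ultimately show ?thesis by simp
  qed
  have "coeff (pderiv G * D - G * pderiv D) (?n + ?d - 1) = (of_nat ?n - of_nat ?d) * (lead_coeff G * lead_coeff D)"
    using 1 2 by (simp add: algebra_simps)
  also have "\<dots> \<noteq> 0" using assms by auto
  finally have "coeff (pderiv G * D - G * pderiv D) (?n + ?d - 1) \<noteq> 0" .
  then show "degree G + degree D - 1 \<le> degree (pderiv G * D - G * pderiv D)"
    and "pderiv G * D - G * pderiv D \<noteq> 0"
    by (auto intro: le_degree)
qed

lemma residue_sum:
  assumes "open S" "z \<in> S" "\<And>i. i \<in> A \<Longrightarrow> f i holomorphic_on S - {z}"
  shows "residue (\<lambda>x. \<Sum>i\<in>A. f i x) z = (\<Sum>i\<in>A. residue (f i) z)"
  using assms(3)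
proof (induction A rule: infinite_finite_induct)
  case (insert i A)
  have "residue (\<lambda>x. f i x + (\<Sum>i\<in>A. f i x)) z = residue (f i) z + residue (\<lambda>x. \<Sum>i\<in>A. f i x) z"
    by (rule residue_add[OF assms(1,2)]) (auto intro!: holomorphic_on_sum insert)
  with insert show ?case by simp
qed (auto simp: residue_const)

text \<open>Without residues the function has a rational primitive G / D, where D lowers every
  multiplicity by one. With the product E of the distinct linear factors this gives E (G' D - G D')
  = N D, and the lower degree bound for G' D - G D' forces deg N >= card W - 1.\<close>

lemma rational_residues_zero:
  fixes N :: "complex poly" and m :: "complex \<Rightarrow> nat"
  assumes W: "finite W" "\<And>w. w \<in> W \<Longrightarrow> m w \<ge> 1" and N: "degree N + 2 \<le> card W"
    and res: "\<And>w. w \<in> W \<Longrightarrow> residue (\<lambda>z. poly N z / (\<Prod>w\<in>W. (z - w) ^ m w)) w = 0"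
  shows "N = 0"
proof (rule ccontr)
  assume "N \<noteq> 0"
  have "card W \<le> (\<Sum>w\<in>W. m w)"
    using sum_mono[of W "\<lambda>_. 1" m] W by simp
  then obtain a where a: "\<And>z. z \<notin> W \<Longrightarrow>
      poly N z / (\<Prod>w\<in>W. (z - w) ^ m w) = (\<Sum>w\<in>W. \<Sum>k=1..m w. a w k / (z - w) ^ k)"
    using partial_fractions[of W N m] W N by auto
  \<comment> \<open>The coefficient of 1 / (z - w) is the residue at w; this is the only kind of
    term without a rational primitive.\<close>
  have a1: "a w 1 = 0" if w: "w \<in> W" for w
  proof -
    have fin: "\<forall>\<^sub>F z in at w. z \<notin> W"
      using W(1) islimpt_finite[OF W(1)] by (auto simp: islimpt_iff_eventually)
    have "0 = residue (\<lambda>z. poly N z / (\<Prod>w\<in>W. (z - w) ^ m w)) w" using res w by simp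
    also have "\<dots> = residue (\<lambda>z. \<Sum>w\<in>W. \<Sum>k=1..m w. a w k / (z - w) ^ k) w"
      by (rule residue_cong) (use eventually_mono[OF fin a] in auto)
    also have "\<dots> = (\<Sum>v\<in>W. \<Sum>k=1..m v. residue (\<lambda>z. a v k / (z - v) ^ k) w)"
    proof -
      define S where "S = - (W - {w})"
      have S: "open S" "w \<in> S"
        unfolding S_def by (intro open_Compl finite_imp_closed finite_Diff W(1)) simp
      have h: "(\<lambda>z. a v k / (z - v) ^ k) holomorphic_on S - {w}" if "v \<in> W" for v k
        using that by (auto simp: S_def intro!: holomorphic_intros)
      show ?thesis
        by (subst residue_sum[OF S], intro holomorphic_on_sum h, assumption,
            intro sum.cong refl residue_sum[OF S] h)
    qed
    also have "\<dots> = (\<Sum>v\<in>W. if v = w then a v 1 else 0)"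
    proof (rule sum.cong)
      fix v assume "v \<in> W"
      have "(\<Sum>k=1..m v. residue (\<lambda>z. a v k / (z - v) ^ k) w) = (\<Sum>k=1..m v. if k = 1 then (if v = w then a v 1 else 0) else 0)"
        by (intro sum.cong) (auto simp: residue_const_over_power)
      also have "\<dots> = (if v = w then a v 1 else 0)"
        using W(2)[OF \<open>v \<in> W\<close>] by (simp add: sum.delta)
      finally show "(\<Sum>k=1..m v. residue (\<lambda>z. a v k / (z - v) ^ k) w) = (if v = w then a v 1 else 0)" .
    qed simp
    also have "\<dots> = a w 1" using W(1) w by simp
    finally show ?thesis by simp
  qed
  define D where "D = (\<Prod>w\<in>W. [:-w, 1:] ^ (m w - 1))"
  define E where "E = (\<Prod>w\<in>W. [:-w, 1:])"
  \<comment> \<open>The numerator, over the common denominator D, of the primitive - a / ((k - 1) (z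
    - w) ^ (k - 1)) of one term.\<close>
  define T where "T = (\<lambda>w k. smult (- a w k / of_nat (k - 1))
      ([:-w, 1:] ^ (m w - k) * (\<Prod>v\<in>W - {w}. [:-v, 1:] ^ (m v - 1))))"
  define G where "G = (\<Sum>w\<in>W. \<Sum>k=2..m w. T w k)"
  have Dnz: "poly D z \<noteq> 0" if "z \<notin> W" for z
    using that W(1) by (auto simp: D_def poly_prod)
  have D0: "D \<noteq> 0"
    using Dnz ex_new_if_finite[OF infinite_UNIV_char_0 W(1)] by auto
  have degD: "degree D = (\<Sum>w\<in>W. m w - 1)"
    unfolding D_def by (subst degree_prod_eq_sum_degree) (auto simp: degree_power_eq)
  have degE: "degree E = card W" "E \<noteq> 0"
    unfolding E_def by (subst degree_prod_eq_sum_degree) (use W(1) in auto)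
  have DE: "poly D z * poly E z = (\<Prod>w\<in>W. (z - w) ^ m w)" for z
    unfolding D_def E_def poly_prod prod.distrib[symmetric]
  proof (rule prod.cong)
    fix w assume "w \<in> W"
    then have "m w = Suc (m w - 1)" using W(2)[of w] by simp
    then have "(z - w) ^ m w = (z - w) ^ (m w - 1) * (z - w)" by (metis power_Suc2)
    then show "poly ([:- w, 1:] ^ (m w - 1)) z * poly [:- w, 1:] z = (z - w) ^ m w" by simp
  qed simp
  have degG: "G = 0 \<or> degree G < degree D"
  proof (cases "degree D = 0")
    case True
    then have "\<And>w. w \<in> W \<Longrightarrow> m w - 1 = 0" using W(1) degD by auto
    then have "\<And>w. w \<in> W \<Longrightarrow> {2..m w} = {}" by fastforce
    then have "G = 0" by (simp add: G_def)
    then show ?thesis ..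
  next
    case False
    have "degree (T w k) < degree D" if "w \<in> W" "k \<in> {2..m w}" for w k
    proof -
      have "degree (T w k) \<le> degree ([:-w, 1:] ^ (m w - k) * (\<Prod>v\<in>W - {w}. [:-v, 1:] ^ (m v - 1)))"
        unfolding T_def by (rule degree_smult_le)
      also have "\<dots> = (m w - k) + (\<Sum>v\<in>W - {w}. m v - 1)"
        by (subst degree_mult_eq) (auto simp: degree_power_eq degree_prod_eq_sum_degree W(1))
      also have "\<dots> < (m w - 1) + (\<Sum>v\<in>W - {w}. m v - 1)" using that by auto
      also have "\<dots> = degree D" unfolding degD using that W(1) by (simp add: sum.remove)
      finally show ?thesis .
    qed
    then have "degree G < degree D" unfolding G_def
      by (intro degree_sum_less) (use False in auto)
    then show ?thesis ..
  qed
  have Gz: "poly G z / poly D z = (\<Sum>w\<in>W. \<Sum>k=2..m w. - a w k / of_nat (k - 1) / (z - w) ^ (k - 1))"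
    if z: "z \<notin> W" for z
  proof -
    have "poly G z = (\<Sum>w\<in>W. \<Sum>k=2..m w. poly (T w k) z)" by (simp add: G_def poly_sum)
    also have "\<dots> = (\<Sum>w\<in>W. \<Sum>k=2..m w. - a w k / of_nat (k - 1) / (z - w) ^ (k - 1) * poly D z)"
    proof (intro sum.cong refl)
      fix w k assume w: "w \<in> W" "k \<in> {2..m w}"
      have zw: "z - w \<noteq> 0" using z w by auto
      have "poly D z = (z - w) ^ (m w - 1) * (\<Prod>v\<in>W - {w}. (z - v) ^ (m v - 1))"
        unfolding D_def poly_prod using w W(1) by (simp add: prod.remove)
      also have "m w - 1 = (k - 1) + (m w - k)" using w by auto
      finally have D': "poly D z = (z - w) ^ (k - 1) * ((z - w) ^ (m w - k) * (\<Prod>v\<in>W - {w}. (z - v) ^ (m v - 1)))"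
        by (simp add: power_add mult.assoc)
      show "poly (T w k) z = - a w k / of_nat (k - 1) / (z - w) ^ (k - 1) * poly D z"
        unfolding D' using zw by (simp add: T_def poly_prod)
    qed
    also have "\<dots> = (\<Sum>w\<in>W. \<Sum>k=2..m w. - a w k / of_nat (k - 1) / (z - w) ^ (k - 1)) * poly D z"
      by (simp only: sum_distrib_right)
    finally show ?thesis using Dnz[OF z] by (simp only: nonzero_mult_div_cancel_right not_False_eq_True)
  qed
  have key: "poly (E * (pderiv G * D - G * pderiv D)) z = poly (N * D) z" if z: "z \<notin> W" for z
  proof -
    let ?F = "\<lambda>z. \<Sum>w\<in>W. \<Sum>k=2..m w. - a w k / of_nat (k - 1) / (z - w) ^ (k - 1)"
    have "((\<lambda>z. poly G z / poly D z) has_field_derivative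
        (poly (pderiv G) z * poly D z - poly G z * poly (pderiv D) z) / (poly D z * poly D z)) (at z)"
      by (intro derivative_intros poly_DERIV Dnz z)
    moreover have "((\<lambda>z. poly G z / poly D z) has_field_derivative
        (\<Sum>w\<in>W. \<Sum>k=2..m w. a w k / (z - w) ^ k)) (at z)"
    proof (rule has_field_derivative_transform_within_open[of ?F _ _ "- W"])
      show "(?F has_field_derivative (\<Sum>w\<in>W. \<Sum>k=2..m w. a w k / (z - w) ^ k)) (at z)"
      proof (intro DERIV_sum)
        fix w k assume w: "w \<in> W" "k \<in> {2..m w}"
        then have zw: "z - w \<noteq> 0" using z by auto
        obtain n where n: "k = Suc (Suc n)" using w by (metis atLeastAtMost_iff add_2_eq_Suc le_Suc_ex)
        show "((\<lambda>z. - a w k / of_nat (k - 1) / (z - w) ^ (k - 1)) has_field_derivative a w k / (z - w) ^ k) (at z)"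
        proof -
          have "of_nat n * (z - w) ^ (n - Suc 0) * (z - w) = of_nat n * (z - w) ^ n"
            by (cases n) auto
          then have "(z - w) ^ n + of_nat n * (z - w) ^ (n - Suc 0) * (z - w) = of_nat (Suc n) * (z - w) ^ n"
            by (simp add: algebra_simps)
          then show ?thesis
            unfolding n using zw
            by (auto intro!: derivative_eq_intros simp: power2_eq_square divide_simps simp del: of_nat_Suc)
        qed
      qed
    qed (use z W(1) Gz in \<open>auto intro: finite_imp_closed\<close>)
    ultimately have "(poly (pderiv G) z * poly D z - poly G z * poly (pderiv D) z) / (poly D z * poly D z)
       = (\<Sum>w\<in>W. \<Sum>k=2..m w. a w k / (z - w) ^ k)"
      by (rule DERIV_unique)
    also have "\<dots> = (\<Sum>w\<in>W. \<Sum>k=1..m w. a w k / (z - w) ^ k)"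
    proof (rule sum.cong)
      fix w assume "w \<in> W"
      then have "{1..m w} = insert 1 {2..m w}" using W(2)[of w] by auto
      then show "(\<Sum>k=2..m w. a w k / (z - w) ^ k) = (\<Sum>k=1..m w. a w k / (z - w) ^ k)"
        using a1[OF \<open>w \<in> W\<close>] by simp
    qed simp
    also have "\<dots> = poly N z / (poly D z * poly E z)" using a[OF z] DE by simp
    finally have "(poly (pderiv G) z * poly D z - poly G z * poly (pderiv D) z) / (poly D z * poly D z)
       = poly N z / (poly D z * poly E z)" .
    moreover have "poly E z \<noteq> 0" using z W(1) by (auto simp: E_def poly_prod)
    ultimately show ?thesis using Dnz[OF z] by (simp add: divide_simps) (simp add: algebra_simps)
  qed
  have eq: "E * (pderiv G * D - G * pderiv D) = N * D"
  proof (rule ccontr)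
    assume "E * (pderiv G * D - G * pderiv D) \<noteq> N * D"
    then have "finite {z. poly (E * (pderiv G * D - G * pderiv D) - N * D) z = 0}"
      by (intro poly_roots_finite) simp
    then have "finite (- W)"
      by (rule finite_subset[rotated]) (use key in auto)
    with W(1) show False using infinite_UNIV_char_0[where 'a = complex] by (simp add: finite_compl)
  qed
  show False
  proof (cases "G = 0")
    case True
    with eq \<open>N \<noteq> 0\<close> D0 show False by simp
  next
    case False
    with degG have lt: "degree G < degree D" by simp
    note wr = degree_wronskian_ge[OF False lt]
    have "degree (N * D) = card W + degree (pderiv G * D - G * pderiv D)"
      unfolding eq[symmetric] using degE wr by (simp add: degree_mult_eq)
    moreover have "degree (N * D) = degree N + degree D" using \<open>N \<noteq> 0\<close> D0 by (simp add: degree_mult_eq)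
    ultimately show False using wr(1) N lt by linarith
  qed
qed


text \<open>The points may coincide, as they do in a limit of colliding poles; equal points are
  merged and their multiplicities added. The numerator 1 has degree 0, so two distinct values
  suffice.\<close>

lemma nonzero_residue_of_reciprocal:
  fixes c :: "'i \<Rightarrow> complex" and b :: "'i \<Rightarrow> nat"
  assumes S: "finite S" and b: "\<And>j. j \<in> S \<Longrightarrow> b j \<ge> 1" and "card (c ` S) \<ge> 2"
  shows "\<exists>w\<in>c ` S. residue (\<lambda>z. 1 / (\<Prod>j\<in>S. (z - c j) ^ b j)) w \<noteq> 0"
proof (rule ccontr)
  define m where "m = (\<lambda>w. \<Sum>j\<in>{j\<in>S. c j = w}. b j)"
  assume "\<not> ?thesis"
  moreover have "(\<Prod>j\<in>S. (z - c j) ^ b j) = (\<Prod>w\<in>c ` S. (z - w) ^ m w)" for z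
  proof -
    have "(\<Prod>j\<in>S. (z - c j) ^ b j) = (\<Prod>w\<in>c ` S. \<Prod>j\<in>{j\<in>S. c j = w}. (z - c j) ^ b j)"
      by (rule prod.image_gen[OF S])
    also have "\<dots> = (\<Prod>w\<in>c ` S. (z - w) ^ m w)"
      by (intro prod.cong refl) (simp add: m_def power_sum)
    finally show ?thesis .
  qed
  ultimately have "residue (\<lambda>z. poly 1 z / (\<Prod>w\<in>c ` S. (z - w) ^ m w)) w = 0" if "w \<in> c ` S" for w
    using that by auto
  moreover have "m w \<ge> 1" if "w \<in> c ` S" for w
  proof -
    from that obtain j where "j \<in> S" "c j = w" by auto
    then have "b j \<le> m w" unfolding m_def using S by (intro member_le_sum) auto
    with b[OF \<open>j \<in> S\<close>] show ?thesis by simp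
  qed
  ultimately have "(1 :: complex poly) = 0"
    using assms by (intro rational_residues_zero[of "c ` S" m]) auto
  then show False by simp
qed

text \<open>
  Adding a constant to \<open>v\<close> changes the form by an exact one, so one may assume that the
  weighted sum of the \<open>v k\<close> vanishes; then the numerator has degree at most \<open>p - 2\<close>.
\<close>

lemma variation_with_zero_residues:
  fixes x v :: "'i::finite \<Rightarrow> complex" and b :: "'i \<Rightarrow> nat"
  assumes x: "inj x" and b: "\<And>j. b j \<ge> 1"
    and res: "\<And>j. residue (\<lambda>z. (\<Sum>k\<in>UNIV. of_nat (b k) * v k / (z - x k)) / (\<Prod>j\<in>UNIV. (z - x j) ^ b j)) (x j) = 0"
  shows "v k = v l"
proof -
  define P where "P = (\<lambda>z. \<Prod>j\<in>UNIV. (z - x j) ^ b j)"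
  define \<tau> where "\<tau> = (\<Sum>k\<in>UNIV. of_nat (b k) * v k) / (\<Sum>k\<in>UNIV. of_nat (b k))"
  define u where "u = (\<lambda>k. v k - \<tau>)"
  have "(\<Sum>k\<in>UNIV. b k) > 0"
    using member_le_sum[of k UNIV b] b[of k] by simp
  then have "(\<Sum>k\<in>UNIV. of_nat (b k) :: complex) \<noteq> 0"
    by (metis of_nat_sum of_nat_eq_0_iff less_irrefl)
  then have u0: "(\<Sum>k\<in>UNIV. of_nat (b k) * u k) = 0"
    by (simp add: u_def \<tau>_def right_diff_distrib sum_subtractf)
       (simp flip: sum_distrib_right sum_divide_distrib)
  define S where "S = (\<lambda>j. - (range x - {x j}))"
  have S: "open (S j)" "x j \<in> S j" for j
    unfolding S_def by (intro open_Compl finite_imp_closed finite_Diff) auto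
  have Pnz: "P z \<noteq> 0" if "z \<notin> range x" for z using that by (auto simp: P_def)
  \<comment> \<open>A constant v gives an exact form with the single-valued primitive - 1 / P, hence
    no residues.\<close>
  have Pder: "((\<lambda>z. - 1 / P z) has_field_derivative (\<Sum>k\<in>UNIV. of_nat (b k) / (z - x k)) / P z) (at z)"
    if z: "z \<notin> range x" for z
  proof -
    have "(P has_field_derivative P z * (\<Sum>k\<in>UNIV. of_nat (b k) / (z - x k))) (at z)"
    proof -
      have "((\<lambda>z. (z - x k) ^ b k) has_field_derivative of_nat (b k) * (z - x k) ^ (b k - 1)) (at z)" for k
        by (auto intro!: derivative_eq_intros)
      then have "(P has_field_derivative P z * (\<Sum>k\<in>UNIV. of_nat (b k) * (z - x k) ^ (b k - 1) / (z - x k) ^ b k)) (at z)"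
        unfolding P_def using z by (intro has_field_derivative_prod') auto
      also have "(\<Sum>k\<in>UNIV. of_nat (b k) * (z - x k) ^ (b k - 1) / (z - x k) ^ b k) = (\<Sum>k\<in>UNIV. of_nat (b k) / (z - x k))"
      proof (intro sum.cong refl)
        fix k have "z - x k \<noteq> 0" using z by auto
        moreover have "(z - x k) ^ b k = (z - x k) ^ (b k - 1) * (z - x k)"
          using b[of k] by (simp flip: power_Suc2)
        ultimately show "of_nat (b k) * (z - x k) ^ (b k - 1) / (z - x k) ^ b k = of_nat (b k) / (z - x k)"
          by simp
      qed
      finally show ?thesis .
    qed
    then show ?thesis
      by (auto intro!: derivative_eq_intros simp: Pnz[OF z] power2_eq_square)
  qed
  have resP: "residue (\<lambda>z. (\<Sum>k\<in>UNIV. of_nat (b k) / (z - x k)) / P z) (x j) = 0" for j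
  proof -
    obtain e where e: "e > 0" "cball (x j) e \<subseteq> S j" using S open_contains_cball by blast
    let ?f = "\<lambda>z. (\<Sum>k\<in>UNIV. of_nat (b k) / (z - x k)) / P z"
    have "?f holomorphic_on S j - {x j}"
      unfolding P_def by (auto intro!: holomorphic_intros simp: S_def)
    from base_residue[OF S(1) S(2) e(1) this e(2)]
    have 1: "(?f has_contour_integral complex_of_real (2 * pi) * \<i> * residue ?f (x j)) (circlepath (x j) e)" .
    have "(?f has_contour_integral (- 1 / P (pathfinish (circlepath (x j) e)) - - 1 / P (pathstart (circlepath (x j) e))))
          (circlepath (x j) e)"
    proof (rule contour_integral_primitive)
      show "((\<lambda>z. - 1 / P z) has_field_derivative ?f z) (at z within - range x)" if "z \<in> - range x" for z
        using Pder[of z] that by (auto intro: has_field_derivative_at_within)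
      show "path_image (circlepath (x j) e) \<subseteq> - range x"
        using e by (auto simp: S_def path_image_circlepath)
    qed auto
    then have "(?f has_contour_integral 0) (circlepath (x j) e)" by simp
    with 1 show ?thesis by (auto dest: has_contour_integral_unique)
  qed
  define N where "N = (\<Sum>k\<in>UNIV. smult (of_nat (b k) * u k) (\<Prod>j\<in>UNIV - {k}. [:- x j, 1:]))"
  \<comment> \<open>The factor 1 / (z - x k) raises each pole order by one.\<close>
  define m where "m = (\<lambda>w. b (inv x w) + 1)"
  have Nz: "poly N z / (\<Prod>w\<in>range x. (z - w) ^ m w) = (\<Sum>k\<in>UNIV. of_nat (b k) * u k / (z - x k)) / P z"
    if z: "z \<notin> range x" for z
  proof -
    have "(\<Prod>w\<in>range x. (z - w) ^ m w) = (\<Prod>j\<in>UNIV. (z - x j) * (z - x j) ^ b j)"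
      by (subst prod.reindex[OF x]) (simp add: m_def x)
    also have "\<dots> = (\<Prod>j\<in>UNIV. z - x j) * P z"
      by (simp add: P_def prod.distrib)
    finally have 1: "(\<Prod>w\<in>range x. (z - w) ^ m w) = (\<Prod>j\<in>UNIV. z - x j) * P z" .
    have "poly N z = (\<Sum>k\<in>UNIV. of_nat (b k) * u k / (z - x k) * (\<Prod>j\<in>UNIV. z - x j))"
      unfolding N_def poly_sum
    proof (intro sum.cong refl)
      fix k have "z - x k \<noteq> 0" using z by auto
      then show "poly (smult (of_nat (b k) * u k) (\<Prod>j\<in>UNIV - {k}. [:- x j, 1:])) z =
        of_nat (b k) * u k / (z - x k) * (\<Prod>j\<in>UNIV. z - x j)"
        by (subst prod.remove[of UNIV k]) (auto simp: poly_prod)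
    qed
    also have "\<dots> = (\<Sum>k\<in>UNIV. of_nat (b k) * u k / (z - x k)) * (\<Prod>j\<in>UNIV. z - x j)"
      by (simp add: sum_distrib_right)
    finally have 2: "poly N z = (\<Sum>k\<in>UNIV. of_nat (b k) * u k / (z - x k)) * (\<Prod>j\<in>UNIV. z - x j)" .
    have "(\<Prod>j\<in>UNIV. z - x j) \<noteq> 0" using z by auto
    then show ?thesis unfolding 1 2 by simp
  qed
  let ?q = "CARD('i)"
  have degk: "degree (\<Prod>j\<in>UNIV - {k}. [:- x j, 1:]) = ?q - 1" for k
    by (subst degree_prod_eq_sum_degree) (auto simp: card_Diff_singleton)
  have N0: "N = 0"
  proof (cases "?q \<ge> 2")
    \<comment> \<open>With a single pole the bound deg N + 2 <= card is out of reach, but then the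
      weighted sum of u has only one term, which must vanish.\<close>
    case False
    then have "?q = 1" using zero_less_card_finite[where 'a='i] by linarith
    then have U: "(UNIV :: 'i set) = {k}" by (metis UNIV_I card_1_singletonE singletonD)
    have "of_nat (b k) * u k = 0" using u0 unfolding U by simp
    then show ?thesis unfolding N_def U by (simp del: mult_eq_0_iff)
  next
    case q: True
    have "degree N \<le> ?q - 1" unfolding N_def
      by (intro degree_sum_le order.trans[OF degree_smult_le]) (auto simp: degk)
    \<comment> \<open>The cofactors are monic of degree p - 1, so the coefficient there is the
      weighted sum of u; its vanishing lowers the degree to p - 2.\<close>
    moreover have "coeff N (?q - 1) = (\<Sum>k\<in>UNIV. of_nat (b k) * u k)"
      unfolding N_def coeff_sum
    proof (intro sum.cong refl)
      fix k
      have "coeff (\<Prod>j\<in>UNIV - {k}. [:- x j, 1:]) (?q - 1) = lead_coeff (\<Prod>j\<in>UNIV - {k}. [:- x j, 1:])"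
        by (simp add: degk)
      also have "\<dots> = 1" by (subst lead_coeff_prod) simp
      finally show "coeff (smult (of_nat (b k) * u k) (\<Prod>j\<in>UNIV - {k}. [:- x j, 1:])) (?q - 1) = of_nat (b k) * u k"
        by simp
    qed
    ultimately have "degree N \<le> ?q - 1" "coeff N (?q - 1) = 0" using u0 by auto
    then have "degree N + 2 \<le> ?q"
      using q leading_coeff_0_iff[of N] by (cases "degree N = ?q - 1") auto
    show ?thesis
    proof (rule rational_residues_zero[of "range x" m])
      show "degree N + 2 \<le> card (range x)" using \<open>degree N + 2 \<le> ?q\<close> card_image[OF x] by simp
      fix w assume "w \<in> range x"
      then obtain j where j: "w = x j" by auto
      let ?A = "\<lambda>z. (\<Sum>k\<in>UNIV. of_nat (b k) * v k / (z - x k)) / P z"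
      let ?B = "\<lambda>z. (\<Sum>k\<in>UNIV. of_nat (b k) / (z - x k)) / P z"
      have hol: "?A holomorphic_on S j - {x j}" "?B holomorphic_on S j - {x j}"
        unfolding P_def by (auto intro!: holomorphic_intros simp: S_def)
      have "residue (\<lambda>z. poly N z / (\<Prod>w\<in>range x. (z - w) ^ m w)) w = residue (\<lambda>z. ?A z - \<tau> * ?B z) w"
      proof (rule residue_cong)
        have "\<forall>\<^sub>F z in at w. z \<notin> range x"
          using islimpt_finite[of "range x"] by (auto simp: islimpt_iff_eventually)
        then show "\<forall>\<^sub>F z in at w. poly N z / (\<Prod>w\<in>range x. (z - w) ^ m w) = ?A z - \<tau> * ?B z"
        proof eventually_elim
          case (elim z)
          have "(\<Sum>k\<in>UNIV. of_nat (b k) * u k / (z - x k)) =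
             (\<Sum>k\<in>UNIV. of_nat (b k) * v k / (z - x k)) - \<tau> * (\<Sum>k\<in>UNIV. of_nat (b k) / (z - x k))"
            by (simp add: u_def sum_distrib_left sum_subtractf[symmetric] algebra_simps diff_divide_distrib)
          then show ?case unfolding Nz[OF elim] by (simp add: diff_divide_distrib)
        qed
      qed simp
      also have "\<dots> = residue ?A (x j) - residue (\<lambda>z. \<tau> * ?B z) (x j)"
        unfolding j by (rule residue_diff[OF S hol(1) holomorphic_on_mult[OF holomorphic_on_const hol(2)]])
      also have "residue (\<lambda>z. \<tau> * ?B z) (x j) = \<tau> * residue ?B (x j)"
        by (rule residue_lmul[OF S hol(2)])
      also have "residue ?A (x j) - \<tau> * residue ?B (x j) = 0" using res[of j] resP[of j] by (simp add: P_def)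
      finally show "residue (\<lambda>z. poly N z / (\<Prod>w\<in>range x. (z - w) ^ m w)) w = 0" .
    qed (auto simp: m_def)
  qed
  \<comment> \<open>At x k every summand of N except the k-th vanishes.\<close>
  have "u k = 0" for k
  proof -
    have "0 = poly N (x k)" by (simp add: N0)
    also have "\<dots> = (\<Sum>i\<in>UNIV. if i = k then of_nat (b k) * u k * (\<Prod>j\<in>UNIV - {k}. x k - x j) else 0)"
      unfolding N_def poly_sum by (intro sum.cong refl) (auto simp: poly_prod)
    finally have "of_nat (b k) * u k * (\<Prod>j\<in>UNIV - {k}. x k - x j) = 0" by simp
    moreover have "(\<Prod>j\<in>UNIV - {k}. x k - x j) \<noteq> 0" using x by (auto simp: inj_eq)
    moreover have "b k \<noteq> 0" using b[of k] by simp
    ultimately show ?thesis by simp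
  qed
  then show ?thesis by (simp add: u_def)
qed

section \<open>Residues as functions of the poles\<close>

definition turn :: "real \<Rightarrow> complex" where
  "turn t = exp (2 * of_real pi * \<i> * of_real t)"

lemma turn_simps [simp]: "turn 0 = 1" "turn 1 = 1" "norm (turn t) = 1" "turn t \<noteq> 0"
  by (simp_all add: turn_def norm_exp_eq_Re)

lemma continuous_on_turn [continuous_intros]: "continuous_on A f \<Longrightarrow> continuous_on A (\<lambda>x. turn (f x))"
  unfolding turn_def by (intro continuous_intros)

text \<open>Over the fixed interval [0, 1] the centre, the radius and the integrand become
  parameters on which the integral can depend continuously.\<close>

lemma contour_integral_circlepath_eq:
  "contour_integral (circlepath w r) f =
     integral {0..1} (\<lambda>t. f (w + of_real r * turn t) * (2 * of_real pi * \<i> * of_real r * turn t))"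
  unfolding contour_integral_integral vector_derivative_circlepath by (simp add: turn_def circlepath)

lemma tendsto_integral_param:
  fixes F :: "'a::t2_space \<Rightarrow> real \<Rightarrow> complex"
  assumes "continuous_on (U \<times> {0..1}) (\<lambda>(P, t). F P t)" "P \<in> U" "(Q \<longlongrightarrow> P) net"
    "\<forall>\<^sub>F n in net. Q n \<in> U"
  shows "((\<lambda>n. integral {0..1} (F (Q n))) \<longlongrightarrow> integral {0..1} (F P)) net"
  using continuous_on_tendsto_compose[OF _ assms(3,2,4)]
    integral_continuous_on_param[of U 0 1 F] assms(1) by simp

section \<open>Forms with their zero at infinity\<close>

definition normal_form :: "('p::finite \<Rightarrow> nat) \<Rightarrow> complex ^ 'p \<Rightarrow> complex \<Rightarrow> complex" where
  "normal_form b x z = 1 / (\<Prod>j\<in>UNIV. (z - x $ j) ^ b j)"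

definition res_at :: "('p::finite \<Rightarrow> nat) \<Rightarrow> complex ^ 'p \<Rightarrow> 'p \<Rightarrow> complex" where
  "res_at b x j = 2 * of_real pi * \<i> * residue (normal_form b x) (x $ j)"

definition config :: "(complex ^ 'p::finite) set" where
  "config = {x. \<forall>i j. i \<noteq> j \<longrightarrow> x $ i \<noteq> x $ j}"

lemma open_config: "open config"
proof -
  have "config = (\<Inter>(i, j)\<in>{(i, j). i \<noteq> j}. {x. x $ i \<noteq> x $ j})" by (auto simp: config_def)
  also have "open \<dots>" by (intro open_INT) (auto intro!: open_Collect_neq continuous_intros)
  finally show ?thesis .
qed

lemma holomorphic_normal_form: "range (($) x) \<inter> A = {} \<Longrightarrow> normal_form b x holomorphic_on A"
  unfolding normal_form_def by (rule holomorphic_intros | auto)+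

lemma contour_integral_normal_form:
  fixes x :: "complex ^ 'p::finite"
  assumes x: "x \<in> config" and r: "r > 0" and w: "\<And>j. dist w (x $ j) \<noteq> r"
  shows "contour_integral (circlepath w r) (normal_form b x) = (\<Sum>j\<in>{j. dist w (x $ j) < r}. res_at b x j)"
proof -
  have inj: "inj (($) x)" using x by (auto simp: config_def inj_def)
  have "contour_integral (circlepath w r) (normal_form b x) =
      2 * pi * \<i> * (\<Sum>p\<in>range (($) x). winding_number (circlepath w r) p * residue (normal_form b x) p)"
    by (rule Residue_theorem[of UNIV])
       (use r w in \<open>auto simp: path_image_circlepath sphere_def intro!: holomorphic_normal_form\<close>)
  also have "(\<Sum>p\<in>range (($) x). winding_number (circlepath w r) p * residue (normal_form b x) p) =
      (\<Sum>j\<in>UNIV. winding_number (circlepath w r) (x $ j) * residue (normal_form b x) (x $ j))"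
    by (subst sum.reindex[OF inj]) simp
  also have "\<dots> = (\<Sum>j\<in>UNIV. if dist w (x $ j) < r then residue (normal_form b x) (x $ j) else 0)"
  proof (intro sum.cong refl)
    fix j
    show "winding_number (circlepath w r) (x $ j) * residue (normal_form b x) (x $ j) =
      (if dist w (x $ j) < r then residue (normal_form b x) (x $ j) else 0)"
    proof (cases "dist w (x $ j) < r")
      case True
      then have "norm (x $ j - w) < r" by (simp add: dist_norm norm_minus_commute)
      then show ?thesis using True by (simp add: winding_number_circlepath)
    next
      case False
      with w[of j] have "x $ j \<notin> cball w r" by auto
      then have "winding_number (circlepath w r) (x $ j) = 0"
        by (intro winding_number_zero_outside[of _ "cball w r"])
           (use r in \<open>auto simp: path_image_circlepath\<close>)
      with False show ?thesis by simp
    qed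
  qed
  also have "\<dots> = (\<Sum>j\<in>{j. dist w (x $ j) < r}. residue (normal_form b x) (x $ j))"
    by (simp add: sum.If_cases)
  finally show ?thesis by (simp add: res_at_def sum_distrib_left)
qed

text \<open>The total pole order is at least 2, so the form is O(1 / r^2) on a circle of large
  radius r, and its integral, the sum of all residues, is O(1 / r).\<close>

lemma sum_res_at:
  fixes x :: "complex ^ 'p::finite"
  assumes x: "x \<in> config" and B: "(\<Sum>j\<in>UNIV. b j) \<ge> 2"
  shows "(\<Sum>j\<in>UNIV. res_at b x j) = 0"
proof (rule ccontr)
  let ?s = "\<Sum>j\<in>UNIV. res_at b x j" and ?B = "\<Sum>j\<in>UNIV. b j"
  assume nz: "?s \<noteq> 0"
  define M where "M = norm x + 1"
  have M: "norm (x $ j) < M" for j using Finite_Cartesian_Product.norm_nth_le[of x j] by (simp add: M_def)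
  have M1: "M \<ge> 1" by (simp add: M_def)
  \<comment> \<open>r >= 2 M keeps the circle at distance at least r / 2 from the poles, r >= 2
    makes powers of r / 2 grow with the exponent, and the last summand contradicts the bound 8 pi /
    r for the sum of the residues.\<close>
  define r where "r = 2 * M + 2 + 8 * pi / norm ?s"
  have "8 * pi / norm ?s > 0" using nz by simp
  then have r: "r > 0" "r \<ge> 2 * M" "r \<ge> 2" "8 * pi / norm ?s < r" using M1 by (auto simp: r_def)
  have d: "dist 0 (x $ j) < r" for j using M[of j] r M1 by simp
  then have "contour_integral (circlepath 0 r) (normal_form b x) = ?s"
    by (subst contour_integral_normal_form[OF x r(1)]) (auto simp: order_less_le)
  moreover have "normal_form b x contour_integrable_on circlepath 0 r"
    by (intro contour_integrable_holomorphic_simple[of _ "- range (($) x)"] holomorphic_normal_form)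
       (use d r(1) in \<open>auto simp: path_image_circlepath open_Compl finite_imp_closed less_le dist_commute\<close>)
  ultimately have "(normal_form b x has_contour_integral ?s) (circlepath 0 r)"
    by (metis has_contour_integral_integral)
  then have "norm ?s \<le> (2 / r) ^ 2 * (2 * pi * r)"
  proof (rule has_contour_integral_bound_circlepath)
    fix z :: complex assume z: "norm (z - 0) = r"
    have h: "r / 2 \<le> norm (z - x $ j)" for j
      using norm_triangle_ineq2[of z "x $ j"] M[of j] r z by simp
    have "(r / 2) ^ 2 \<le> (r / 2) ^ ?B" using B r by (intro power_increasing) auto
    also have "\<dots> = (\<Prod>j\<in>UNIV. (r / 2) ^ b j)" by (simp add: power_sum)
    also have "\<dots> \<le> (\<Prod>j\<in>UNIV. norm (z - x $ j) ^ b j)"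
      using h r by (intro prod_mono conjI power_mono zero_le_power) auto
    finally have "(r / 2) ^ 2 \<le> (\<Prod>j\<in>UNIV. norm (z - x $ j) ^ b j)" .
    then have "1 / (\<Prod>j\<in>UNIV. norm (z - x $ j) ^ b j) \<le> 1 / (r / 2) ^ 2"
      using r by (intro divide_left_mono mult_pos_pos) (auto intro: less_le_trans[of 0 "(r/2)^2"])
    then show "norm (normal_form b x z) \<le> (2 / r) ^ 2"
      by (simp add: normal_form_def norm_divide norm_power flip: prod_norm) (simp add: power_divide)
  qed (use r in auto)
  also have "\<dots> = 8 * pi / r" using r by (simp add: power2_eq_square field_simps)
  finally have "norm ?s * r \<le> 8 * pi" using r by (simp add: field_simps)
  moreover have "8 * pi < norm ?s * r" using r nz by (simp add: field_simps)
  ultimately show False by simp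
qed

text \<open>
  The rescaling \<open>z = c n + s n * u\<close> zooms in on the points indexed by \<open>S\<close>; the points outside
  \<open>S\<close> contribute only a nonzero constant to the limit form.
\<close>

lemma cluster_residue_limit:
  fixes x :: "nat \<Rightarrow> complex ^ 'p::finite" and y d :: "'p \<Rightarrow> complex"
  assumes x: "\<And>n. x n \<in> config" and s: "\<And>n. s n > (0::real)" and b: "\<And>j. b j \<ge> 1"
    and y: "\<And>j. j \<in> S \<Longrightarrow> (\<lambda>n. (x n $ j - c n) / of_real (s n)) \<longlonglongrightarrow> y j"
    and d: "\<And>j. j \<notin> S \<Longrightarrow> (\<lambda>n. c n - x n $ j) \<longlonglongrightarrow> d j" "\<And>j. j \<notin> S \<Longrightarrow> d j \<noteq> 0"
    and s0: "S \<noteq> UNIV \<Longrightarrow> s \<longlonglongrightarrow> 0" and card: "card (y ` S) \<ge> 2"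
  shows "\<exists>K L. K \<noteq> {} \<and> K \<noteq> UNIV \<and> L \<noteq> 0 \<and>
     (\<lambda>n. of_real (s n) ^ ((\<Sum>j\<in>S. b j) - 1) * (\<Sum>j\<in>K. res_at b (x n) j)) \<longlonglongrightarrow> L"
proof -
  \<comment> \<open>In the rescaled coordinate the limit form has a nonzero residue at some w. K
    will consist of the indices whose points tend to w; it is proper because y takes a second value
    on S.\<close>
  obtain w where w: "w \<in> y ` S" and res: "residue (\<lambda>z. 1 / (\<Prod>j\<in>S. (z - y j) ^ b j)) w \<noteq> 0"
    using nonzero_residue_of_reciprocal[of S b y] b card by auto
  obtain \<delta> where \<delta>: "\<delta> > 0" "\<And>v. v \<in> y ` S \<Longrightarrow> v \<noteq> w \<Longrightarrow> \<delta> \<le> dist w v"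
    using finite_set_avoid[of "y ` S" w] by auto
  define \<epsilon> where "\<epsilon> = \<delta> / 2"
  have \<epsilon>: "\<epsilon> > 0" using \<delta> by (simp add: \<epsilon>_def)
  have dy: "j \<in> S \<Longrightarrow> y j \<noteq> w \<Longrightarrow> dist w (y j) > \<epsilon>" for j
    using \<delta>(1) \<delta>(2)[of "y j"] by (auto simp: \<epsilon>_def)
  define K where "K = {j\<in>S. y j = w}"
  have K1: "K \<noteq> {}" using w by (auto simp: K_def)
  have K2: "K \<noteq> UNIV"
  proof
    assume "K = UNIV"
    then have "y ` S \<subseteq> {w}" by (auto simp: K_def)
    then have "card (y ` S) \<le> 1" using card_mono[of "{w}"] by force
    with card show False by simp
  qed
  define B where "B = (\<Sum>j\<in>S. b j)"
  obtain j1 where "j1 \<in> S" using w by auto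
  then have "B \<ge> 1" using member_le_sum[of j1 S b] b[of j1] by (simp add: B_def)
  \<comment> \<open>For \<open>S = UNIV\<close> the scale s need not tend to 0, and there are no
    outer factors that refer to it; the value 0 lets both cases share one limit argument.\<close>
  define \<sigma> where "\<sigma> = (\<lambda>n. if S = UNIV then 0 else complex_of_real (s n))"
  define Q where "Q = (\<lambda>n. \<chi> j. if j \<in> S then (x n $ j - c n) / of_real (s n) else c n - x n $ j)"
  define Q0 where "Q0 = (\<chi> j. if j \<in> S then y j else d j)"
  \<comment> \<open>The factors z - x j at z = c + s (w + \<epsilon> turn t), divided by s for the
    indices in S. In this form they are continuous in the parameters, up to the limit
    \<open>(Q0, 0)\<close>.\<close>
  define V where "V = (\<lambda>(P :: (complex ^ 'p) \<times> complex) t j. if j \<in> S then w + of_real \<epsilon> * turn t - fst P $ j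
        else fst P $ j + snd P * (w + of_real \<epsilon> * turn t))"
  define F where "F = (\<lambda>P t. 1 / (\<Prod>j\<in>UNIV. V P t j ^ b j) * (2 * of_real pi * \<i> * of_real \<epsilon> * turn t))"
  define U where "U = {P. \<forall>t\<in>{0..1}. \<forall>j. V P t j \<noteq> 0}"
  have contV: "continuous_on A (\<lambda>p. V (fst p) (snd p) j)" for j A
    by (cases "j \<in> S") (auto simp: V_def intro!: continuous_intros)
  have contF: "continuous_on (U \<times> {0..1}) (\<lambda>(P, t). F P t)"
    unfolding F_def case_prod_beta
    by (intro continuous_intros contV) (auto simp: U_def)
  have Qlim: "(\<lambda>n. (Q n, \<sigma> n)) \<longlonglongrightarrow> (Q0, 0)"
  proof (rule tendsto_Pair)
    show "Q \<longlonglongrightarrow> Q0"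
    proof (rule vec_tendstoI)
      fix j show "(\<lambda>n. Q n $ j) \<longlonglongrightarrow> Q0 $ j"
        using y d(1) by (cases "j \<in> S") (simp_all add: Q_def Q0_def)
    qed
    show "\<sigma> \<longlonglongrightarrow> 0"
    proof (cases "S = UNIV")
      case False
      then have "(\<lambda>n. complex_of_real (s n)) \<longlonglongrightarrow> of_real 0" using s0 by (intro tendsto_of_real)
      with False show ?thesis by (simp add: \<sigma>_def)
    qed (simp add: \<sigma>_def)
  qed
  have dist_circ: "w + of_real \<epsilon> * turn t \<noteq> v" if "dist w v \<noteq> \<epsilon>" for v t
  proof
    assume "w + of_real \<epsilon> * turn t = v"
    then have "dist w v = norm (of_real \<epsilon> * turn t)" by (auto simp: dist_norm)
    with that \<epsilon> show False by (simp add: norm_mult)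
  qed
  have ylim: "\<forall>\<^sub>F n in sequentially. \<forall>j\<in>S. if y j = w then dist w (Q n $ j) < \<epsilon> else dist w (Q n $ j) > \<epsilon>"
  proof (intro eventually_ball_finite ballI)
    fix j assume j: "j \<in> S"
    have "(\<lambda>n. dist w (Q n $ j)) \<longlonglongrightarrow> dist w (y j)"
      using y[OF j] j by (intro tendsto_intros) (simp add: Q_def)
    then show "\<forall>\<^sub>F n in sequentially. if y j = w then dist w (Q n $ j) < \<epsilon> else dist w (Q n $ j) > \<epsilon>"
      using dy[OF j] \<epsilon> order_tendstoD by (cases "y j = w") auto
  qed simp
  have dlim: "\<forall>\<^sub>F n in sequentially. \<forall>j\<in>-S. norm (\<sigma> n) * (norm w + \<epsilon>) < norm (c n - x n $ j)"
  proof (intro eventually_ball_finite ballI)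
    fix j assume j: "j \<in> - S"
    have "(\<lambda>n. norm (c n - x n $ j) - norm (\<sigma> n) * (norm w + \<epsilon>)) \<longlonglongrightarrow> norm (d j) - norm (0::complex) * (norm w + \<epsilon>)"
      using tendsto_snd[OF Qlim] d(1)[of j] j by (intro tendsto_intros) auto
    moreover have "norm (d j) - norm (0::complex) * (norm w + \<epsilon>) > 0" using d(2) j by simp
    ultimately have "\<forall>\<^sub>F n in sequentially. 0 < norm (c n - x n $ j) - norm (\<sigma> n) * (norm w + \<epsilon>)"
      by (rule order_tendstoD)
    then show "\<forall>\<^sub>F n in sequentially. norm (\<sigma> n) * (norm w + \<epsilon>) < norm (c n - x n $ j)"
      by eventually_elim simp
  qed simp
  have normu: "norm (w + of_real \<epsilon> * turn t) \<le> norm w + \<epsilon>" for t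
    using norm_triangle_ineq[of w "of_real \<epsilon> * turn t"] \<epsilon> by (simp add: norm_mult)
  have evU: "\<forall>\<^sub>F n in sequentially. (Q n, \<sigma> n) \<in> U"
    using ylim dlim
  proof eventually_elim
    case (elim n)
    have "V (Q n, \<sigma> n) t j \<noteq> 0" for t j
    proof (cases "j \<in> S")
      case True
      then have "dist w (Q n $ j) \<noteq> \<epsilon>" using elim(1) by (cases "y j = w") force+
      from dist_circ[OF this, of t] True show ?thesis by (simp add: V_def)
    next
      case False
      have "norm (\<sigma> n * (w + of_real \<epsilon> * turn t)) < norm (Q n $ j)"
        using elim(2) False mult_left_mono[OF normu[of t], of "norm (\<sigma> n)"]
        by (force simp: Q_def norm_mult)
      then have "Q n $ j \<noteq> - (\<sigma> n * (w + of_real \<epsilon> * turn t))" by force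
      with False show ?thesis by (auto simp: V_def add_eq_0_iff2)
    qed
    then show ?case by (simp add: U_def)
  qed
  have U0: "(Q0, 0) \<in> U"
  proof -
    have "w + of_real \<epsilon> * turn t \<noteq> y j" if "j \<in> S" for t j
      by (rule dist_circ) (use dy[OF that] \<epsilon> in fastforce)
    then show ?thesis using d(2) by (auto simp: U_def V_def Q0_def)
  qed
  have lim: "(\<lambda>n. integral {0..1} (F (Q n, \<sigma> n))) \<longlonglongrightarrow> integral {0..1} (F (Q0, 0))"
    by (rule tendsto_integral_param[OF contF U0 Qlim evU])
  \<comment> \<open>Eventually the circle of radius s \<epsilon> encloses exactly the points of K.
    Pulling s out of the factors indexed by S costs s ^ B, of which dz returns one power.\<close>
  have ev: "\<forall>\<^sub>F n in sequentially. of_real (s n) ^ (B - 1) * (\<Sum>j\<in>K. res_at b (x n) j) = integral {0..1} (F (Q n, \<sigma> n))"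
    using ylim dlim
  proof eventually_elim
    case (elim n)
    let ?w = "c n + of_real (s n) * w" and ?r = "s n * \<epsilon>"
    have sc: "dist ?w (x n $ j) = s n * dist w (Q n $ j)" if "j \<in> S" for j
    proof -
      have "x n $ j = c n + of_real (s n) * (Q n $ j)" using that s[of n] by (simp add: Q_def)
      then have "dist ?w (x n $ j) = norm (of_real (s n) * (w - Q n $ j))" by (simp add: dist_norm algebra_simps)
      also have "\<dots> = s n * dist w (Q n $ j)" using s[of n] by (simp add: norm_mult dist_norm)
      finally show ?thesis .
    qed
    have out: "dist ?w (x n $ j) > ?r" if "j \<notin> S" for j
    proof -
      have "\<sigma> n = of_real (s n)" using that by (auto simp: \<sigma>_def)
      then have "s n * norm w + ?r < norm (c n - x n $ j)"
        using elim(2) that s[of n] by (simp add: distrib_left)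
      also have "\<dots> = norm ((?w - x n $ j) - of_real (s n) * w)" by simp
      also have "\<dots> \<le> norm (?w - x n $ j) + norm (of_real (s n) * w)" by (rule norm_triangle_ineq4)
      also have "\<dots> = norm (?w - x n $ j) + s n * norm w" using s[of n] by (simp add: norm_mult)
      finally show ?thesis by (simp add: dist_norm)
    qed
    have in_iff: "dist ?w (x n $ j) < ?r \<longleftrightarrow> j \<in> K" and ne: "dist ?w (x n $ j) \<noteq> ?r" for j
    proof -
      have "(dist ?w (x n $ j) < ?r \<longleftrightarrow> j \<in> K) \<and> dist ?w (x n $ j) \<noteq> ?r"
      proof (cases "j \<in> S")
        case True
        have "if y j = w then dist w (Q n $ j) < \<epsilon> else dist w (Q n $ j) > \<epsilon>" using elim(1) True by blast
        then show ?thesis using True s[of n] by (auto simp: sc K_def split: if_splits)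
      next
        case False
        with out[OF False] show ?thesis by (auto simp: K_def)
      qed
      then show "dist ?w (x n $ j) < ?r \<longleftrightarrow> j \<in> K" and "dist ?w (x n $ j) \<noteq> ?r" by auto
    qed
    have "of_real (s n) ^ (B - 1) * (\<Sum>j\<in>K. res_at b (x n) j) =
        of_real (s n) ^ (B - 1) * contour_integral (circlepath ?w ?r) (normal_form b (x n))"
      by (subst contour_integral_normal_form[OF x]) (use s[of n] \<epsilon> ne in_iff in auto)
    also have "\<dots> = integral {0..1} (\<lambda>t. of_real (s n) ^ (B - 1) *
        (normal_form b (x n) (?w + of_real ?r * turn t) * (2 * of_real pi * \<i> * of_real ?r * turn t)))"
      unfolding contour_integral_circlepath_eq by (simp only: integral_mult_right)
    also have "\<dots> = integral {0..1} (F (Q n, \<sigma> n))"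
    proof (rule integral_cong)
      fix t
      have "(?w + of_real ?r * turn t - x n $ j) = (if j \<in> S then of_real (s n) else 1) * V (Q n, \<sigma> n) t j" for j
      proof (cases "j \<in> S")
        case True
        then show ?thesis using s[of n] by (simp add: V_def Q_def field_simps)
      next
        case False
        then have "\<sigma> n = of_real (s n)" by (auto simp: \<sigma>_def)
        with False show ?thesis by (simp add: V_def Q_def algebra_simps)
      qed
      then have "(\<Prod>j\<in>UNIV. (?w + of_real ?r * turn t - x n $ j) ^ b j) =
          (\<Prod>j\<in>UNIV. (if j \<in> S then of_real (s n) ^ b j else 1)) * (\<Prod>j\<in>UNIV. V (Q n, \<sigma> n) t j ^ b j)"
        by (simp add: prod.distrib power_mult_distrib if_distrib[of "\<lambda>u. u ^ _"] cong: if_cong)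
      also have "(\<Prod>j\<in>UNIV. (if j \<in> S then complex_of_real (s n) ^ b j else 1)) = of_real (s n) ^ B"
        by (simp add: prod.If_cases B_def power_sum)
      also have "\<dots> = of_real (s n) ^ (B - 1) * of_real (s n)" using \<open>B \<ge> 1\<close> by (simp flip: power_Suc2)
      finally show "of_real (s n) ^ (B - 1) *
        (normal_form b (x n) (?w + of_real ?r * turn t) * (2 * of_real pi * \<i> * of_real ?r * turn t)) = F (Q n, \<sigma> n) t"
        using s[of n] unfolding normal_form_def F_def by (simp add: divide_simps)
    qed
    finally show ?case .
  qed
  have L: "integral {0..1} (F (Q0, 0)) \<noteq> 0"
  proof -
    let ?f = "\<lambda>z. 1 / (\<Prod>j\<in>S. (z - y j) ^ b j)" and ?C = "\<Prod>j\<in>-S. d j ^ b j"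
    have C: "?C \<noteq> 0" using d(2) by auto
    have "F (Q0, 0) t = 1 / ?C * (?f (w + of_real \<epsilon> * turn t) * (2 * of_real pi * \<i> * of_real \<epsilon> * turn t))" for t
    proof -
      have "(\<Prod>j\<in>UNIV. V (Q0, 0) t j ^ b j) = (\<Prod>j\<in>UNIV. if j \<in> S then (w + of_real \<epsilon> * turn t - y j) ^ b j else d j ^ b j)"
        by (intro prod.cong) (auto simp: V_def Q0_def)
      also have "\<dots> = (\<Prod>j\<in>S. (w + of_real \<epsilon> * turn t - y j) ^ b j) * ?C"
        by (simp add: prod.If_cases)
      finally show ?thesis by (simp add: F_def)
    qed
    then have "F (Q0, 0) = (\<lambda>t. 1 / ?C * (?f (w + of_real \<epsilon> * turn t) * (2 * of_real pi * \<i> * of_real \<epsilon> * turn t)))"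
      by (rule ext)
    then have "integral {0..1} (F (Q0, 0)) = 1 / ?C * contour_integral (circlepath w \<epsilon>) ?f"
      unfolding contour_integral_circlepath_eq by (simp only: integral_mult_right)
    also have "contour_integral (circlepath w \<epsilon>) ?f = 2 * pi * \<i> * residue ?f w"
    proof (rule contour_integral_unique, rule base_residue[of "- (y ` S - {w})"])
      show "open (- (y ` S - {w}))" by (intro open_Compl finite_imp_closed finite_Diff) auto
      show "?f holomorphic_on - (y ` S - {w}) - {w}" by (auto intro!: holomorphic_intros)
      show "cball w \<epsilon> \<subseteq> - (y ` S - {w})" using dy by fastforce
    qed (use \<epsilon> in auto)
    finally show ?thesis using res C by simp
  qed
  have "(\<lambda>n. of_real (s n) ^ (B - 1) * (\<Sum>j\<in>K. res_at b (x n) j)) \<longlonglongrightarrow> integral {0..1} (F (Q0, 0))"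
    using lim by (rule Lim_transform_eventually) (use ev in eventually_elim, simp)
  with K1 K2 L show ?thesis unfolding B_def by blast
qed


text \<open>If the poles spread without bound, rescaling by their spread s makes s ^ (B - 1) times
  some partial sum of residues converge, which is impossible when that sum has a nonzero limit. If
  poles collide at a scale \<rho> tending to 0, then \<rho> ^ (B - 1) times some partial sum has a
  nonzero limit, so the residues could not converge.\<close>

lemma config_limit:
  fixes x :: "nat \<Rightarrow> complex ^ 'p::finite"
  assumes x: "\<And>n. x n \<in> config" and b: "\<And>j. b j \<ge> 1" and p: "CARD('p) \<ge> 2"
    and j0: "(\<lambda>n. x n $ j0) \<longlonglongrightarrow> \<xi>" and lim: "\<And>j. (\<lambda>n. res_at b (x n) j) \<longlonglongrightarrow> \<mu> j"
    and nonres: "\<And>K. K \<noteq> {} \<Longrightarrow> K \<noteq> UNIV \<Longrightarrow> (\<Sum>j\<in>K. \<mu> j) \<noteq> 0"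
  shows "\<exists>y\<in>config. \<exists>r. strict_mono (r :: nat \<Rightarrow> nat) \<and> (x \<circ> r) \<longlonglongrightarrow> y"
proof -
  have sumlim: "(\<lambda>n. \<Sum>j\<in>K. res_at b (x n) j) \<longlonglongrightarrow> (\<Sum>j\<in>K. \<mu> j)" for K
    by (intro tendsto_sum lim)
  \<comment> \<open>Two poles give an exponent B - 1 >= 1 in both rescalings; with exponent 0 the
    scale would drop out of the limits.\<close>
  have B2: "(\<Sum>j\<in>S. b j) \<ge> 2" if "i \<in> S" "j \<in> S" "i \<noteq> j" for S i j
  proof -
    have "2 \<le> b i + b j" using b[of i] b[of j] by simp
    also have "\<dots> = (\<Sum>k\<in>{i, j}. b k)" using that by simp
    also have "\<dots> \<le> (\<Sum>k\<in>S. b k)" using that by (intro sum_mono2) auto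
    finally show ?thesis .
  qed
  obtain i1 where i1: "i1 \<noteq> j0"
    using p by (metis One_nat_def UNIV_I card.empty card_1_singleton_iff empty_iff finite insert_iff is_singletonI' not_numeral_le_zero numeral_le_one_iff semiring_norm(69) card_eq_0_iff is_singleton_altdef)
  define X where "X = (\<lambda>n. \<chi> j. x n $ j - x n $ j0)"
  define s where "s = (\<lambda>n. norm (X n))"
  have s: "s n > 0" for n
  proof -
    have "X n $ i1 \<noteq> 0" using x[of n] i1 by (auto simp: X_def config_def)
    then show ?thesis by (auto simp: s_def vec_eq_iff)
  qed
  have "bounded (range (\<lambda>n. X n /\<^sub>R s n))"
    by (rule boundedI[of _ 1]) (use s in \<open>auto simp: s_def\<close>)
  then obtain y r1 where r1: "strict_mono r1" and y: "((\<lambda>n. X n /\<^sub>R s n) \<circ> r1) \<longlonglongrightarrow> y"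
    using bounded_imp_convergent_subsequence by blast
  have "bounded (range (s \<circ> r1))"
  proof -
    have "norm (X n /\<^sub>R s n) = 1" for n using s[of n] by (simp add: s_def)
    then have "norm y = 1"
      using LIMSEQ_unique[OF tendsto_norm[OF y], of 1] by (simp add: o_def)
    then obtain j where "y $ j \<noteq> 0" by (metis norm_zero vec_eq_iff zero_index zero_neq_one)
    moreover have y0: "y $ j0 = 0"
      using LIMSEQ_unique[OF tendsto_vec_nth[OF y, of j0], of 0] by (simp add: X_def)
    ultimately have "y $ j0 \<noteq> y $ j" by simp
    moreover have "card {y $ j0, y $ j} \<le> card (range (($) y))" by (rule card_mono) auto
    ultimately have card: "card (range (($) y)) \<ge> 2" by simp
    have "\<exists>K L. K \<noteq> {} \<and> K \<noteq> UNIV \<and> L \<noteq> 0 \<and> (\<lambda>n. of_real ((s \<circ> r1) n) ^ ((\<Sum>j\<in>UNIV. b j) - 1) *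
        (\<Sum>j\<in>K. res_at b ((x \<circ> r1) n) j)) \<longlonglongrightarrow> L"
    proof (rule cluster_residue_limit[where c = "\<lambda>n. x (r1 n) $ j0" and y = "($) y"])
      fix j
      show "(\<lambda>n. ((x \<circ> r1) n $ j - x (r1 n) $ j0) / of_real ((s \<circ> r1) n)) \<longlonglongrightarrow> y $ j"
        using tendsto_vec_nth[OF y, of j] by (simp add: X_def o_def scaleR_conv_of_real[where 'a = complex] divide_inverse mult.commute)
    qed (use x s b card in auto)
    then obtain K L where K: "K \<noteq> {}" "K \<noteq> UNIV" "L \<noteq> 0"
      "(\<lambda>n. of_real ((s \<circ> r1) n) ^ ((\<Sum>j\<in>UNIV. b j) - 1) * (\<Sum>j\<in>K. res_at b (x (r1 n)) j)) \<longlonglongrightarrow> L"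
      by auto
    have K': "(\<lambda>n. \<Sum>j\<in>K. res_at b (x (r1 n)) j) \<longlonglongrightarrow> (\<Sum>j\<in>K. \<mu> j)"
      using LIMSEQ_subseq_LIMSEQ[OF sumlim r1] by (simp add: o_def)
    have nz: "(\<Sum>j\<in>K. \<mu> j) \<noteq> 0" using nonres K by auto
    have "(\<lambda>n. of_real ((s \<circ> r1) n) ^ ((\<Sum>j\<in>UNIV. b j) - 1) * (\<Sum>j\<in>K. res_at b (x (r1 n)) j) / (\<Sum>j\<in>K. res_at b (x (r1 n)) j))
       \<longlonglongrightarrow> L / (\<Sum>j\<in>K. \<mu> j)"
      by (intro tendsto_divide K K' nz)
    moreover have ev0: "\<forall>\<^sub>F n in sequentially. (\<Sum>j\<in>K. res_at b (x (r1 n)) j) \<noteq> 0"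
      using tendsto_imp_eventually_ne[OF K' nz] .
    moreover have "\<forall>\<^sub>F n in sequentially. of_real ((s \<circ> r1) n) ^ ((\<Sum>j\<in>UNIV. b j) - 1) * (\<Sum>j\<in>K. res_at b (x (r1 n)) j) / (\<Sum>j\<in>K. res_at b (x (r1 n)) j)
        = of_real ((s \<circ> r1) n) ^ ((\<Sum>j\<in>UNIV. b j) - 1)"
      using ev0 by (rule eventually_mono) simp
    ultimately have "(\<lambda>n. of_real ((s \<circ> r1) n) ^ ((\<Sum>j\<in>UNIV. b j) - 1)) \<longlonglongrightarrow> L / (\<Sum>j\<in>K. \<mu> j)"
      by (elim Lim_transform_eventually)
    then have "bounded (range (\<lambda>n. complex_of_real ((s \<circ> r1) n) ^ ((\<Sum>j\<in>UNIV. b j) - 1)))"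
      by (rule convergent_imp_bounded)
    then obtain M where M: "\<And>n. norm (complex_of_real ((s \<circ> r1) n) ^ ((\<Sum>j\<in>UNIV. b j) - 1)) \<le> M"
      unfolding bounded_iff by auto
    show ?thesis
    proof (rule boundedI[of _ "max 1 M"])
      fix u assume "u \<in> range (s \<circ> r1)"
      then obtain n where n: "u = s (r1 n)" by auto
      show "norm u \<le> max 1 M"
      proof (cases "u \<le> 1")
        case False
        have "u ^ 1 \<le> u ^ ((\<Sum>j\<in>UNIV. b j) - 1)"
          using False B2[of j0 UNIV i1] i1 by (intro power_increasing) auto
        also have "\<dots> \<le> M" using M[of n] s[of "r1 n"] by (simp add: n norm_power)
        finally show ?thesis using False by simp
      qed (use s[of "r1 n"] n in auto)
    qed
  qed
  then obtain M where M: "\<And>n. norm (s (r1 n)) \<le> M" unfolding bounded_iff by auto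
  have "bounded (range (X \<circ> r1))"
    by (rule boundedI[of _ M]) (use M in \<open>auto simp: s_def\<close>)
  then obtain X' r2 where r2: "strict_mono r2" and X': "((X \<circ> r1) \<circ> r2) \<longlonglongrightarrow> X'"
    using bounded_imp_convergent_subsequence by blast
  define r where "r = r1 \<circ> r2"
  have r: "strict_mono r" unfolding r_def using r1 r2 by (rule strict_mono_o)
  define z where "z = (\<chi> j. X' $ j + \<xi>)"
  have xz: "(x \<circ> r) \<longlonglongrightarrow> z"
  proof (rule vec_tendstoI)
    fix j
    have "(\<lambda>n. (X \<circ> r1 \<circ> r2) n $ j + x (r n) $ j0) \<longlonglongrightarrow> X' $ j + \<xi>"
      using LIMSEQ_subseq_LIMSEQ[OF j0 r] by (intro tendsto_add tendsto_vec_nth X') (simp add: o_def)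
    then show "(\<lambda>n. (x \<circ> r) n $ j) \<longlonglongrightarrow> z $ j" by (simp add: X_def z_def r_def)
  qed
  have xzj: "(\<lambda>n. x (r n) $ j) \<longlonglongrightarrow> z $ j" for j using tendsto_vec_nth[OF xz, of j] by simp
  have "z \<in> config"
  proof (rule ccontr)
    assume "z \<notin> config"
    then obtain i k where ik: "i \<noteq> k" "z $ i = z $ k" by (auto simp: config_def)
    define S where "S = {j. z $ j = z $ i}"
    have S: "i \<in> S" "k \<in> S" using ik by (auto simp: S_def)
    \<comment> \<open>Setting Y to 0 outside S makes its norm measure the size of the collapsing
      cluster alone.\<close>
    define Y where "Y = (\<lambda>n. \<chi> j. if j \<in> S then x (r n) $ j - x (r n) $ i else 0)"
    define \<rho> where "\<rho> = (\<lambda>n. norm (Y n))"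
    have \<rho>: "\<rho> n > 0" for n
    proof -
      have "Y n $ k \<noteq> 0" using x[of "r n"] ik S by (auto simp: Y_def config_def)
      then show ?thesis by (auto simp: \<rho>_def vec_eq_iff)
    qed
    have \<rho>0: "\<rho> \<longlonglongrightarrow> 0"
    proof -
      have "Y \<longlonglongrightarrow> 0"
      proof (rule vec_tendstoI)
        fix j
        have "(\<lambda>n. x (r n) $ j - x (r n) $ i) \<longlonglongrightarrow> z $ j - z $ i" by (intro tendsto_diff xzj)
        then show "(\<lambda>n. Y n $ j) \<longlonglongrightarrow> 0 $ j" by (cases "j \<in> S") (auto simp: Y_def S_def)
      qed
      then show ?thesis unfolding \<rho>_def by (rule tendsto_norm_zero)
    qed
    have "bounded (range (\<lambda>n. Y n /\<^sub>R \<rho> n))"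
      by (rule boundedI[of _ 1]) (use \<rho> in \<open>auto simp: \<rho>_def\<close>)
    then obtain y r3 where r3: "strict_mono r3" and y: "((\<lambda>n. Y n /\<^sub>R \<rho> n) \<circ> r3) \<longlonglongrightarrow> y"
      using bounded_imp_convergent_subsequence by blast
    have "norm (Y n /\<^sub>R \<rho> n) = 1" for n using \<rho>[of n] by (simp add: \<rho>_def)
    then have "norm y = 1"
      using LIMSEQ_unique[OF tendsto_norm[OF y], of 1] by (simp add: o_def)
    then obtain j where j: "y $ j \<noteq> 0" by (metis norm_zero vec_eq_iff zero_index zero_neq_one)
    have "j \<in> S"
    proof (rule ccontr)
      assume "j \<notin> S"
      then have "y $ j = 0" using LIMSEQ_unique[OF tendsto_vec_nth[OF y, of j], of 0] by (simp add: Y_def)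
      with j show False by simp
    qed
    moreover have "y $ i = 0"
      using LIMSEQ_unique[OF tendsto_vec_nth[OF y, of i], of 0] by (simp add: Y_def S)
    ultimately have "j \<in> S" "y $ i \<noteq> y $ j" using j by auto
    moreover have "card {y $ i, y $ j} \<le> card (($) y ` S)" by (rule card_mono) (use S \<open>j \<in> S\<close> in auto)
    ultimately have card: "card (($) y ` S) \<ge> 2" by simp
    have "\<exists>K L. K \<noteq> {} \<and> K \<noteq> UNIV \<and> L \<noteq> 0 \<and> (\<lambda>n. of_real ((\<rho> \<circ> r3) n) ^ ((\<Sum>j\<in>S. b j) - 1) *
        (\<Sum>j\<in>K. res_at b ((x \<circ> r \<circ> r3) n) j)) \<longlonglongrightarrow> L"
    proof (rule cluster_residue_limit[where c = "\<lambda>n. x (r (r3 n)) $ i" and y = "($) y" and d = "\<lambda>j. z $ i - z $ j"])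
      fix j assume "j \<in> S"
      then show "(\<lambda>n. ((x \<circ> r \<circ> r3) n $ j - x (r (r3 n)) $ i) / of_real ((\<rho> \<circ> r3) n)) \<longlonglongrightarrow> y $ j"
        using tendsto_vec_nth[OF y, of j] by (simp add: Y_def o_def scaleR_conv_of_real[where 'a = complex] divide_inverse mult.commute)
    next
      fix j assume "j \<notin> S"
      show "(\<lambda>n. x (r (r3 n)) $ i - (x \<circ> r \<circ> r3) n $ j) \<longlonglongrightarrow> z $ i - z $ j"
        using LIMSEQ_subseq_LIMSEQ[OF xzj r3] by (intro tendsto_diff) (auto simp: o_def)
    next
      show "(\<rho> \<circ> r3) \<longlonglongrightarrow> 0" by (rule LIMSEQ_subseq_LIMSEQ[OF \<rho>0 r3])
    qed (use x \<rho> b card in \<open>auto simp: S_def\<close>)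
    then obtain K L where K: "K \<noteq> {}" "K \<noteq> UNIV" "L \<noteq> 0"
      "(\<lambda>n. of_real (\<rho> (r3 n)) ^ ((\<Sum>j\<in>S. b j) - 1) * (\<Sum>j\<in>K. res_at b (x (r (r3 n))) j)) \<longlonglongrightarrow> L"
      by auto
    have "(\<lambda>n. \<Sum>j\<in>K. res_at b (x (r (r3 n))) j) \<longlonglongrightarrow> (\<Sum>j\<in>K. \<mu> j)"
      using LIMSEQ_subseq_LIMSEQ[OF LIMSEQ_subseq_LIMSEQ[OF sumlim r] r3] by (simp add: o_def)
    moreover have \<rho>c: "(\<lambda>n. complex_of_real (\<rho> (r3 n))) \<longlonglongrightarrow> of_real 0"
      using LIMSEQ_subseq_LIMSEQ[OF \<rho>0 r3] by (intro tendsto_of_real) (simp add: o_def)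
    ultimately have "(\<lambda>n. of_real (\<rho> (r3 n)) ^ ((\<Sum>j\<in>S. b j) - 1) * (\<Sum>j\<in>K. res_at b (x (r (r3 n))) j)) \<longlonglongrightarrow>
        of_real 0 ^ ((\<Sum>j\<in>S. b j) - 1) * (\<Sum>j\<in>K. \<mu> j)"
      by (intro tendsto_mult tendsto_power)
    then have "L = of_real 0 ^ ((\<Sum>j\<in>S. b j) - 1) * (\<Sum>j\<in>K. \<mu> j)" using K(4) LIMSEQ_unique by blast
    moreover have "(\<Sum>j\<in>S. b j) - 1 > 0" using B2[OF S ik(1)] by simp
    ultimately show False using K(3) by simp
  qed
  with r xz show ?thesis by blast
qed

section \<open>Divided differences and local injectivity of the residues\<close>

lemma power_divided_difference:
  fixes u v :: "'a::field"
  assumes "u \<noteq> 0" "v \<noteq> 0"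
  shows "1 / u ^ n - 1 / v ^ n = (v - u) * (1 / (u * v) * (\<Sum>i<n. (1 / v) ^ (n - Suc i) * (1 / u) ^ i))"
proof -
  have "1 / u ^ n - 1 / v ^ n = (1 / u) ^ n - (1 / v) ^ n" by (simp add: power_divide)
  also have "\<dots> = (1 / u - 1 / v) * (\<Sum>i<n. (1 / v) ^ (n - Suc i) * (1 / u) ^ i)"
    by (rule power_diff_sumr2)
  also have "1 / u - 1 / v = (v - u) * (1 / (u * v))" using assms by (simp add: field_simps)
  finally show ?thesis by (simp only: mult.assoc)
qed

text \<open>Difference quotients in each pole that extend continuously over the diagonal, where they
  become the partial derivatives. They permit passing to the limit along pairs of configurations
  that approach each other. The induction changes one factor of the product at a time.\<close>

lemma normal_form_divided_difference:
  fixes b :: "'p::finite \<Rightarrow> nat"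
  shows "\<exists>D :: 'p \<Rightarrow> (complex ^ 'p) \<times> (complex ^ 'p) \<Rightarrow> complex \<Rightarrow> complex.
    (\<forall>k. continuous_on {(P, z). \<forall>j. z \<noteq> fst P $ j \<and> z \<noteq> snd P $ j} (\<lambda>(P, z). D k P z)) \<and>
    (\<forall>x y z. (\<forall>j. z \<noteq> x $ j \<and> z \<noteq> y $ j) \<longrightarrow>
       normal_form b x z - normal_form b y z = (\<Sum>k\<in>UNIV. (x $ k - y $ k) * D k (x, y) z)) \<and>
    (\<forall>x z k. (\<forall>j. z \<noteq> x $ j) \<longrightarrow> D k (x, x) z = of_nat (b k) / (z - x $ k) * normal_form b x z)"
proof -
  define V where "V = {(P :: (complex ^ 'p) \<times> (complex ^ 'p), z). \<forall>j. z \<noteq> fst P $ j \<and> z \<noteq> snd P $ j}"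
  define N where "N = (\<lambda>S (x :: complex ^ 'p) z. 1 / (\<Prod>j\<in>S. (z - x $ j) ^ b j))"
  have contN: "continuous_on V (\<lambda>p. N S (f (fst p)) (snd p))" if "f = fst \<or> f = snd" for S f
    using that unfolding N_def by (elim disjE; hypsubst; intro continuous_intros) (auto simp: V_def)
  have "\<exists>D. (\<forall>k. continuous_on V (\<lambda>(P, z). D k P z)) \<and>
      (\<forall>x y z. ((x, y), z) \<in> V \<longrightarrow> N S x z - N S y z = (\<Sum>k\<in>S. (x $ k - y $ k) * D k (x, y) z)) \<and>
      (\<forall>x z. \<forall>k\<in>S. ((x, x), z) \<in> V \<longrightarrow> D k (x, x) z = of_nat (b k) / (z - x $ k) * N S x z)"
    if "finite S" for S :: "'p set"
    using that
  proof induction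
    case empty
    show ?case by (rule exI[of _ "\<lambda>_ _ _. 0"]) (auto simp: N_def)
  next
    case (insert i S)
    from insert(3) obtain D where D': "(\<forall>k. continuous_on V (\<lambda>(P, z). D k P z)) \<and>
      (\<forall>x y z. ((x, y), z) \<in> V \<longrightarrow> N S x z - N S y z = (\<Sum>k\<in>S. (x $ k - y $ k) * D k (x, y) z)) \<and>
      (\<forall>x z. \<forall>k\<in>S. ((x, x), z) \<in> V \<longrightarrow> D k (x, x) z = of_nat (b k) / (z - x $ k) * N S x z)"
      by (elim exE)
    note D = D'[THEN conjunct1, rule_format] D'[THEN conjunct2, THEN conjunct1, rule_format]
      D'[THEN conjunct2, THEN conjunct2, rule_format]
    define G where "G = (\<lambda>(x :: complex ^ 'p) (y :: complex ^ 'p) z. 1 / ((z - x $ i) * (z - y $ i)) *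
      (\<Sum>m<b i. (1 / (z - y $ i)) ^ (b i - Suc m) * (1 / (z - x $ i)) ^ m))"
    define D' where "D' = (\<lambda>k P z. if k = i then G (fst P) (snd P) z * N S (snd P) z
       else 1 / (z - fst P $ i) ^ b i * D k P z)"
    have ins: "N (insert i S) x z = 1 / (z - x $ i) ^ b i * N S x z" for x z
      unfolding N_def using insert by simp
    show ?case
    proof (intro exI[of _ D'] conjI allI impI ballI)
      fix k
      have "continuous_on V (\<lambda>p. G (fst (fst p)) (snd (fst p)) (snd p) * N S (snd (fst p)) (snd p))"
        unfolding G_def by (intro continuous_intros contN) (auto simp: V_def)
      moreover have "continuous_on V (\<lambda>p. 1 / (snd p - fst (fst p) $ i) ^ b i * D k (fst p) (snd p))"
        using D(1)[of k] unfolding case_prod_beta by (intro continuous_intros) (auto simp: V_def)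
      ultimately show "continuous_on V (\<lambda>(P, z). D' k P z)"
        by (cases "k = i") (simp_all add: D'_def case_prod_beta)
    next
      fix x y z assume V: "((x, y), z) \<in> V"
      then have nz: "z - x $ i \<noteq> 0" "z - y $ i \<noteq> 0" by (auto simp: V_def)
      have "N (insert i S) x z - N (insert i S) y z =
         1 / (z - x $ i) ^ b i * (N S x z - N S y z) + (1 / (z - x $ i) ^ b i - 1 / (z - y $ i) ^ b i) * N S y z"
        by (simp add: ins algebra_simps diff_divide_distrib)
      also have "1 / (z - x $ i) ^ b i - 1 / (z - y $ i) ^ b i = (x $ i - y $ i) * G x y z"
        unfolding power_divided_difference[OF nz] by (simp add: G_def)
      also have "N S x z - N S y z = (\<Sum>k\<in>S. (x $ k - y $ k) * D k (x, y) z)" by (rule D(2)[OF V])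
      also have "1 / (z - x $ i) ^ b i * (\<Sum>k\<in>S. (x $ k - y $ k) * D k (x, y) z) = (\<Sum>k\<in>S. (x $ k - y $ k) * D' k (x, y) z)"
        unfolding sum_distrib_left using insert by (intro sum.cong) (auto simp: D'_def)
      finally show "N (insert i S) x z - N (insert i S) y z = (\<Sum>k\<in>insert i S. (x $ k - y $ k) * D' k (x, y) z)"
        using insert by (simp add: D'_def)
    next
      fix x z k assume k: "k \<in> insert i S" and V: "((x, x), z) \<in> V"
      then have nz: "z - x $ i \<noteq> 0" by (auto simp: V_def)
      show "D' k (x, x) z = of_nat (b k) / (z - x $ k) * N (insert i S) x z"
      proof (cases "k = i")
        case True
        have "(\<Sum>m<b i. (1 / (z - x $ i)) ^ (b i - Suc m) * (1 / (z - x $ i)) ^ m) = (\<Sum>m<b i. (1 / (z - x $ i)) ^ (b i - 1))"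
          by (intro sum.cong refl) (simp flip: power_add)
        then have "G x x z = 1 / ((z - x $ i) * (z - x $ i)) * (of_nat (b i) * (1 / (z - x $ i)) ^ (b i - 1))"
          by (simp add: G_def)
        also have "\<dots> = of_nat (b i) / (z - x $ i) * (1 / (z - x $ i) ^ b i)"
          using nz by (cases "b i") (auto simp: power_divide)
        finally show ?thesis using True by (simp add: D'_def ins)
      next
        case False
        with k D(3)[OF _ V] show ?thesis by (simp add: D'_def ins)
      qed
    qed
  qed
  from this[OF finite[of UNIV]] obtain D where D': "(\<forall>k. continuous_on V (\<lambda>(P, z). D k P z)) \<and>
      (\<forall>x y z. ((x, y), z) \<in> V \<longrightarrow> N UNIV x z - N UNIV y z = (\<Sum>k\<in>UNIV. (x $ k - y $ k) * D k (x, y) z)) \<and>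
      (\<forall>x z. \<forall>k\<in>UNIV. ((x, x), z) \<in> V \<longrightarrow> D k (x, x) z = of_nat (b k) / (z - x $ k) * N UNIV x z)"
      by (elim exE)
  note D = D'[THEN conjunct1, rule_format] D'[THEN conjunct2, THEN conjunct1, rule_format]
      D'[THEN conjunct2, THEN conjunct2, rule_format]
  have "N UNIV = normal_form b" by (simp add: N_def normal_form_def fun_eq_iff)
  with D show ?thesis by (intro exI[of _ D]) (simp add: V_def)
qed

lemma config_separation:
  fixes x :: "complex ^ 'p::finite"
  assumes "x \<in> config"
  obtains \<epsilon> where "\<epsilon> > 0" "\<And>i j. i \<noteq> j \<Longrightarrow> dist (x $ i) (x $ j) > 2 * \<epsilon>"
proof -
  define S where "S = (\<lambda>(i, j). dist (x $ i) (x $ j)) ` {(i, j). i \<noteq> j}"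
  have "finite S" "\<forall>u\<in>S. u > 0" using assms by (auto simp: S_def config_def)
  define d where "d = Min (insert 1 S)"
  have d: "d > 0" "\<And>u. u \<in> S \<Longrightarrow> d \<le> u"
    using \<open>finite S\<close> \<open>\<forall>u\<in>S. u > 0\<close> by (auto simp: d_def)
  show thesis
  proof (rule that[of "d / 3"])
    fix i j :: 'p assume "i \<noteq> j"
    then have "d \<le> dist (x $ i) (x $ j)" by (intro d(2)) (auto simp: S_def)
    with d(1) show "dist (x $ i) (x $ j) > 2 * (d / 3)" by simp
  qed (use d in simp)
qed

text \<open>One fixed circle around \<open>x $ j\<close> isolates the j-th pole of every
  configuration within \<epsilon> of x, so the residues become integrals over a path independent of
  y.\<close>

lemma res_at_circle:
  fixes x y :: "complex ^ 'p::finite"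
  assumes y: "y \<in> config" and \<epsilon>: "\<epsilon> > 0" "\<And>i j. i \<noteq> j \<Longrightarrow> dist (x $ i) (x $ j) > 2 * \<epsilon>" and d: "dist x y < \<epsilon>"
  shows "contour_integral (circlepath (x $ j) \<epsilon>) (normal_form b y) = res_at b y j"
    and "x $ j + of_real \<epsilon> * turn t \<noteq> y $ i"
proof -
  have dj: "dist (x $ i) (y $ i) < \<epsilon>" for i
    using dist_vec_nth_le[of x i y] d by simp
  have di: "dist (x $ j) (y $ i) > \<epsilon>" if "i \<noteq> j" for i
    using \<epsilon>(2)[OF that] dj[of i] dist_triangle[of "x $ i" "x $ j" "y $ i"] by (simp add: dist_commute)
  have iff: "dist (x $ j) (y $ i) < \<epsilon> \<longleftrightarrow> i = j" and ne: "dist (x $ j) (y $ i) \<noteq> \<epsilon>" for i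
    using dj[of i] di[of i] by (cases "i = j"; auto)+
  show "contour_integral (circlepath (x $ j) \<epsilon>) (normal_form b y) = res_at b y j"
    by (subst contour_integral_normal_form[OF y \<epsilon>(1) ne]) (simp add: iff)
  show "x $ j + of_real \<epsilon> * turn t \<noteq> y $ i"
  proof
    assume "x $ j + of_real \<epsilon> * turn t = y $ i"
    then have "dist (x $ j) (y $ i) = norm (of_real \<epsilon> * turn t)" by (metis add_diff_cancel_left' dist_commute dist_norm)
    with ne[of i] \<epsilon>(1) show False by (simp add: norm_mult)
  qed
qed

lemma continuous_on_res_at:
  "continuous_on config (\<lambda>x :: complex ^ 'p::finite. res_at b x j)"
proof (rule continuous_at_imp_continuous_on, rule ballI)
  fix x :: "complex ^ 'p" assume x: "x \<in> config"
  obtain \<epsilon> where \<epsilon>: "\<epsilon> > 0" "\<And>i j. i \<noteq> j \<Longrightarrow> dist (x $ i) (x $ j) > 2 * \<epsilon>"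
    using config_separation[OF x] by blast
  define U where "U = ball x \<epsilon> \<inter> config"
  have U: "open U" "x \<in> U" using x \<epsilon> open_config by (auto simp: U_def)
  define F where "F = (\<lambda>y t. normal_form b y (x $ j + of_real \<epsilon> * turn t) * (2 * of_real pi * \<i> * of_real \<epsilon> * turn t))"
  have "continuous_on (U \<times> cbox 0 1) (\<lambda>(y, t). F y t)"
    unfolding F_def case_prod_beta normal_form_def
    by (intro continuous_intros) (use res_at_circle(2)[OF _ \<epsilon>] in \<open>force simp: U_def\<close>)
  then have "continuous_on U (\<lambda>y. integral (cbox 0 1) (F y))"
    by (rule integral_continuous_on_param)
  moreover have "integral (cbox 0 1) (F y) = res_at b y j" if "y \<in> U" for y
    using res_at_circle(1)[OF _ \<epsilon>, where y = y and b = b and j = j] that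
    by (simp add: U_def contour_integral_circlepath_eq F_def)
  ultimately have "continuous_on U (\<lambda>y. res_at b y j)" by simp
  with U show "isCont (\<lambda>x. res_at b x j) x" by (simp add: continuous_on_eq_continuous_at)
qed

text \<open>The residues sum to 0, so the one at j0 carries no further information; the position of
  the pole j0 in its slot removes the freedom of translation and keeps the dimension.\<close>

definition residue_chart :: "('p::finite \<Rightarrow> nat) \<Rightarrow> 'p \<Rightarrow> complex ^ 'p \<Rightarrow> complex ^ 'p" where
  "residue_chart b j0 x = (\<chi> j. if j = j0 then x $ j0 else res_at b x j)"

lemma residue_chart_nth: "residue_chart b j0 x $ j = (if j = j0 then x $ j0 else res_at b x j)"
  by (simp add: residue_chart_def)

lemma continuous_on_residue_chart: "continuous_on config (residue_chart b j0)"
  unfolding residue_chart_def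
proof (rule continuous_on_vec_lambda)
  fix j show "continuous_on config (\<lambda>x. if j = j0 then x $ j0 else res_at b x j)"
    by (cases "j = j0") (auto intro!: continuous_intros continuous_on_res_at)
qed

text \<open>Otherwise pairs of distinct configurations with equal values would converge to x. A
  limit v of their normalised differences is a variation of the poles that leaves all residues
  unchanged to first order, hence constant, and \<open>v $ j0 = 0\<close> leaves only v = 0, against
  norm 1.\<close>

lemma residue_chart_locally_injective:
  fixes x :: "complex ^ 'p::finite"
  assumes x: "x \<in> config" and b: "\<And>j. b j \<ge> 1" and B: "(\<Sum>j\<in>UNIV. b j) \<ge> 2"
  shows "\<exists>U. open U \<and> x \<in> U \<and> U \<subseteq> config \<and> inj_on (residue_chart b j0) U"
proof (rule ccontr)
  assume neg: "\<not> ?thesis"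
  obtain \<epsilon> where \<epsilon>: "\<epsilon> > 0" "\<And>i j. i \<noteq> j \<Longrightarrow> dist (x $ i) (x $ j) > 2 * \<epsilon>"
    using config_separation[OF x] by blast
  define W where "W = ball x \<epsilon> \<inter> config"
  have W: "open W" "x \<in> W" using x \<epsilon> open_config by (auto simp: W_def)
  have "\<exists>q. fst q \<noteq> snd q \<and> fst q \<in> W \<and> snd q \<in> W \<and> dist x (fst q) < 1 / Suc n \<and>
      dist x (snd q) < 1 / Suc n \<and> residue_chart b j0 (fst q) = residue_chart b j0 (snd q)" for n :: nat
  proof -
    let ?V = "W \<inter> ball x (1 / Suc n)"
    have "open ?V" "x \<in> ?V" "?V \<subseteq> config" using W by (auto simp: W_def)
    then have "\<not> inj_on (residue_chart b j0) ?V" using neg by blast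
    then obtain y z where "y \<in> ?V" "z \<in> ?V" "y \<noteq> z" "residue_chart b j0 y = residue_chart b j0 z"
      unfolding inj_on_def by blast
    then show ?thesis by (intro exI[of _ "(y, z)"]) simp
  qed
  then have "\<forall>n. \<exists>q. fst q \<noteq> snd q \<and> fst q \<in> W \<and> snd q \<in> W \<and> dist x (fst q) < 1 / Suc n \<and>
      dist x (snd q) < 1 / Suc n \<and> residue_chart b j0 (fst q) = residue_chart b j0 (snd q)"
    by (rule allI)
  from choice[OF this] obtain q where q: "\<forall>n. fst (q n) \<noteq> snd (q n) \<and> fst (q n) \<in> W \<and> snd (q n) \<in> W \<and> dist x (fst (q n)) < 1 / Suc n \<and>
      dist x (snd (q n)) < 1 / Suc n \<and> residue_chart b j0 (fst (q n)) = residue_chart b j0 (snd (q n))"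
    by (elim exE)
  define y where "y = (\<lambda>n. fst (q n))"
  define z where "z = (\<lambda>n. snd (q n))"
  have yz: "y n \<noteq> z n" "y n \<in> W" "z n \<in> W" "dist x (y n) < 1 / Suc n" "dist x (z n) < 1 / Suc n"
    "residue_chart b j0 (y n) = residue_chart b j0 (z n)" for n
    using q[rule_format, of n] by (simp_all only: y_def z_def simp_thms)
  have lim: "w \<longlonglongrightarrow> x" if "\<And>n. dist x (w n) < 1 / Suc n" for w
  proof (rule metric_LIMSEQ_I)
    fix r :: real assume "r > 0"
    then obtain N where "1 / real (Suc N) < r" using nat_approx_posE by blast
    then have "dist (w n) x < r" if "n \<ge> N" for n
      using \<open>\<And>n. dist x (w n) < 1 / Suc n\<close>[of n] that frac_le[of 1 1 "real (Suc N)" "real (Suc n)"] by (simp add: dist_commute)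
    then show "\<exists>no. \<forall>n\<ge>no. dist (w n) x < r" by blast
  qed
  have ylim: "y \<longlonglongrightarrow> x" and zlim: "z \<longlonglongrightarrow> x" by (rule lim, rule yz)+
  \<comment> \<open>The residues at j0 agree as well, since all residues sum to 0.\<close>
  have eq: "res_at b (y n) j = res_at b (z n) j" for n j
  proof (cases "j = j0")
    case False
    then show ?thesis using arg_cong[OF yz(6)[of n], of "\<lambda>v. v $ j"] by (simp add: residue_chart_nth)
  next
    case True
    have "res_at b w j0 = - (\<Sum>j\<in>UNIV - {j0}. res_at b w j)" if "w \<in> W" for w
    proof -
      have "(\<Sum>j\<in>UNIV. res_at b w j) = 0" using sum_res_at[of w b] B that by (simp add: W_def)
      then have "res_at b w j0 + (\<Sum>j\<in>UNIV - {j0}. res_at b w j) = 0"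
        by (subst (asm) sum.remove[of UNIV j0]) auto
      then show ?thesis by (rule add_eq_0_iff2[THEN iffD1])
    qed
    moreover have "(\<Sum>j\<in>UNIV - {j0}. res_at b (y n) j) = (\<Sum>j\<in>UNIV - {j0}. res_at b (z n) j)"
    proof (rule sum.cong)
      fix j assume "j \<in> UNIV - {j0}"
      then show "res_at b (y n) j = res_at b (z n) j"
        using arg_cong[OF yz(6)[of n], of "\<lambda>v. v $ j"] by (simp add: residue_chart_nth)
    qed simp
    ultimately show ?thesis using yz(2,3) True by simp
  qed
  define u where "u = (\<lambda>n. (y n - z n) /\<^sub>R norm (y n - z n))"
  have normu: "norm (u n) = 1" for n using yz(1)[of n] by (simp add: u_def)
  have "bounded (range u)" by (rule boundedI[of _ 1]) (use normu in auto)
  then obtain v r where r: "strict_mono r" and v: "(u \<circ> r) \<longlonglongrightarrow> v"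
    using bounded_imp_convergent_subsequence by blast
  have "norm v = 1"
    using LIMSEQ_unique[OF tendsto_norm[OF v], of 1] normu by (simp add: o_def)
  have "y n $ j0 = z n $ j0" for n
    using arg_cong[OF yz(6)[of n], of "\<lambda>v. v $ j0"] by (simp add: residue_chart_nth)
  then have v0: "v $ j0 = 0"
    using LIMSEQ_unique[OF tendsto_vec_nth[OF v, of j0], of 0] by (simp add: u_def)
  obtain D :: "'p \<Rightarrow> (complex ^ 'p) \<times> (complex ^ 'p) \<Rightarrow> complex \<Rightarrow> complex" where D':
    "(\<forall>k. continuous_on {(P, z). \<forall>j. z \<noteq> fst P $ j \<and> z \<noteq> snd P $ j} (\<lambda>(P, z). D k P z)) \<and>
    (\<forall>x y z. (\<forall>j. z \<noteq> x $ j \<and> z \<noteq> y $ j) \<longrightarrow>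
       normal_form b x z - normal_form b y z = (\<Sum>k\<in>UNIV. (x $ k - y $ k) * D k (x, y) z)) \<and>
    (\<forall>x z k. (\<forall>j. z \<noteq> x $ j) \<longrightarrow> D k (x, x) z = of_nat (b k) / (z - x $ k) * normal_form b x z)"
    using normal_form_divided_difference[of b] by (elim exE)
  note D = D'[THEN conjunct1, rule_format] D'[THEN conjunct2, THEN conjunct1, rule_format]
      D'[THEN conjunct2, THEN conjunct2, rule_format]
  have "residue (\<lambda>\<zeta>. (\<Sum>k\<in>UNIV. of_nat (b k) * v $ k / (\<zeta> - x $ k)) / (\<Prod>j\<in>UNIV. (\<zeta> - x $ j) ^ b j)) (x $ j) = 0" for j
  proof -
    define c where "c = (\<lambda>t. x $ j + of_real \<epsilon> * turn t)"
    define c' where "c' = (\<lambda>t. 2 * of_real pi * \<i> * of_real \<epsilon> * turn t)"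
    have cW: "c t \<noteq> w $ i" if "w \<in> W" for w t i
      unfolding c_def by (rule res_at_circle(2)[OF _ \<epsilon>]) (use that in \<open>auto simp: W_def\<close>)
    have contc: "continuous_on {0..1} c" unfolding c_def by (intro continuous_intros)
    define F where "F = (\<lambda>P t. (\<Sum>k\<in>UNIV. snd P $ k * D k (fst P) (c t)) * c' t)"
    define U where "U = (W \<times> W) \<times> (UNIV :: (complex ^ 'p) set)"
    have "continuous_on (U \<times> {0..1}) (\<lambda>p. D k (fst (fst p)) (c (snd p)))" for k
    proof -
      have "continuous_on (U \<times> {0..1}) (\<lambda>p. (fst (fst p), c (snd p)))"
        unfolding c_def by (intro continuous_intros)
      moreover have "(\<lambda>p. (fst (fst p), c (snd p))) ` (U \<times> {0..1}) \<subseteq> {(P, z). \<forall>j. z \<noteq> fst P $ j \<and> z \<noteq> snd P $ j}"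
      proof (rule image_subsetI)
        fix p assume "p \<in> U \<times> {0..1::real}"
        then have "fst (fst (fst p)) \<in> W" "snd (fst (fst p)) \<in> W" by (auto simp: U_def)
        from this[THEN cW] show "(fst (fst p), c (snd p)) \<in> {(P, z). \<forall>j. z \<noteq> fst P $ j \<and> z \<noteq> snd P $ j}"
          by simp
      qed
      ultimately show ?thesis
        using continuous_on_compose2[OF D(1)[of k], of "U \<times> {0..1}" "\<lambda>p. (fst (fst p), c (snd p))"] by simp
    qed
    then have contF: "continuous_on (U \<times> {0..1}) (\<lambda>(P, t). F P t)"
      unfolding F_def c'_def case_prod_beta by (intro continuous_intros)
    \<comment> \<open>Along the pairs the integral is a difference of two equal residues divided by
      a norm, so it is 0; its limit is, up to 2 pi i, the residue of the varied form.\<close>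
    have "(\<lambda>n. integral {0..1} (F ((y (r n), z (r n)), u (r n)))) \<longlonglongrightarrow> integral {0..1} (F ((x, x), v))"
    proof (rule tendsto_integral_param[OF contF])
      show "(\<lambda>n. ((y (r n), z (r n)), u (r n))) \<longlonglongrightarrow> ((x, x), v)"
        using LIMSEQ_subseq_LIMSEQ[OF ylim r] LIMSEQ_subseq_LIMSEQ[OF zlim r] v
        by (intro tendsto_Pair) (auto simp: o_def)
    qed (use W yz in \<open>auto simp: U_def\<close>)
    moreover have "integral {0..1} (F ((y n, z n), u n)) = 0" for n
    proof -
      have F: "F ((y n, z n), u n) t =
        (of_real (1 / norm (y n - z n))) * (normal_form b (y n) (c t) * c' t - normal_form b (z n) (c t) * c' t)" for t
      proof -
        have "normal_form b (y n) (c t) - normal_form b (z n) (c t) =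
           (\<Sum>k\<in>UNIV. (y n $ k - z n $ k) * D k (y n, z n) (c t))"
          by (rule D(2)) (use cW yz in auto)
        moreover have "F ((y n, z n), u n) t = of_real (1 / norm (y n - z n)) * (\<Sum>k\<in>UNIV. (y n $ k - z n $ k) * D k (y n, z n) (c t)) * c' t"
        proof -
          have "u n $ k = of_real (1 / norm (y n - z n)) * (y n $ k - z n $ k)" for k
            by (simp add: u_def scaleR_conv_of_real[where 'a = complex] divide_inverse)
          then show ?thesis by (simp only: F_def fst_conv snd_conv sum_distrib_left mult.assoc)
        qed
        ultimately have "F ((y n, z n), u n) t =
            of_real (1 / norm (y n - z n)) * (normal_form b (y n) (c t) - normal_form b (z n) (c t)) * c' t"
          by simp
        then show ?thesis by (simp only: left_diff_distrib mult.assoc)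
      qed
      have int: "(\<lambda>t. normal_form b w (c t) * c' t) integrable_on {0..1}" if "w \<in> W" for w
        unfolding normal_form_def c'_def using cW[OF that] contc
        by (intro integrable_continuous_real continuous_intros) simp_all
      have R: "integral {0..1} (\<lambda>t. normal_form b w (c t) * c' t) = res_at b w j" if "w \<in> W" for w
        using res_at_circle(1)[OF _ \<epsilon>, where y = w and b = b and j = j] that
        by (simp add: W_def contour_integral_circlepath_eq c_def c'_def)
      have "integral {0..1} (F ((y n, z n), u n)) = of_real (1 / norm (y n - z n)) *
         (integral {0..1} (\<lambda>t. normal_form b (y n) (c t) * c' t) - integral {0..1} (\<lambda>t. normal_form b (z n) (c t) * c' t))"
        unfolding F integral_mult_right using int yz by (simp add: integral_diff)
      then show ?thesis using R yz eq by simp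
    qed
    ultimately have "integral {0..1} (F ((x, x), v)) = 0"
      using LIMSEQ_unique[OF _ tendsto_const] by auto
    moreover
    have "F ((x, x), v) t = (\<Sum>k\<in>UNIV. of_nat (b k) * v $ k / (c t - x $ k)) / (\<Prod>j\<in>UNIV. (c t - x $ j) ^ b j) * c' t" for t
    proof -
      have "D k (x, x) (c t) = of_nat (b k) / (c t - x $ k) * normal_form b x (c t)" for k
        by (rule D(3)) (use cW[OF W(2)] in auto)
      then have "F ((x, x), v) t = (\<Sum>k\<in>UNIV. of_nat (b k) * v $ k / (c t - x $ k) * normal_form b x (c t)) * c' t"
        by (simp add: F_def mult.assoc mult.left_commute)
      then show ?thesis by (simp add: normal_form_def sum_divide_distrib)
    qed
    then have "F ((x, x), v) = (\<lambda>t. (\<Sum>k\<in>UNIV. of_nat (b k) * v $ k / (c t - x $ k)) / (\<Prod>j\<in>UNIV. (c t - x $ j) ^ b j) * c' t)"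
      by (rule ext)
    ultimately have "integral {0..1} (\<lambda>t. (\<Sum>k\<in>UNIV. of_nat (b k) * v $ k / (c t - x $ k)) / (\<Prod>j\<in>UNIV. (c t - x $ j) ^ b j) * c' t) = 0"
      by (simp only:)
    then have "contour_integral (circlepath (x $ j) \<epsilon>)
      (\<lambda>\<zeta>. (\<Sum>k\<in>UNIV. of_nat (b k) * v $ k / (\<zeta> - x $ k)) / (\<Prod>j\<in>UNIV. (\<zeta> - x $ j) ^ b j)) = 0"
      unfolding contour_integral_circlepath_eq by (simp add: c_def c'_def)
    moreover have "contour_integral (circlepath (x $ j) \<epsilon>)
      (\<lambda>\<zeta>. (\<Sum>k\<in>UNIV. of_nat (b k) * v $ k / (\<zeta> - x $ k)) / (\<Prod>j\<in>UNIV. (\<zeta> - x $ j) ^ b j)) =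
      2 * pi * \<i> * residue (\<lambda>\<zeta>. (\<Sum>k\<in>UNIV. of_nat (b k) * v $ k / (\<zeta> - x $ k)) / (\<Prod>j\<in>UNIV. (\<zeta> - x $ j) ^ b j)) (x $ j)"
    proof (rule contour_integral_unique, rule base_residue[of "- (range (($) x) - {x $ j})"])
      show "open (- (range (($) x) - {x $ j}))" by (intro open_Compl finite_imp_closed finite_Diff) auto
      show "cball (x $ j) \<epsilon> \<subseteq> - (range (($) x) - {x $ j})"
      proof
        fix w assume w: "w \<in> cball (x $ j) \<epsilon>"
        have "w = x $ j" if "w = x $ i" for i
          using w that \<epsilon>(2)[of j i] \<epsilon>(1) by (cases "i = j") auto
        then show "w \<in> - (range (($) x) - {x $ j})" by blast
      qed
    qed (use \<epsilon> in \<open>auto intro!: holomorphic_intros\<close>)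
    ultimately show ?thesis by simp
  qed
  then have "v $ k = v $ j0" for k
    using variation_with_zero_residues[of "($) x" b "($) v" k j0] x b by (auto simp: config_def inj_def)
  with v0 have "v = 0" by (simp add: vec_eq_iff)
  with \<open>norm v = 1\<close> show False by simp
qed


section \<open>The residue chart over nonresonant values\<close>

text \<open>For vectors of sum 0 the sum over a set containing j0 is minus the sum over its
  complement. The sets avoiding j0 therefore capture all resonances, and the slot j0 stays free for
  the position of a pole.\<close>

definition regular_residues :: "'p::finite \<Rightarrow> (complex ^ 'p) set" where
  "regular_residues j0 = {\<mu>. \<forall>K. K \<noteq> {} \<longrightarrow> j0 \<notin> K \<longrightarrow> (\<Sum>j\<in>K. \<mu> $ j) \<noteq> 0}"

definition regular_config :: "('p::finite \<Rightarrow> nat) \<Rightarrow> 'p \<Rightarrow> (complex ^ 'p) set" where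
  "regular_config b j0 = {x \<in> config. residue_chart b j0 x \<in> regular_residues j0}"

lemma open_regular_residues: "open (regular_residues j0)"
proof -
  have "regular_residues j0 = (\<Inter>K\<in>{K. K \<noteq> {} \<and> j0 \<notin> K}. {\<mu>. (\<Sum>j\<in>K. \<mu> $ j) \<noteq> 0})"
    by (auto simp: regular_residues_def)
  also have "open \<dots>" by (intro open_INT) (auto intro!: open_Collect_neq continuous_intros)
  finally show ?thesis .
qed

lemma residue_chart_proper_local_injection:
  fixes b :: "'p::finite \<Rightarrow> nat"
  assumes b: "\<And>j. b j \<ge> 1" and B: "(\<Sum>j\<in>UNIV. b j) \<ge> 2" and p: "CARD('p) \<ge> 2"
  shows "proper_local_injection (regular_config b j0) (residue_chart b j0) (regular_residues j0)"
proof
  show "open (regular_residues j0)" by (rule open_regular_residues)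
  have "regular_config b j0 = config \<inter> residue_chart b j0 -` regular_residues j0"
    by (auto simp: regular_config_def)
  also have "open \<dots>"
    by (rule continuous_open_preimage[OF continuous_on_residue_chart open_config open_regular_residues])
  finally show op: "open (regular_config b j0)" .
  have sub: "regular_config b j0 \<subseteq> config" by (auto simp: regular_config_def)
  then show "continuous_on (regular_config b j0) (residue_chart b j0)"
    by (rule continuous_on_subset[OF continuous_on_residue_chart])
  show "residue_chart b j0 ` regular_config b j0 \<subseteq> regular_residues j0"
    by (auto simp: regular_config_def)
  fix x assume x: "x \<in> regular_config b j0"
  then obtain U where U: "open U" "x \<in> U" "U \<subseteq> config" "inj_on (residue_chart b j0) U"
    using residue_chart_locally_injective[of x b j0] b B sub by auto
  then show "\<exists>U. open U \<and> x \<in> U \<and> U \<subseteq> regular_config b j0 \<and> inj_on (residue_chart b j0) U"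
    using x op by (intro exI[of _ "U \<inter> regular_config b j0"]) (auto intro: inj_on_subset)
next
  fix s y
  assume s: "\<And>n. s n \<in> regular_config b j0" and lim: "(\<lambda>n. residue_chart b j0 (s n)) \<longlonglongrightarrow> y"
    and y: "y \<in> regular_residues j0"
  have sc: "s n \<in> config" for n using s[of n] by (simp add: regular_config_def)
  \<comment> \<open>Puts the missing residue back into the slot that held the position of the
    pole.\<close>
  define \<mu> where "\<mu> = (\<lambda>j. if j = j0 then - (\<Sum>j\<in>UNIV - {j0}. y $ j) else y $ j)"
  have limj: "(\<lambda>n. res_at b (s n) j) \<longlonglongrightarrow> y $ j" if "j \<noteq> j0" for j
    using tendsto_vec_nth[OF lim, of j] that by (simp add: residue_chart_nth)
  have res0: "res_at b (s n) j0 = - (\<Sum>j\<in>UNIV - {j0}. res_at b (s n) j)" for n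
  proof -
    have "(\<Sum>j\<in>UNIV. res_at b (s n) j) = 0" using sum_res_at[OF sc B] .
    then have "res_at b (s n) j0 + (\<Sum>j\<in>UNIV - {j0}. res_at b (s n) j) = 0"
      by (subst (asm) sum.remove[of UNIV j0]) auto
    then show ?thesis by (rule add_eq_0_iff2[THEN iffD1])
  qed
  have lim\<mu>: "(\<lambda>n. res_at b (s n) j) \<longlonglongrightarrow> \<mu> j" for j
  proof (cases "j = j0")
    case True
    have "(\<lambda>n. - (\<Sum>j\<in>UNIV - {j0}. res_at b (s n) j)) \<longlonglongrightarrow> - (\<Sum>j\<in>UNIV - {j0}. y $ j)"
      by (intro tendsto_minus tendsto_sum limj) simp
    with True show ?thesis by (simp only: \<mu>_def res0 if_True refl)
  qed (simp add: \<mu>_def limj)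
  have \<mu>0: "(\<Sum>j\<in>UNIV. \<mu> j) = 0"
    by (subst sum.remove[of UNIV j0]) (auto simp: \<mu>_def)
  have nz: "(\<Sum>j\<in>K. \<mu> j) \<noteq> 0" if "K \<noteq> {}" "j0 \<notin> K" for K
  proof -
    have "(\<Sum>j\<in>K. \<mu> j) = (\<Sum>j\<in>K. y $ j)" using that by (intro sum.cong) (auto simp: \<mu>_def)
    with y that show ?thesis by (simp add: regular_residues_def)
  qed
  have nzK: "(\<Sum>j\<in>K. \<mu> j) \<noteq> 0" if "K \<noteq> {}" "K \<noteq> UNIV" for K
  proof (cases "j0 \<in> K")
    case False
    with nz that show ?thesis by blast
  next
    case True
    have "(\<Sum>j\<in>K. \<mu> j) + (\<Sum>j\<in>-K. \<mu> j) = (\<Sum>j\<in>K \<union> -K. \<mu> j)"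
      by (rule sum.union_disjoint[symmetric]) auto
    also have "\<dots> = 0" using \<mu>0 by (simp add: Compl_partition)
    finally have sum: "(\<Sum>j\<in>K. \<mu> j) + (\<Sum>j\<in>-K. \<mu> j) = 0" .
    have "-K \<noteq> {}" "j0 \<notin> -K" using True that by auto
    from nz[OF this] sum show ?thesis by auto
  qed
  have "(\<lambda>n. s n $ j0) \<longlonglongrightarrow> y $ j0"
    using tendsto_vec_nth[OF lim, of j0] by (simp add: residue_chart_nth)
  then have "\<exists>x\<in>config. \<exists>r. strict_mono (r :: nat \<Rightarrow> nat) \<and> (s \<circ> r) \<longlonglongrightarrow> x"
    by (rule config_limit[OF sc b p _ lim\<mu>]) (rule nzK)
  then obtain x r where x: "x \<in> config" "strict_mono (r :: nat \<Rightarrow> nat)" "(s \<circ> r) \<longlonglongrightarrow> x"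
    by (elim bexE exE conjE)
  have "(\<lambda>n. residue_chart b j0 ((s \<circ> r) n)) \<longlonglongrightarrow> residue_chart b j0 x"
    by (rule continuous_on_tendsto_compose[OF continuous_on_residue_chart x(3,1)]) (simp add: sc)
  moreover have "(\<lambda>n. residue_chart b j0 ((s \<circ> r) n)) \<longlonglongrightarrow> y"
    using LIMSEQ_subseq_LIMSEQ[OF lim x(2)] by (simp add: o_def)
  ultimately have "residue_chart b j0 x = y" by (rule LIMSEQ_unique)
  with x y show "\<exists>x\<in>regular_config b j0. \<exists>r. strict_mono (r :: nat \<Rightarrow> nat) \<and> (s \<circ> r) \<longlonglongrightarrow> x"
    by (auto simp: regular_config_def)
qed

section \<open>The covering of the nonresonant vectors\<close>

definition coord_sum :: "'p::finite set \<Rightarrow> complex ^ 'p \<Rightarrow> complex" where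
  "coord_sum K l = (\<Sum>j\<in>K. l $ j)"

lemma coord_sum_simps [simp]:
  "coord_sum K (l + m) = coord_sum K l + coord_sum K m" "coord_sum K (l - m) = coord_sum K l - coord_sum K m"
  "coord_sum K (c *s l) = c * coord_sum K l" "coord_sum K 0 = 0"
  by (simp_all add: coord_sum_def sum.distrib sum_subtractf sum_distrib_left)

lemma coord_sum_scaleR [simp]: "coord_sum K (r *\<^sub>R l) = of_real r * coord_sum K l"
  unfolding coord_sum_def vector_scaleR_component scaleR_conv_of_real[where 'a = complex] sum_distrib_left ..

lemma continuous_on_coord_sum [continuous_intros]: "continuous_on A f \<Longrightarrow> continuous_on A (\<lambda>x. coord_sum K (f x))"
  unfolding coord_sum_def by (intro continuous_intros)

lemma continuous_on_smult [continuous_intros]: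
  fixes f :: "'a::topological_space \<Rightarrow> complex"
  shows "continuous_on A f \<Longrightarrow> continuous_on A g \<Longrightarrow> continuous_on A (\<lambda>x. f x *s (g x :: complex ^ 'p::finite))"
  unfolding vector_scalar_mult_def by (intro continuous_on_vec_lambda continuous_intros)

definition proper_subset :: "'p set \<Rightarrow> bool" where
  "proper_subset K \<longleftrightarrow> K \<noteq> {} \<and> K \<noteq> UNIV"

definition nonresonant :: "(complex ^ 'p::finite) set" where
  "nonresonant = {l. coord_sum UNIV l = 0 \<and> (\<forall>K. proper_subset K \<longrightarrow> coord_sum K l \<noteq> 0)}"

lemma nonresonant_eq: "nonresonant = residual_space - resonance_arrangement"
  by (auto simp: nonresonant_def residual_space_def resonance_arrangement_def
      resonance_hyperplane_def coord_sum_def proper_subset_def)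

definition residues :: "('p::finite \<Rightarrow> nat) \<Rightarrow> complex ^ 'p \<Rightarrow> complex ^ 'p" where
  "residues b x = (\<chi> j. res_at b x j)"

locale residue_covering =
  fixes b :: "'p::finite \<Rightarrow> nat" and j0 :: 'p
  assumes b: "\<And>j. b j \<ge> 1" and B: "(\<Sum>j\<in>UNIV. b j) \<ge> 2" and p: "CARD('p) \<ge> 2"
begin

sublocale C: proper_local_injection "regular_config b j0" "residue_chart b j0" "regular_residues j0"
  by (rule residue_chart_proper_local_injection[OF b B p])

text \<open>Placing the pole j0 at 0 picks one configuration in each translation class.\<close>

definition X0 :: "(complex ^ 'p) set" where
  "X0 = {x \<in> config. x $ j0 = 0 \<and> residues b x \<in> nonresonant}"

text \<open>The value of the residue chart on a configuration of \<open>X0\<close> with residues l: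
  its slot j0 holds the position 0.\<close>

definition drop_coord :: "complex ^ 'p \<Rightarrow> complex ^ 'p" where
  "drop_coord l = (\<chi> j. if j = j0 then 0 else l $ j)"

lemma continuous_on_drop: "continuous_on A drop_coord"
  unfolding drop_coord_def
proof (rule continuous_on_vec_lambda)
  fix j show "continuous_on A (\<lambda>l :: complex ^ 'p. if j = j0 then 0 else l $ j)"
    by (cases "j = j0") (auto intro!: continuous_intros)
qed

lemma drop_regular: "l \<in> nonresonant \<Longrightarrow> drop_coord l \<in> regular_residues j0"
proof -
  assume l: "l \<in> nonresonant"
  have "(\<Sum>j\<in>K. drop_coord l $ j) \<noteq> 0" if K: "K \<noteq> {}" "j0 \<notin> K" for K
  proof -
    have "(\<Sum>j\<in>K. drop_coord l $ j) = coord_sum K l"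
      unfolding coord_sum_def by (intro sum.cong) (use K in \<open>auto simp: drop_coord_def\<close>)
    moreover have "proper_subset K" using K by (auto simp: proper_subset_def)
    ultimately show ?thesis using l by (simp add: nonresonant_def)
  qed
  then show ?thesis by (simp add: regular_residues_def)
qed

lemma sum_residues: "x \<in> config \<Longrightarrow> coord_sum UNIV (residues b x) = 0"
  using sum_res_at[of x b] B by (simp add: coord_sum_def residues_def)

lemma residue_chart_eq_drop: "x $ j0 = 0 \<Longrightarrow> residue_chart b j0 x = drop_coord (residues b x)"
  by (simp add: vec_eq_iff residue_chart_nth drop_coord_def residues_def)

lemma X0_regular: "x \<in> X0 \<Longrightarrow> x \<in> regular_config b j0"
  by (simp add: X0_def regular_config_def residue_chart_eq_drop drop_regular)

lemma drop_inj:
  assumes "coord_sum UNIV l = 0" "coord_sum UNIV m = 0" "\<And>j. j \<noteq> j0 \<Longrightarrow> l $ j = m $ j"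
  shows "l = m"
proof -
  have "l $ j0 + (\<Sum>j\<in>UNIV - {j0}. l $ j) = m $ j0 + (\<Sum>j\<in>UNIV - {j0}. m $ j)"
    using assms(1,2) sum.remove[of UNIV j0 "($) l"] sum.remove[of UNIV j0 "($) m"] by (simp add: coord_sum_def)
  moreover have "(\<Sum>j\<in>UNIV - {j0}. l $ j) = (\<Sum>j\<in>UNIV - {j0}. m $ j)"
    using assms(3) by (intro sum.cong) auto
  ultimately have "l $ j0 = m $ j0" by simp
  with assms(3) show ?thesis by (metis vec_eq_iff)
qed

text \<open>Dropping the coordinate j0 turns this into a lifting problem for the chart. The slot j0
  of the lift says that the pole stays at 0, and the zero sum recovers the residue there.\<close>

lemma lift_exists:
  fixes H :: "'c::real_normed_vector \<Rightarrow> complex ^ 'p"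
  assumes Z: "convex Z" "z0 \<in> Z" and H: "continuous_on Z H" "H ` Z \<subseteq> nonresonant"
    and x0: "x0 \<in> X0" "residues b x0 = H z0"
  shows "\<exists>h. continuous_on Z h \<and> h ` Z \<subseteq> X0 \<and> h z0 = x0 \<and> (\<forall>z\<in>Z. residues b (h z) = H z)"
proof -
  have "residue_chart b j0 x0 = drop_coord (H z0)"
    using x0 residue_chart_eq_drop by (simp add: X0_def)
  moreover have "continuous_on Z (\<lambda>z. drop_coord (H z))"
    by (rule continuous_on_compose2[OF continuous_on_drop[of UNIV] H(1)]) simp
  moreover have "(\<lambda>z. drop_coord (H z)) ` Z \<subseteq> regular_residues j0" using H(2) drop_regular by auto
  ultimately have "\<exists>h. continuous_on Z h \<and> h ` Z \<subseteq> regular_config b j0 \<and> h z0 = x0 \<and>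
      (\<forall>z\<in>Z. residue_chart b j0 (h z) = drop_coord (H z))"
    by (intro C.lift_convex[OF Z(1) _ _ Z(2) X0_regular[OF x0(1)]])
  then obtain h where h': "continuous_on Z h \<and> h ` Z \<subseteq> regular_config b j0 \<and> h z0 = x0 \<and>
      (\<forall>z\<in>Z. residue_chart b j0 (h z) = drop_coord (H z))"
    by (elim exE)
  note h = h'[THEN conjunct1] h'[THEN conjunct2, THEN conjunct1] h'[THEN conjunct2, THEN conjunct2, THEN conjunct1]
    h'[THEN conjunct2, THEN conjunct2, THEN conjunct2, rule_format]
  have "h z \<in> X0 \<and> residues b (h z) = H z" if z: "z \<in> Z" for z
  proof -
    have conf: "h z \<in> config" using h(2) z by (auto simp: regular_config_def)
    have "h z $ j0 = 0"
      using arg_cong[OF h(4)[OF z], of "\<lambda>l. l $ j0"] by (simp add: residue_chart_nth drop_coord_def)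
    moreover have "residues b (h z) = H z"
    proof (rule drop_inj)
      show "coord_sum UNIV (residues b (h z)) = 0" by (rule sum_residues[OF conf])
      show "coord_sum UNIV (H z) = 0" using H(2) z by (auto simp: nonresonant_def)
      fix j assume "j \<noteq> j0"
      then show "residues b (h z) $ j = H z $ j"
        using arg_cong[OF h(4)[OF z], of "\<lambda>l. l $ j"] by (simp add: residue_chart_nth drop_coord_def residues_def)
    qed
    ultimately show ?thesis using conf H(2) z by (auto simp: X0_def)
  qed
  then show ?thesis using h(1,3) by (intro exI[of _ h]) auto
qed

lemma lift_unique:
  fixes g h :: "'c::real_normed_vector \<Rightarrow> complex ^ 'p"
  assumes "convex Z" "continuous_on Z g" "g ` Z \<subseteq> X0" "continuous_on Z h" "h ` Z \<subseteq> X0"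
    "\<And>z. z \<in> Z \<Longrightarrow> residues b (g z) = residues b (h z)" "z0 \<in> Z" "g z0 = h z0" "z \<in> Z"
  shows "g z = h z"
proof (rule C.lift_unique[of Z g h z0 z])
  fix z assume z: "z \<in> Z"
  then have "g z $ j0 = 0" "h z $ j0 = 0" using assms(3,5) by (auto simp: X0_def)
  with assms(6)[OF z] show "residue_chart b j0 (g z) = residue_chart b j0 (h z)"
    by (simp add: residue_chart_eq_drop)
qed (use assms X0_regular in auto)

section \<open>Sections over convex sets and transport along loops\<close>

definition is_section :: "(complex ^ 'p) set \<Rightarrow> (complex ^ 'p \<Rightarrow> complex ^ 'p) \<Rightarrow> bool" where
  "is_section T \<sigma> \<longleftrightarrow> continuous_on T \<sigma> \<and> \<sigma> ` T \<subseteq> X0 \<and> (\<forall>l\<in>T. residues b (\<sigma> l) = l)"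

definition lifts :: "(real \<Rightarrow> complex ^ 'p) \<Rightarrow> complex ^ 'p \<Rightarrow> complex ^ 'p \<Rightarrow> bool" where
  "lifts \<gamma> x y \<longleftrightarrow> (\<exists>h. path h \<and> path_image h \<subseteq> X0 \<and> (\<forall>t\<in>{0..1}. residues b (h t) = \<gamma> t) \<and> h 0 = x \<and> h 1 = y)"

lemma lifts_unique:
  assumes "lifts \<gamma> x y" "lifts \<gamma> x y'"
  shows "y = y'"
proof -
  obtain h where h: "path h" "path_image h \<subseteq> X0" "\<forall>t\<in>{0..1}. residues b (h t) = \<gamma> t" "h 0 = x" "h 1 = y"
    using assms(1) by (auto simp: lifts_def)
  obtain g where g: "path g" "path_image g \<subseteq> X0" "\<forall>t\<in>{0..1}. residues b (g t) = \<gamma> t" "g 0 = x" "g 1 = y'"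
    using assms(2) by (auto simp: lifts_def)
  have "h 1 = g 1"
    by (rule lift_unique[of "{0..1}" h g 0]) (use g h in \<open>auto simp: path_def path_image_def\<close>)
  with g h show ?thesis by simp
qed

lemma section_exists:
  assumes "convex T" "T \<subseteq> nonresonant" "l \<in> T" "x \<in> X0" "residues b x = l"
  obtains \<sigma> where "is_section T \<sigma>" "\<sigma> l = x"
proof -
  have "\<exists>h. continuous_on T h \<and> h ` T \<subseteq> X0 \<and> h l = x \<and> (\<forall>z\<in>T. residues b (h z) = z)"
    by (rule lift_exists) (use assms in auto)
  then obtain h where "continuous_on T h" "h ` T \<subseteq> X0" "h l = x" "\<forall>z\<in>T. residues b (h z) = z"
    by (elim exE conjE)
  then show thesis by (intro that[of h]) (simp_all add: is_section_def)
qed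

lemma section_unique:
  assumes "convex T" "is_section T \<sigma>" "is_section T \<tau>" "l \<in> T" "\<sigma> l = \<tau> l" "m \<in> T"
  shows "\<sigma> m = \<tau> m"
  by (rule lift_unique[of T \<sigma> \<tau> l]) (use assms in \<open>auto simp: is_section_def\<close>)

text \<open>Over a convex T the sections play the role of sheets. A loop based anywhere in T carries
  sheets to sheets, so monodromy can be compared between different base points in T.\<close>

definition transports :: "(complex ^ 'p \<Rightarrow> complex ^ 'p) \<Rightarrow> (complex ^ 'p \<Rightarrow> complex ^ 'p) \<Rightarrow>
    (real \<Rightarrow> complex ^ 'p) \<Rightarrow> bool" where
  "transports \<sigma> \<tau> \<delta> \<longleftrightarrow> lifts \<delta> (\<sigma> (\<delta> 0)) (\<tau> (\<delta> 1))"

lemma transport_exists: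
  assumes T: "convex T" "T \<subseteq> nonresonant" and \<sigma>: "is_section T \<sigma>"
    and \<delta>: "path \<delta>" "path_image \<delta> \<subseteq> nonresonant" "\<delta> 0 \<in> T" "\<delta> 1 = \<delta> 0"
  obtains \<tau> where "is_section T \<tau>" "transports \<sigma> \<tau> \<delta>"
proof -
  have "\<sigma> (\<delta> 0) \<in> X0" "residues b (\<sigma> (\<delta> 0)) = \<delta> 0"
    using \<sigma> \<delta>(3) by (auto simp: is_section_def)
  moreover have "continuous_on {0..1} \<delta>" "\<delta> ` {0..1} \<subseteq> nonresonant"
    using \<delta>(1,2) by (simp_all add: path_def path_image_def)
  ultimately have "\<exists>h. continuous_on {0..1} h \<and> h ` {0..1} \<subseteq> X0 \<and> h 0 = \<sigma> (\<delta> 0) \<and>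
      (\<forall>t\<in>{0..1}. residues b (h t) = \<delta> t)"
    by (intro lift_exists) auto
  then obtain h where h: "continuous_on {0..1} h" "h ` {0..1} \<subseteq> X0" "h 0 = \<sigma> (\<delta> 0)"
      "\<forall>t\<in>{0..1}. residues b (h t) = \<delta> t"
    by (elim exE conjE)
  have "h 1 \<in> X0" "residues b (h 1) = \<delta> 0" using h(2,4) \<delta>(4) by auto
  then obtain \<tau> where \<tau>: "is_section T \<tau>" "\<tau> (\<delta> 0) = h 1"
    by (rule section_exists[OF T \<delta>(3)])
  have "transports \<sigma> \<tau> \<delta>"
    unfolding transports_def lifts_def path_def path_image_def
    using h \<tau>(2) \<delta>(4) by (intro exI[of _ h]) simp
  with \<tau>(1) show thesis by (rule that)
qed

text \<open>A lift of the whole square provides the lifts of all rows and columns at once, with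
  matching corners.\<close>

lemma lift_square:
  fixes G :: "real \<times> real \<Rightarrow> complex ^ 'p"
  assumes G: "continuous_on ({0..1} \<times> {0..1}) G" "G ` ({0..1} \<times> {0..1}) \<subseteq> nonresonant"
    and x: "x \<in> X0" "residues b x = G (0, 0)"
  shows "\<exists>g. g (0 :: real, 0 :: real) = x \<and>
    (\<forall>u\<in>{0..1}. lifts (\<lambda>t. G (u, t)) (g (u, 0)) (g (u, 1)) \<and> lifts (\<lambda>t. G (t, u)) (g (0, u)) (g (1, u)))"
proof -
  have "convex ({0..1::real} \<times> {0..1::real})" "(0, 0) \<in> {0..1::real} \<times> {0..1::real}"
    by (auto intro: convex_Times)
  from lift_exists[OF this G x] obtain g where
    g: "continuous_on ({0..1} \<times> {0..1}) g" "g ` ({0..1} \<times> {0..1}) \<subseteq> X0" "g (0, 0) = x"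
    "\<forall>z\<in>{0..1} \<times> {0..1}. residues b (g z) = G z"
    by (elim exE conjE)
  have "lifts (\<lambda>t. G (u, t)) (g (u, 0)) (g (u, 1))" if "u \<in> {0..1}" for u
    unfolding lifts_def path_def path_image_def
  proof (intro exI[of _ "\<lambda>t. g (u, t)"] conjI)
    show "continuous_on {0..1} (\<lambda>t. g (u, t))"
      using that by (intro continuous_on_compose2[OF g(1)] continuous_intros) auto
  qed (use g that in auto)
  moreover have "lifts (\<lambda>t. G (t, u)) (g (0, u)) (g (1, u))" if "u \<in> {0..1}" for u
    unfolding lifts_def path_def path_image_def
  proof (intro exI[of _ "\<lambda>t. g (t, u)"] conjI)
    show "continuous_on {0..1} (\<lambda>t. g (t, u))"
      using that by (intro continuous_on_compose2[OF g(1)] continuous_intros) auto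
  qed (use g that in auto)
  ultimately show ?thesis using g(3) by (intro exI[of _ g]) simp
qed

text \<open>The homotopy is free: its base point wanders inside T. By uniqueness the tracks of the
  two ends lift through the sections \<sigma> and \<tau>.\<close>

lemma transports_homotopy:
  fixes G :: "real \<times> real \<Rightarrow> complex ^ 'p"
  assumes G: "continuous_on ({0..1} \<times> {0..1}) G" "G ` ({0..1} \<times> {0..1}) \<subseteq> nonresonant"
    and T: "\<And>u. u \<in> {0..1} \<Longrightarrow> G (u, 0) \<in> T" "\<And>u. u \<in> {0..1} \<Longrightarrow> G (u, 1) = G (u, 0)"
    and \<sigma>: "is_section T \<sigma>" "is_section T \<tau>" and tr: "transports \<sigma> \<tau> (\<lambda>t. G (0, t))"
  shows "transports \<sigma> \<tau> (\<lambda>t. G (1, t))"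
proof -
  have "\<sigma> (G (0, 0)) \<in> X0" "residues b (\<sigma> (G (0, 0))) = G (0, 0)"
    using \<sigma>(1) T(1)[of 0] by (auto simp: is_section_def)
  from lift_square[OF G this] obtain g where
    g': "g (0, 0) = \<sigma> (G (0, 0)) \<and>
      (\<forall>u\<in>{0..1}. lifts (\<lambda>t. G (u, t)) (g (u, 0)) (g (u, 1)) \<and> lifts (\<lambda>t. G (t, u)) (g (0, u)) (g (1, u)))"
    by (elim exE)
  then have g: "\<And>u. u \<in> {0..1} \<Longrightarrow> lifts (\<lambda>t. G (u, t)) (g (u, 0)) (g (u, 1))"
    "\<And>t. t \<in> {0..1} \<Longrightarrow> lifts (\<lambda>u. G (u, t)) (g (0, t)) (g (1, t))" "g (0, 0) = \<sigma> (G (0, 0))"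
    by simp_all
  have "lifts (\<lambda>t. G (0, t)) (\<sigma> (G (0, 0))) (\<tau> (G (0, 0)))"
    using tr T(2)[of 0] by (simp add: transports_def)
  then have g01: "g (0, 1) = \<tau> (G (0, 0))" using lifts_unique g(1)[of 0] g(3) by fastforce
  have sec: "lifts (\<lambda>u. G (u, 0)) (\<rho> (G (0, 0))) (\<rho> (G (1, 0)))" if "is_section T \<rho>" for \<rho>
    unfolding lifts_def
  proof (intro exI[of _ "\<lambda>u. \<rho> (G (u, 0))"] conjI ballI)
    have "continuous_on {0..1} (\<lambda>u. G (u, 0))"
      by (auto intro!: continuous_on_compose2[OF G(1)] continuous_intros)
    then show "path (\<lambda>u. \<rho> (G (u, 0)))"
      unfolding path_def using that T(1) by (auto intro: continuous_on_compose2 simp: is_section_def)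
  qed (use that T(1) in \<open>auto simp: is_section_def path_image_def\<close>)
  have "g (1, 0) = \<sigma> (G (1, 0))"
    using lifts_unique[OF _ sec[OF \<sigma>(1)]] g(2)[of 0] g(3) by simp
  moreover have "lifts (\<lambda>u. G (u, 1)) (g (0, 1)) (\<tau> (G (1, 0)))"
    using sec[OF \<sigma>(2)] T(2) g01 by (simp add: lifts_def)
  then have "g (1, 1) = \<tau> (G (1, 0))"
    using lifts_unique g(2)[of 1] by fastforce
  ultimately show ?thesis
    using g(1)[of 1] T(2)[of 1] by (simp add: transports_def)
qed

text \<open>Cut open, the torus \<Theta> is a square whose four corners lie over one point. Going
  round its boundary in the two ways leads to the same corner of the lift.\<close>

lemma transports_commute:
  fixes \<Theta> :: "real \<times> real \<Rightarrow> complex ^ 'p"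
  assumes \<Theta>: "continuous_on ({0..1} \<times> {0..1}) \<Theta>" "\<Theta> ` ({0..1} \<times> {0..1}) \<subseteq> nonresonant"
    and per: "\<And>t. \<Theta> (1, t) = \<Theta> (0, t)" "\<And>s. \<Theta> (s, 1) = \<Theta> (s, 0)"
    and T: "\<Theta> (0, 0) \<in> T" "is_section T \<sigma>"
    and tr: "transports \<sigma> \<tau> (\<lambda>s. \<Theta> (s, 0))" "transports \<sigma> \<sigma>' (\<lambda>t. \<Theta> (0, t))" "transports \<tau> \<tau>' (\<lambda>t. \<Theta> (0, t))"
  shows "transports \<sigma>' \<tau>' (\<lambda>s. \<Theta> (s, 0))"
proof -
  have "\<sigma> (\<Theta> (0, 0)) \<in> X0" "residues b (\<sigma> (\<Theta> (0, 0))) = \<Theta> (0, 0)"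
    using T by (auto simp: is_section_def)
  from lift_square[OF \<Theta> this] obtain g where
    g': "g (0, 0) = \<sigma> (\<Theta> (0, 0)) \<and>
      (\<forall>u\<in>{0..1}. lifts (\<lambda>t. \<Theta> (u, t)) (g (u, 0)) (g (u, 1)) \<and> lifts (\<lambda>t. \<Theta> (t, u)) (g (0, u)) (g (1, u)))"
    by (elim exE)
  then have g: "\<And>u. u \<in> {0..1} \<Longrightarrow> lifts (\<lambda>t. \<Theta> (u, t)) (g (u, 0)) (g (u, 1))"
    "\<And>t. t \<in> {0..1} \<Longrightarrow> lifts (\<lambda>u. \<Theta> (u, t)) (g (0, t)) (g (1, t))" "g (0, 0) = \<sigma> (\<Theta> (0, 0))"
    by simp_all
  let ?P = "\<Theta> (0, 0)"
  have P: "\<Theta> (1, 0) = ?P" "\<Theta> (0, 1) = ?P" "\<Theta> (1, 1) = ?P" using per by simp_all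
  have g10: "g (1, 0) = \<tau> ?P"
  proof (rule lifts_unique)
    show "lifts (\<lambda>s. \<Theta> (s, 0)) (\<sigma> ?P) (g (1, 0))" using g(2)[of 0] g(3) by simp
    show "lifts (\<lambda>s. \<Theta> (s, 0)) (\<sigma> ?P) (\<tau> ?P)" using tr(1) P by (simp only: transports_def)
  qed
  have g01: "g (0, 1) = \<sigma>' ?P"
  proof (rule lifts_unique)
    show "lifts (\<lambda>t. \<Theta> (0, t)) (\<sigma> ?P) (g (0, 1))" using g(1)[of 0] g(3) by simp
    show "lifts (\<lambda>t. \<Theta> (0, t)) (\<sigma> ?P) (\<sigma>' ?P)" using tr(2) P by (simp only: transports_def)
  qed
  have g11: "g (1, 1) = \<tau>' ?P"
  proof (rule lifts_unique)
    show "lifts (\<lambda>t. \<Theta> (0, t)) (\<tau> ?P) (g (1, 1))" using g(1)[of 1] g10 per(1) by simp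
    show "lifts (\<lambda>t. \<Theta> (0, t)) (\<tau> ?P) (\<tau>' ?P)" using tr(3) P by (simp only: transports_def)
  qed
  have "lifts (\<lambda>s. \<Theta> (s, 0)) (g (0, 1)) (g (1, 1))" using g(2)[of 1] per(2) by simp
  then show ?thesis by (simp only: transports_def g01 g11 P)
qed

lemma joinpaths_pointwise:
  assumes "\<And>s. s \<in> {0..1} \<Longrightarrow> f (p s) = p' s" "\<And>s. s \<in> {0..1} \<Longrightarrow> f (q s) = q' s" "t \<in> {0..1}"
  shows "f ((p +++ q) t) = (p' +++ q') t"
  using assms(1)[of "2 * t"] assms(2)[of "2 * t - 1"] assms(3) by (auto simp: joinpaths_def)

text \<open>The tail \<alpha> stays in T, so it is lifted by \<sigma> on the way out and by \<tau>
  on the way back.\<close>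

lemma lifts_loop:
  assumes \<sigma>: "is_section T \<sigma>" "is_section T \<tau>" and tr: "transports \<sigma> \<tau> \<delta>"
    and \<alpha>: "path \<alpha>" "path_image \<alpha> \<subseteq> T" "pathfinish \<alpha> = \<delta> 0" "\<delta> 1 = \<delta> 0"
  shows "lifts (\<alpha> +++ \<delta> +++ reversepath \<alpha>) (\<sigma> (pathstart \<alpha>)) (\<tau> (pathstart \<alpha>))"
proof -
  have "lifts \<delta> (\<sigma> (\<delta> 0)) (\<tau> (\<delta> 0))" using tr \<alpha>(4) by (simp only: transports_def)
  then obtain h where h: "path h" "path_image h \<subseteq> X0" "\<forall>t\<in>{0..1}. residues b (h t) = \<delta> t"
      "h 0 = \<sigma> (\<delta> 0)" "h 1 = \<tau> (\<delta> 0)"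
    unfolding lifts_def by (elim exE conjE)
  let ?h = "(\<sigma> \<circ> \<alpha>) +++ h +++ reversepath (\<tau> \<circ> \<alpha>)"
  have img: "\<alpha> t \<in> T" if "t \<in> {0..1}" for t using \<alpha>(2) that by (auto simp: path_image_def)
  have sec: "continuous_on (path_image \<alpha>) \<sigma>" "continuous_on (path_image \<alpha>) \<tau>"
    using \<sigma> \<alpha>(2) unfolding is_section_def by (blast intro: continuous_on_subset)+
  have p: "path (\<sigma> \<circ> \<alpha>)" "path (\<tau> \<circ> \<alpha>)"
    by (rule path_continuous_image[OF \<alpha>(1) sec(1)], rule path_continuous_image[OF \<alpha>(1) sec(2)])
  have "pathfinish (\<sigma> \<circ> \<alpha>) = pathstart h" "pathfinish h = pathstart (reversepath (\<tau> \<circ> \<alpha>))"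
    using h(4,5) \<alpha>(3) by (simp_all add: pathstart_compose pathfinish_compose) (simp_all add: pathstart_def pathfinish_def)
  then have "path ?h" using p h(1) by simp
  moreover have "path_image ?h \<subseteq> X0"
  proof -
    have "path_image (\<sigma> \<circ> \<alpha>) \<subseteq> X0" "path_image (\<tau> \<circ> \<alpha>) \<subseteq> X0"
      using \<sigma> img by (auto simp: path_image_def is_section_def)
    with h(2) show ?thesis by (intro subset_path_image_join) (auto simp: path_image_reversepath)
  qed
  moreover have "residues b (?h t) = (\<alpha> +++ \<delta> +++ reversepath \<alpha>) t" if t: "t \<in> {0..1}" for t
  proof -
    have r: "residues b (\<sigma> (\<alpha> s)) = \<alpha> s" "residues b (\<tau> (\<alpha> s)) = \<alpha> s" if "s \<in> {0..1}" for s
      using \<sigma> img[OF that] by (auto simp: is_section_def)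
    have r': "residues b ((h +++ reversepath (\<tau> \<circ> \<alpha>)) s) = (\<delta> +++ reversepath \<alpha>) s" if "s \<in> {0..1}" for s
      by (rule joinpaths_pointwise[of "residues b" h]) (use that h(3) r in \<open>simp_all add: reversepath_def\<close>)
    show ?thesis
      by (rule joinpaths_pointwise[of "residues b" "\<sigma> \<circ> \<alpha>"]) (use r r' t in simp_all)
  qed
  moreover have "?h 0 = \<sigma> (pathstart \<alpha>)" "?h 1 = \<tau> (pathstart \<alpha>)"
    using pathstart_join[of "\<sigma> \<circ> \<alpha>" "h +++ reversepath (\<tau> \<circ> \<alpha>)"]
      pathfinish_join[of "\<sigma> \<circ> \<alpha>" "h +++ reversepath (\<tau> \<circ> \<alpha>)"] pathfinish_join[of h "reversepath (\<tau> \<circ> \<alpha>)"]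
    by (simp_all only: pathstart_def pathfinish_def reversepath_def o_def) simp
  ultimately show ?thesis
    unfolding lifts_def by blast
qed

end

section \<open>Loops around walls of a chamber\<close>

lemma scaleR_eq_smult: "r *\<^sub>R x = complex_of_real r *s (x :: complex ^ 'p::finite)"
  unfolding vec_eq_iff vector_scaleR_component scaleR_conv_of_real[where 'a = complex] by simp

section \<open>Chambers, tubes and discs transverse to walls\<close>

text \<open>For l0 in a chamber, these are the vectors whose real part lies in that chamber, with
  any imaginary part of sum 0. Describing the chamber by signs makes convexity evident.\<close>

definition tube :: "complex ^ 'p::finite \<Rightarrow> (complex ^ 'p) set" where
  "tube l0 = {l. coord_sum UNIV l = 0 \<and> (\<forall>K. proper_subset K \<longrightarrow> 0 < Re (coord_sum K l) * Re (coord_sum K l0))}"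

lemma convex_tube: "convex (tube l0)"
proof -
  have conv: "convex {l. 0 < Re (coord_sum K l) * c}" for K :: "'a set" and c
  proof (rule convexI)
    fix x y :: "complex ^ 'a" and u v :: real
    assume h: "x \<in> {l. 0 < Re (coord_sum K l) * c}" "y \<in> {l. 0 < Re (coord_sum K l) * c}" "0 \<le> u" "0 \<le> v" "u + v = 1"
    have "0 < u * (Re (coord_sum K x) * c) + v * (Re (coord_sum K y) * c)"
    proof (cases "u = 0")
      case False
      then have "0 < u * (Re (coord_sum K x) * c)" "0 \<le> v * (Re (coord_sum K y) * c)" using h by auto
      then show ?thesis by linarith
    qed (use h in simp)
    then show "u *\<^sub>R x + v *\<^sub>R y \<in> {l. 0 < Re (coord_sum K l) * c}" by (simp add: algebra_simps)
  qed
  have "tube l0 = {l. coord_sum UNIV l = 0} \<inter> (\<Inter>K\<in>{K. proper_subset K}. {l. 0 < Re (coord_sum K l) * Re (coord_sum K l0)})"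
    by (auto simp: tube_def)
  moreover have "convex {l :: complex ^ 'a. coord_sum UNIV l = 0}" by (rule convexI) simp
  ultimately show ?thesis using conv by (auto intro!: convex_Int convex_INT)
qed

lemma tube_nonresonant: "tube l0 \<subseteq> nonresonant"
  by (force simp: tube_def nonresonant_def)

definition real_vec :: "complex ^ 'p::finite \<Rightarrow> bool" where
  "real_vec l \<longleftrightarrow> (\<forall>j. l $ j \<in> \<real>)"

lemma coord_sum_real: "real_vec l \<Longrightarrow> coord_sum K l \<in> \<real>"
  unfolding coord_sum_def real_vec_def by (intro sum_in_Reals) auto

lemma coord_sum_real': "real_vec l \<Longrightarrow> coord_sum K l = of_real (Re (coord_sum K l))"
  using coord_sum_real[of l K] by simp

text \<open>No proper sum vanishes on the connected set C, so each keeps its sign there.\<close>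

lemma chamber_tube:
  assumes C: "C \<in> real_chambers" and l0: "l0 \<in> C"
  shows "C \<subseteq> tube l0" "\<And>l. l \<in> C \<Longrightarrow> real_vec l"
proof -
  have sub: "C \<subseteq> residual_space \<inter> real_points - resonance_arrangement" and con: "connected C"
    using C in_components_subset in_components_connected by (auto simp: real_chambers_def)
  then have sub': "C \<subseteq> nonresonant" by (auto simp: nonresonant_eq)
  show real: "real_vec l" if "l \<in> C" for l using sub that by (auto simp: real_points_def real_vec_def)
  show "C \<subseteq> tube l0"
  proof
    fix l assume l: "l \<in> C"
    have "0 < Re (coord_sum K l) * Re (coord_sum K l0)" if K: "proper_subset K" for K
    proof (rule ccontr)
      have ne: "Re (coord_sum K m) \<noteq> 0" if "m \<in> C" for m
        using sub' that K coord_sum_real'[OF real[OF that], of K] by (auto simp: nonresonant_def)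
      assume "\<not> 0 < Re (coord_sum K l) * Re (coord_sum K l0)"
      then have neg: "Re (coord_sum K l) * Re (coord_sum K l0) < 0" using ne[OF l] ne[OF l0] by (simp add: not_less order_less_le)
      have "connected ((\<lambda>m. Re (coord_sum K m)) ` C)"
        by (intro connected_continuous_image con continuous_intros)
      then have Z: "0 \<in> (\<lambda>m. Re (coord_sum K m)) ` C" if "Re (coord_sum K m) \<le> 0" "0 \<le> Re (coord_sum K m')" "m \<in> C" "m' \<in> C" for m m'
        using that by (meson connectedD_interval imageI)
      then have "0 \<in> (\<lambda>m. Re (coord_sum K m)) ` C"
        using neg l l0 Z[of l l0] Z[of l0 l]
        unfolding mult_less_0_iff by linarith
      with ne show False by auto
    qed
    with l sub' show "l \<in> tube l0" by (auto simp: tube_def nonresonant_def)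
  qed
qed

lemma coord_sum_Im: "real_vec l \<Longrightarrow> Im (coord_sum K l) = 0"
  using coord_sum_real[of l K] by (simp add: complex_is_Real_iff)

lemma real_vec_simps [simp]:
  "real_vec (axis i 1)" "real_vec x \<Longrightarrow> real_vec y \<Longrightarrow> real_vec (x + y)"
  "real_vec x \<Longrightarrow> real_vec y \<Longrightarrow> real_vec (x - y)"
  by (auto simp: real_vec_def axis_def)

definition same_hyperplane :: "'p::finite set \<Rightarrow> 'p set \<Rightarrow> bool" where
  "same_hyperplane K I \<longleftrightarrow> resonance_hyperplane K = resonance_hyperplane I"

lemma same_hyperplaneD:
  "same_hyperplane K I \<Longrightarrow> coord_sum UNIV l = 0 \<Longrightarrow> coord_sum K l = 0 \<longleftrightarrow> coord_sum I l = 0"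
  by (auto simp: same_hyperplane_def resonance_hyperplane_def residual_space_def coord_sum_def set_eq_iff)

text \<open>What the deformation needs of a transverse disc: for hyperplanes other than that of I,
  the real part of the sum keeps on the whole disc the sign it has in the chamber.\<close>

definition wall_disc :: "complex ^ 'p::finite \<Rightarrow> 'p set \<Rightarrow> complex ^ 'p \<Rightarrow> complex ^ 'p \<Rightarrow> bool" where
  "wall_disc l0 I n v \<longleftrightarrow> real_vec n \<and> real_vec v \<and> coord_sum UNIV n = 0 \<and> coord_sum UNIV v = 0 \<and> coord_sum I n = 0 \<and>
     n + v \<in> tube l0 \<and>
     (\<forall>K z. proper_subset K \<longrightarrow> \<not> same_hyperplane K I \<longrightarrow> norm z \<le> 1 \<longrightarrow>
        0 < Re (coord_sum K (n + z *s v)) * Re (coord_sum K l0))"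

lemma affine_sign:
  fixes A B s :: real
  assumes "\<And>r. -1 \<le> r \<Longrightarrow> r \<le> 1 \<Longrightarrow> A + r * B \<noteq> 0" "0 < (A + B) * s" "-1 \<le> r" "r \<le> 1"
  shows "0 < (A + r * B) * s"
proof (rule ccontr)
  assume neg: "\<not> ?thesis"
  have s: "s \<noteq> 0" using assms(2) by auto
  have "(A + r * B) * s < 0" using neg assms(1)[OF assms(3,4)] s by (simp add: not_less order_less_le)
  define f where "f = (\<lambda>r. (A + r * B) * s)"
  have "continuous_on {r..1} f" unfolding f_def by (intro continuous_intros)
  then have "\<exists>x\<ge>r. x \<le> 1 \<and> f x = 0"
    using IVT'[of f r 0 1] assms \<open>(A + r * B) * s < 0\<close> by (auto simp: f_def)
  then obtain x where "r \<le> x" "x \<le> 1" "(A + x * B) * s = 0" by (auto simp: f_def)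
  with assms(1)[of x] assms(3) s show False by auto
qed

text \<open>Since n and v are real, the real part of a sum at n + z v depends on Re z only. On the
  real diameter the sums of the other hyperplanes do not vanish, so they keep the sign they have at
  n + v, a point of the chamber.\<close>

lemma resonance_loop_wall_disc:
  assumes C: "C \<in> real_chambers" "l0 \<in> C" and I: "proper_subset I" and loop: "resonance_loop C I l0 \<gamma>"
  shows "\<exists>n v \<alpha>. wall_disc l0 I n v \<and> path \<alpha> \<and> path_image \<alpha> \<subseteq> tube l0 \<and> pathstart \<alpha> = l0 \<and>
    pathfinish \<alpha> = n + v \<and> \<gamma> = \<alpha> +++ (\<lambda>t. n + turn t *s v) +++ reversepath \<alpha>"
proof -
  from loop obtain F n v \<alpha> where F: "wall_of C I F" "n \<in> rel_interior F"
    and v: "v \<in> residual_space" "(\<Sum>j\<in>I. v $ j) \<noteq> 0"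
    and K: "\<forall>K. K \<noteq> {} \<and> K \<noteq> UNIV \<and> resonance_hyperplane K \<noteq> resonance_hyperplane I \<longrightarrow>
           (\<forall>z. cmod z \<le> 1 \<longrightarrow> n + z *s v \<notin> resonance_hyperplane K)"
    and \<alpha>: "path \<alpha>" "path_image \<alpha> \<subseteq> C" "pathstart \<alpha> = l0" "pathfinish \<alpha> = n + v"
      "\<gamma> = \<alpha> +++ (\<lambda>t. n + exp (2 * of_real pi * \<i> * of_real t) *s v) +++ reversepath \<alpha>"
    unfolding resonance_loop_def by (elim exE conjE)
  note tube = chamber_tube[OF C]
  have "n \<in> F" using F(2) rel_interior_subset by auto
  then have n: "n \<in> resonance_hyperplane I" "real_vec n"
    using F(1) by (auto simp: wall_of_def real_points_def real_vec_def)
  have nv: "n + v \<in> C" using \<alpha>(2,4) pathfinish_in_path_image[of \<alpha>] by auto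
  then have rv: "real_vec v" using tube(2)[OF nv] n(2) by (auto simp: real_vec_def) (metis Reals_diff add_diff_cancel_left')
  have nU: "coord_sum UNIV n = 0" "coord_sum UNIV v = 0" "coord_sum I n = 0"
    using n v by (auto simp: resonance_hyperplane_def residual_space_def coord_sum_def)
  have "0 < Re (coord_sum K (n + z *s v)) * Re (coord_sum K l0)"
    if h: "proper_subset K" "\<not> same_hyperplane K I" "norm z \<le> 1" for K z
  proof -
    have ne: "Re (coord_sum K n) + r * Re (coord_sum K v) \<noteq> 0" if "-1 \<le> r" "r \<le> 1" for r
    proof -
      have "n + of_real r *s v \<notin> resonance_hyperplane K"
        using K h that by (simp add: proper_subset_def same_hyperplane_def)
      moreover have "n + of_real r *s v \<in> residual_space"
        using nU by (simp add: residual_space_def flip: coord_sum_def)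
      ultimately have "coord_sum K (n + of_real r *s v) \<noteq> 0"
        by (simp add: resonance_hyperplane_def coord_sum_def)
      then have "of_real (Re (coord_sum K n)) + of_real r * of_real (Re (coord_sum K v)) \<noteq> (0 :: complex)"
        using coord_sum_real'[OF n(2), of K] coord_sum_real'[OF rv, of K] by simp
      then show ?thesis by (metis of_real_0 of_real_add of_real_mult)
    qed
    have "n + v \<in> tube l0" using nv tube by auto
    then have "0 < (Re (coord_sum K n) + Re (coord_sum K v)) * Re (coord_sum K l0)" using h by (auto simp: tube_def)
    moreover have "-1 \<le> Re z" "Re z \<le> 1" using abs_Re_le_cmod[of z] h(3) by auto
    ultimately have "0 < (Re (coord_sum K n) + Re z * Re (coord_sum K v)) * Re (coord_sum K l0)"
      using affine_sign[OF ne] by blast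
    moreover have "Re (coord_sum K (n + z *s v)) = Re (coord_sum K n) + Re z * Re (coord_sum K v)"
      using coord_sum_Im[OF rv, of K] by simp
    ultimately show ?thesis by (simp only:)
  qed
  then have "wall_disc l0 I n v"
    using n rv nU nv tube by (auto simp: wall_disc_def)
  moreover have "path_image \<alpha> \<subseteq> tube l0" using \<alpha>(2) tube(1) by blast
  ultimately show ?thesis
    using \<alpha>(1,3,4,5)[folded turn_def] by (intro exI conjI)
qed

section \<open>Hyperplanes through the intersection of two secant ones\<close>

text \<open>Differences of unit vectors within one cell show that K is a union of the four cells cut
  out by I and J. With one point in each cell, the vector with alternating signs gives ind a + ind e
  = ind c + ind d. For a proper K this leaves one of a, e together with one of c, d, that is I, J or
  one of their complements.\<close>

lemma secant_hyperplanes: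
  fixes I J K :: "'p::finite set"
  assumes sec: "secant I J" and K: "proper_subset K"
    and van: "\<And>l. real_vec l \<Longrightarrow> coord_sum UNIV l = 0 \<Longrightarrow> coord_sum I l = 0 \<Longrightarrow> coord_sum J l = 0 \<Longrightarrow> coord_sum K l = 0"
  shows "K = I \<or> K = - I \<or> K = J \<or> K = - J"
proof -
  define ind :: "'p set \<Rightarrow> 'p \<Rightarrow> complex" where "ind = (\<lambda>S i. if i \<in> S then 1 else 0)"
  have parta: "coord_sum S (axis i 1) = ind S i" for S i
    by (simp add: coord_sum_def axis_def ind_def)
  have same: "ind K i = ind K j" if "i \<in> I \<longleftrightarrow> j \<in> I" "i \<in> J \<longleftrightarrow> j \<in> J" for i j
  proof -
    have "coord_sum K (axis i 1 - axis j 1) = 0"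
      by (rule van) (use that in \<open>auto simp: parta ind_def\<close>)
    then show ?thesis by (simp add: parta)
  qed
  obtain a where a: "a \<in> I" "a \<in> J" using sec by (auto simp: secant_def)
  obtain c where c: "c \<in> I" "c \<notin> J" using sec by (auto simp: secant_def)
  obtain d where d: "d \<notin> I" "d \<in> J" using sec by (auto simp: secant_def)
  obtain e where e: "e \<notin> I" "e \<notin> J" using sec by (auto simp: secant_def)
  have "coord_sum K (axis a 1 - axis c 1 - axis d 1 + axis e 1) = 0"
    by (rule van) (use a c d e in \<open>auto simp: parta ind_def\<close>)
  then have eq: "ind K a + ind K e = ind K c + ind K d" by (simp add: parta algebra_simps)
  have cell: "i \<in> K \<longleftrightarrow> (if i \<in> I then (if i \<in> J then a \<in> K else c \<in> K) else (if i \<in> J then d \<in> K else e \<in> K))" for i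
    using same[of i a] same[of i c] same[of i d] same[of i e] a c d e by (auto simp: ind_def split: if_splits)
  have some: "a \<in> K \<or> c \<in> K \<or> d \<in> K \<or> e \<in> K"
  proof -
    obtain i where "i \<in> K" using K by (auto simp: proper_subset_def)
    with cell[of i] show ?thesis by (metis (full_types))
  qed
  have notall: "\<not> (a \<in> K \<and> c \<in> K \<and> d \<in> K \<and> e \<in> K)"
  proof -
    obtain i where "i \<notin> K" using K by (auto simp: proper_subset_def)
    with cell[of i] show ?thesis by (metis (full_types))
  qed
  consider "a \<in> K" "c \<in> K" "d \<notin> K" "e \<notin> K" | "a \<in> K" "c \<notin> K" "d \<in> K" "e \<notin> K"
    | "a \<notin> K" "c \<in> K" "d \<notin> K" "e \<in> K" | "a \<notin> K" "c \<notin> K" "d \<in> K" "e \<in> K"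
    using eq some notall
    by (cases "a \<in> K"; cases "c \<in> K"; cases "d \<in> K"; cases "e \<in> K") (simp_all add: ind_def)
  then show ?thesis
  proof cases
    case 1
    then have "i \<in> K \<longleftrightarrow> i \<in> I" for i using cell[of i] by (cases "i \<in> I"; cases "i \<in> J") simp_all
    then show ?thesis by blast
  next
    case 2
    then have "i \<in> K \<longleftrightarrow> i \<in> J" for i using cell[of i] by (cases "i \<in> I"; cases "i \<in> J") simp_all
    then show ?thesis by blast
  next
    case 3
    then have "i \<in> K \<longleftrightarrow> i \<in> - J" for i using cell[of i] by (cases "i \<in> I"; cases "i \<in> J") simp_all
    then show ?thesis by blast
  next
    case 4
    then have "i \<in> K \<longleftrightarrow> i \<in> - I" for i using cell[of i] by (cases "i \<in> I"; cases "i \<in> J") simp_all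
    then show ?thesis by blast
  qed
qed

text \<open>A real vector space is no finite union of proper subspaces: on the line from a vector
  good for \<K> in a direction good for K, only finitely many real parameters are bad.\<close>

lemma generic_vector:
  fixes S :: "(complex ^ 'p::finite) set"
  assumes add: "\<And>x y (r :: real). x \<in> S \<Longrightarrow> y \<in> S \<Longrightarrow> x + of_real r *s y \<in> S" and zero: "0 \<in> S"
    and fin: "finite \<K>" and wit: "\<And>K. K \<in> \<K> \<Longrightarrow> \<exists>x\<in>S. coord_sum K x \<noteq> 0"
  shows "\<exists>x\<in>S. \<forall>K\<in>\<K>. coord_sum K x \<noteq> 0"
  using fin wit
proof (induction \<K>)
  case empty
  then show ?case using zero by auto
next
  case (insert K \<K>)
  obtain x where x: "x \<in> S" "\<forall>K\<in>\<K>. coord_sum K x \<noteq> 0" using insert by auto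
  obtain y where y: "y \<in> S" "coord_sum K y \<noteq> 0" using insert by auto
  define bad where "bad = (\<lambda>L. {r :: real. coord_sum L (x + of_real r *s y) = 0})"
  have fb: "finite (bad L)" if "coord_sum L x \<noteq> 0 \<or> coord_sum L y \<noteq> 0" for L
  proof (cases "coord_sum L y = 0")
    case False
    have "bad L \<subseteq> {Re (- coord_sum L x / coord_sum L y)}"
    proof
      fix r assume "r \<in> bad L"
      then have "of_real r = - coord_sum L x / coord_sum L y"
        using False by (simp add: bad_def field_simps eq_neg_iff_add_eq_0 add.commute)
      then show "r \<in> {Re (- coord_sum L x / coord_sum L y)}" by (metis Re_complex_of_real singletonI)
    qed
    then show ?thesis by (rule finite_subset) simp
  qed (use that in \<open>auto simp: bad_def\<close>)
  have "finite (\<Union>L\<in>insert K \<K>. bad L)" using insert x y by (intro finite_UN_I fb) auto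
  then obtain r where "r \<notin> (\<Union>L\<in>insert K \<K>. bad L)" using ex_new_if_finite infinite_UNIV_char_0 by blast
  then show ?case using add[OF x(1) y(1)] by (intro bexI[of _ "x + of_real r *s y"]) (auto simp: bad_def)
qed

lemma secant_generic_vector:
  fixes I J :: "'p::finite set"
  assumes sec: "secant I J"
  shows "\<exists>\<eta>. real_vec \<eta> \<and> coord_sum UNIV \<eta> = 0 \<and> coord_sum I \<eta> = 0 \<and> coord_sum J \<eta> = 0 \<and>
    (\<forall>K. proper_subset K \<longrightarrow> \<not> same_hyperplane K I \<longrightarrow> \<not> same_hyperplane K J \<longrightarrow> coord_sum K \<eta> \<noteq> 0)"
proof -
  define S :: "(complex ^ 'p) set" where "S = {l. real_vec l \<and> coord_sum UNIV l = 0 \<and> coord_sum I l = 0 \<and> coord_sum J l = 0}"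
  define \<K> where "\<K> = {K. proper_subset K \<and> \<not> same_hyperplane K I \<and> \<not> same_hyperplane K J}"
  have neg: "same_hyperplane (- L) L" for L :: "'p set"
  proof -
    have "coord_sum L l + coord_sum (- L) l = coord_sum UNIV l" for l
      unfolding coord_sum_def by (subst sum.union_disjoint[symmetric]) (auto simp: Compl_partition)
    then show ?thesis
      unfolding same_hyperplane_def resonance_hyperplane_def residual_space_def
      by (auto simp flip: coord_sum_def) (metis add_cancel_right_left add.right_neutral)+
  qed
  have "\<exists>x\<in>S. coord_sum K x \<noteq> 0" if "K \<in> \<K>" for K
  proof (rule ccontr)
    assume "\<not> ?thesis"
    then have "K = I \<or> K = - I \<or> K = J \<or> K = - J"
      using that by (intro secant_hyperplanes[OF sec]) (auto simp: S_def \<K>_def)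
    with that neg show False by (auto simp: \<K>_def same_hyperplane_def)
  qed
  then have "\<exists>x\<in>S. \<forall>K\<in>\<K>. coord_sum K x \<noteq> 0"
    by (intro generic_vector) (auto simp: S_def real_vec_def)
  then show ?thesis unfolding S_def \<K>_def by blast
qed

text \<open>Secancy provides an index in I but not in J and an index in neither; the difference of
  their unit vectors is seen by I and not by J.\<close>

lemma dual_vector:
  fixes I J :: "'p::finite set"
  assumes sec: "secant I J"
  shows "\<exists>e. real_vec e \<and> coord_sum UNIV e = 0 \<and> coord_sum I e = 1 \<and> coord_sum J e = 0"
proof -
  obtain c where c: "c \<in> I" "c \<notin> J" using sec by (auto simp: secant_def)
  obtain d where d: "d \<notin> I" "d \<notin> J" using sec by (auto simp: secant_def)
  show ?thesis
    by (rule exI[of _ "axis c 1 - axis d 1"]) (use c d in \<open>auto simp: coord_sum_def axis_def real_vec_def sum_subtractf\<close>)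
qed

lemma secant_not_same_hyperplane:
  assumes "secant I J" shows "\<not> same_hyperplane I J"
proof
  assume same: "same_hyperplane I J"
  obtain e where "coord_sum UNIV e = 0" "coord_sum I e = 1" "coord_sum J e = 0" using dual_vector[OF assms] by blast
  with same_hyperplaneD[OF same, of e] show False by simp
qed

lemma large_multiple:
  fixes c M :: "'k \<Rightarrow> real"
  assumes "finite A" "\<And>k. k \<in> A \<Longrightarrow> c k > 0"
  shows "\<exists>S>0. \<forall>k\<in>A. M k < S * c k"
proof -
  define S where "S = 1 + (\<Sum>k\<in>A. \<bar>M k\<bar> / c k)"
  have nn: "0 \<le> \<bar>M k\<bar> / c k" if "k \<in> A" for k using assms(2)[OF that] by simp
  have "S > 0" using sum_nonneg[of A "\<lambda>k. \<bar>M k\<bar> / c k"] nn by (simp add: S_def add_pos_nonneg)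
  moreover have "M k < S * c k" if k: "k \<in> A" for k
  proof -
    have "\<bar>M k\<bar> / c k \<le> (\<Sum>k\<in>A. \<bar>M k\<bar> / c k)"
      by (rule member_le_sum[OF k]) (use nn assms(1) in auto)
    then have "\<bar>M k\<bar> / c k < S" by (simp add: S_def)
    then have "\<bar>M k\<bar> < S * c k" using assms(2)[OF k] by (simp add: field_simps)
    then show ?thesis by simp
  qed
  ultimately show ?thesis by blast
qed

lemma wall_circle_path:
  assumes w: "wall_disc l0 I n v" and I: "proper_subset I"
  shows "path (\<lambda>t. n + turn t *s v)" "path_image (\<lambda>t. n + turn t *s v) \<subseteq> nonresonant"
proof -
    show "path (\<lambda>t. n + turn t *s v)" unfolding path_def by (intro continuous_intros)
    have wd: "coord_sum UNIV n = 0" "coord_sum UNIV v = 0" "coord_sum I n = 0" "n + v \<in> tube l0"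
      "\<And>K z. proper_subset K \<Longrightarrow> \<not> same_hyperplane K I \<Longrightarrow> norm z \<le> 1 \<Longrightarrow> 0 < Re (coord_sum K (n + z *s v)) * Re (coord_sum K l0)"
      using w by (auto simp: wall_disc_def)
    have vI: "coord_sum I v \<noteq> 0" using wd(3,4) I by (auto simp: tube_def)
    have "coord_sum K (n + turn t *s v) \<noteq> 0" if "proper_subset K" for K t
    proof (cases "same_hyperplane K I")
      case True
      have "coord_sum I (n + turn t *s v) \<noteq> 0" using wd(3) vI by simp
      moreover have "coord_sum UNIV (n + turn t *s v) = 0" using wd(1,2) by simp
      ultimately show ?thesis using same_hyperplaneD[OF True] by blast
    next
      case False
      have "0 < Re (coord_sum K (n + turn t *s v)) * Re (coord_sum K l0)"
        by (rule wd(5)[OF that False]) simp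
      then show ?thesis by (metis less_irrefl mult_zero_left zero_complex.sel(1))
    qed
    then show "path_image (\<lambda>t. n + turn t *s v) \<subseteq> nonresonant"
      using wd(1,2) by (auto simp: path_image_def nonresonant_def)
qed

section \<open>Deforming the loops onto a torus\<close>

context residue_covering
begin

text \<open>
  At height \<open>S\<close> in the imaginary direction \<open>\<eta>\<close> only the hyperplanes of \<open>I\<close> and \<open>J\<close> remain close, so
  the small circle can be deformed into a coordinate circle of a torus around their intersection.
\<close>

lemma transport_wall_disc:
  fixes I J :: "'p set"
  assumes w: "wall_disc l0 I n v" and l0: "l0 \<in> tube l0" "real_vec l0"
    and I: "proper_subset I" and J: "proper_subset J" and IJ: "\<not> same_hyperplane J I"
    and \<eta>: "real_vec \<eta>" "coord_sum UNIV \<eta> = 0" "coord_sum I \<eta> = 0" "coord_sum J \<eta> = 0"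
    and e: "coord_sum UNIV e = 0" "coord_sum I e = 1" "coord_sum J e = 0"
    and S: "S > 0" "\<And>K. proper_subset K \<Longrightarrow> \<not> same_hyperplane K I \<Longrightarrow> \<not> same_hyperplane K J \<Longrightarrow>
        norm (coord_sum K n) + norm (coord_sum K v) + norm (coord_sum K l0) + 2 * norm (coord_sum I l0 * coord_sum K e) < S * norm (coord_sum K \<eta>)"
    and \<sigma>: "is_section (tube l0) \<sigma>" "is_section (tube l0) \<tau>"
    and tr: "transports \<sigma> \<tau> (\<lambda>t. n + turn t *s v)"
  shows "transports \<sigma> \<tau> (\<lambda>t. l0 + (\<i> * of_real S) *s \<eta> + ((turn t - 1) * coord_sum I l0) *s e)"
proof -
  note wd = w[unfolded wall_disc_def]
  have n: "real_vec n" "real_vec v" "coord_sum UNIV n = 0" "coord_sum UNIV v = 0" "coord_sum I n = 0" "n + v \<in> tube l0"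
    using wd by auto
  have sgn: "0 < Re (coord_sum K (n + z *s v)) * Re (coord_sum K l0)"
    if "proper_subset K" "\<not> same_hyperplane K I" "norm z \<le> 1" for K z
    using wd that by auto
  have \<eta>i: "Re (\<i> * of_real s * coord_sum K \<eta>) = 0" for s K
    using coord_sum_Im[OF \<eta>(1), of K] by simp
  have lI: "Re (coord_sum I l0) \<noteq> 0" "Re (coord_sum J l0) \<noteq> 0" using l0(1) I J by (auto simp: tube_def)
  have sqJ: "0 < Re (coord_sum J l0) * Re (coord_sum J l0)" using lI(2) not_real_square_gt_zero by blast
  have vI: "0 < Re (coord_sum I v) * Re (coord_sum I l0)" using n I by (auto simp: tube_def)
  have tubei: "l + (\<i> * of_real s) *s \<eta> \<in> tube l0" if "l \<in> tube l0" for l s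
    using that \<eta>(2) coord_sum_Im[OF \<eta>(1)] by (simp add: tube_def)
  \<comment> \<open>Raises the circle to height S: the real parts of all sums stay, and the sum over
    I stays altogether.\<close>
  define G1 where "G1 = (\<lambda>(s, t). n + turn t *s v + (\<i> * of_real (s * S)) *s \<eta>)"
  have 1: "transports \<sigma> \<tau> (\<lambda>t. G1 (1, t))"
  proof (rule transports_homotopy[of G1 "tube l0", OF _ _ _ _ \<sigma>])
    show "continuous_on ({0..1} \<times> {0..1}) G1"
      unfolding G1_def case_prod_beta by (intro continuous_intros)
    show "G1 ` ({0..1} \<times> {0..1}) \<subseteq> nonresonant"
    proof (clarify)
      fix s t :: real
      have "coord_sum K (G1 (s, t)) \<noteq> 0" if K: "proper_subset K" for K
      proof (cases "same_hyperplane K I")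
        case True
        have "coord_sum I (G1 (s, t)) \<noteq> 0" using vI n \<eta> by (auto simp: G1_def)
        moreover have "coord_sum UNIV (G1 (s, t)) = 0" using n \<eta> by (simp add: G1_def)
        ultimately show ?thesis using same_hyperplaneD[OF True] by blast
      next
        case False
        have "Re (coord_sum K (G1 (s, t))) = Re (coord_sum K (n + turn t *s v))"
          using \<eta>i[of "s * S" K] by (simp add: G1_def)
        moreover have "0 < Re (coord_sum K (n + turn t *s v)) * Re (coord_sum K l0)"
          by (rule sgn[OF K False]) simp
        ultimately show ?thesis by (metis less_irrefl mult_zero_left zero_complex.sel(1))
      qed
      then show "G1 (s, t) \<in> nonresonant" using n \<eta> by (simp add: nonresonant_def G1_def)
    qed
    show "G1 (u, 0) \<in> tube l0" for u using tubei[OF n(6), of "u * S"] by (simp add: G1_def)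
  qed (use tr in \<open>simp_all add: G1_def\<close>)
  \<comment> \<open>The projection of l0 along e to the hyperplane of I, the centre of the new
    circle before it is raised.\<close>
  define w1 where "w1 = l0 - coord_sum I l0 *s e"
  \<comment> \<open>Straight-line homotopy at height S. The sum over I is turn t times a combination
    of two numbers whose real parts have the same sign; the sum over J keeps the sign of its real
    part; every other sum is dominated by S times the sum of \<eta>.\<close>
  define G2 where "G2 = (\<lambda>(u, t). of_real (1 - u) *s (n + turn t *s v) + of_real u *s (w1 + (turn t * coord_sum I l0) *s e)
      + (\<i> * of_real S) *s \<eta>)"
  have l0U: "coord_sum UNIV l0 = 0" using l0 by (simp add: tube_def)
  have "transports \<sigma> \<tau> (\<lambda>t. G2 (1, t))"
  proof (rule transports_homotopy[of G2 "tube l0", OF _ _ _ _ \<sigma>])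
    show "continuous_on ({0..1} \<times> {0..1}) G2"
      unfolding G2_def case_prod_beta by (intro continuous_intros)
    show "G2 ` ({0..1} \<times> {0..1}) \<subseteq> nonresonant"
    proof (rule image_subsetI)
      fix q :: "real \<times> real" assume "q \<in> {0..1} \<times> {0..1}"
      then obtain u t where q: "q = (u, t)" and u: "0 \<le> u" "u \<le> 1" by auto
      have U: "coord_sum UNIV (G2 (u, t)) = 0" using n \<eta> e l0U by (simp add: G2_def w1_def)
      have comb: "0 < (1 - u) * x + u * y" if "0 < x" "0 < y" for x y :: real
        using that u by (cases "u = 0") (auto intro: add_nonneg_pos)
      have "coord_sum K (G2 (u, t)) \<noteq> 0" if K: "proper_subset K" for K
      proof -
        consider "same_hyperplane K I" | "same_hyperplane K J" | "\<not> same_hyperplane K I" "\<not> same_hyperplane K J" by blast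
        then show ?thesis
        proof cases
          case 1
          have "coord_sum I (G2 (u, t)) = turn t * (of_real (1 - u) * coord_sum I v + of_real u * coord_sum I l0)"
            using n \<eta> e by (simp add: G2_def w1_def algebra_simps)
          moreover have "Re (of_real (1 - u) * coord_sum I v + of_real u * coord_sum I l0) * Re (coord_sum I l0) > 0"
          proof -
            have "0 < Re (coord_sum I l0) * Re (coord_sum I l0)" using lI(1) not_real_square_gt_zero by blast
            from comb[OF vI this] show ?thesis by (simp add: algebra_simps)
          qed
          then have "of_real (1 - u) * coord_sum I v + of_real u * coord_sum I l0 \<noteq> 0"
            by (metis less_irrefl mult_zero_left zero_complex.sel(1))
          ultimately have "coord_sum I (G2 (u, t)) \<noteq> 0" by simp
          then show ?thesis using same_hyperplaneD[OF 1 U] by simp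
        next
          case 2
          have "coord_sum J (G2 (u, t)) = of_real (1 - u) * coord_sum J (n + turn t *s v) + of_real u * coord_sum J l0"
            using n \<eta> e by (simp add: G2_def w1_def algebra_simps)
          moreover have "Re (of_real (1 - u) * coord_sum J (n + turn t *s v) + of_real u * coord_sum J l0) * Re (coord_sum J l0) =
             (1 - u) * (Re (coord_sum J (n + turn t *s v)) * Re (coord_sum J l0)) + u * (Re (coord_sum J l0) * Re (coord_sum J l0))"
            by (simp add: algebra_simps)
          moreover have "\<dots> > 0"
            using comb[OF sgn[OF J IJ] sqJ, of "turn t"] by simp
          ultimately have "coord_sum J (G2 (u, t)) \<noteq> 0" by (metis less_irrefl mult_zero_left zero_complex.sel(1))
          then show ?thesis using same_hyperplaneD[OF 2 U] by simp
        next
          case 3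
          let ?A = "of_real (1 - u) * (coord_sum K n + turn t * coord_sum K v) + of_real u * (coord_sum K l0 + (turn t - 1) * (coord_sum I l0 * coord_sum K e))"
          have eq: "coord_sum K (G2 (u, t)) = ?A + \<i> * of_real S * coord_sum K \<eta>"
            by (simp add: G2_def w1_def algebra_simps)
          have "norm ?A \<le> norm (of_real (1 - u) * (coord_sum K n + turn t * coord_sum K v)) +
              norm (of_real u * (coord_sum K l0 + (turn t - 1) * (coord_sum I l0 * coord_sum K e)))" by (rule norm_triangle_ineq)
          also have "norm (of_real (1 - u) * (coord_sum K n + turn t * coord_sum K v)) \<le> norm (coord_sum K n) + norm (coord_sum K v)"
          proof -
            have "norm (of_real (1 - u) * (coord_sum K n + turn t * coord_sum K v)) = (1 - u) * norm (coord_sum K n + turn t * coord_sum K v)"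
              using u by (simp add: norm_mult del: of_real_diff)
            also have "\<dots> \<le> 1 * (norm (coord_sum K n) + norm (turn t * coord_sum K v))"
              by (intro mult_mono norm_triangle_ineq) (use u in auto)
            finally show ?thesis by (simp add: norm_mult)
          qed
          also have "norm (of_real u * (coord_sum K l0 + (turn t - 1) * (coord_sum I l0 * coord_sum K e))) \<le>
              norm (coord_sum K l0) + 2 * norm (coord_sum I l0 * coord_sum K e)"
          proof -
            have "norm (turn t - 1) \<le> 2" using norm_triangle_ineq4[of "turn t" 1] by simp
            then have "norm ((turn t - 1) * (coord_sum I l0 * coord_sum K e)) \<le> 2 * norm (coord_sum I l0 * coord_sum K e)"
              unfolding norm_mult[of "turn t - 1"] by (intro mult_right_mono) auto
            then have le: "norm (coord_sum K l0) + norm ((turn t - 1) * (coord_sum I l0 * coord_sum K e)) \<le>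
                norm (coord_sum K l0) + 2 * norm (coord_sum I l0 * coord_sum K e)" by simp
            have "norm (of_real u * (coord_sum K l0 + (turn t - 1) * (coord_sum I l0 * coord_sum K e))) =
                u * norm (coord_sum K l0 + (turn t - 1) * (coord_sum I l0 * coord_sum K e))"
              using u by (simp add: norm_mult)
            also have "\<dots> \<le> 1 * (norm (coord_sum K l0) + norm ((turn t - 1) * (coord_sum I l0 * coord_sum K e)))"
              by (intro mult_mono norm_triangle_ineq) (use u in auto)
            finally show ?thesis using le by simp
          qed
          finally have "norm ?A < S * norm (coord_sum K \<eta>)" using S(2)[OF K 3] by linarith
          also have "\<dots> = norm (\<i> * of_real S * coord_sum K \<eta>)" using S(1) by (simp add: norm_mult)
          finally have "?A \<noteq> - (\<i> * of_real S * coord_sum K \<eta>)" by auto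
          then show ?thesis unfolding eq by (simp only: eq_neg_iff_add_eq_0 simp_thms)
        qed
      qed
      with U show "G2 q \<in> nonresonant" by (simp add: nonresonant_def q)
    qed
    show "G2 (u, 0) \<in> tube l0" if "u \<in> {0..1}" for u
    proof -
      have "(1 - u) *\<^sub>R (n + v) + u *\<^sub>R l0 \<in> tube l0"
        using that by (intro convexD[OF convex_tube n(6) l0(1)]) auto
      moreover have "(1 - u) *\<^sub>R (n + v) + u *\<^sub>R l0 + (\<i> * of_real S) *s \<eta> = G2 (u, 0)"
        unfolding G2_def w1_def scaleR_eq_smult vec_eq_iff by (simp add: algebra_simps)
      ultimately show ?thesis using tubei by metis
    qed
  qed (use 1 in \<open>simp_all add: G1_def G2_def\<close>)
  also have "(\<lambda>t. G2 (1, t)) = (\<lambda>t. l0 + (\<i> * of_real S) *s \<eta> + ((turn t - 1) * coord_sum I l0) *s e)"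
    unfolding G2_def w1_def fun_eq_iff vec_eq_iff by (simp add: algebra_simps)
  finally show ?thesis .
qed

text \<open>The two small circles transport the sections over the tube as the coordinate circles of
  one torus do, and these commute. The tails of the loops stay in the tube, so the result passes
  from sections to lifts starting at x.\<close>

lemma loops_commute:
  fixes I J :: "'p set"
  assumes C: "C \<in> real_chambers" "l0 \<in> C" and sec: "secant I J"
    and loops: "resonance_loop C I l0 \<gamma>" "resonance_loop C J l0 \<gamma>'"
    and x: "x \<in> X0" "residues b x = l0"
  shows "\<exists>y z w. lifts \<gamma> x y \<and> lifts \<gamma>' x z \<and> lifts \<gamma>' y w \<and> lifts \<gamma> z w"
proof -
  let ?T = "tube l0"
  have I: "proper_subset I" and J: "proper_subset J"
    using sec unfolding secant_def proper_subset_def by simp_all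
  have sec': "secant J I"
    using sec unfolding secant_def by (simp only: Int_commute simp_thms)
  have l0: "l0 \<in> ?T" "real_vec l0" by (rule subsetD[OF chamber_tube(1)[OF C] C(2)], rule chamber_tube(2)[OF C C(2)])
  have l0U: "coord_sum UNIV l0 = 0" using l0 by (simp add: tube_def)
  obtain n v \<alpha> where I1: "wall_disc l0 I n v" "path \<alpha>" "path_image \<alpha> \<subseteq> ?T" "pathstart \<alpha> = l0"
    "pathfinish \<alpha> = n + v" "\<gamma> = \<alpha> +++ (\<lambda>t. n + turn t *s v) +++ reversepath \<alpha>"
    using resonance_loop_wall_disc[OF C I loops(1)] by (elim exE conjE)
  obtain n' v' \<alpha>' where J1: "wall_disc l0 J n' v'" "path \<alpha>'" "path_image \<alpha>' \<subseteq> ?T" "pathstart \<alpha>' = l0"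
    "pathfinish \<alpha>' = n' + v'" "\<gamma>' = \<alpha>' +++ (\<lambda>t. n' + turn t *s v') +++ reversepath \<alpha>'"
    using resonance_loop_wall_disc[OF C J loops(2)] by (elim exE conjE)
  obtain \<eta> where \<eta>: "real_vec \<eta>" "coord_sum UNIV \<eta> = 0" "coord_sum I \<eta> = 0" "coord_sum J \<eta> = 0"
    "\<forall>K. proper_subset K \<longrightarrow> \<not> same_hyperplane K I \<longrightarrow> \<not> same_hyperplane K J \<longrightarrow> coord_sum K \<eta> \<noteq> 0"
    using secant_generic_vector[OF sec] by (elim exE conjE)
  obtain e where e: "real_vec e" "coord_sum UNIV e = 0" "coord_sum I e = 1" "coord_sum J e = 0" using dual_vector[OF sec] by (elim exE conjE)
  obtain e' where e': "real_vec e'" "coord_sum UNIV e' = 0" "coord_sum J e' = 1" "coord_sum I e' = 0" using dual_vector[OF sec'] by (elim exE conjE)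
  define \<K> where "\<K> = {K. proper_subset K \<and> \<not> same_hyperplane K I \<and> \<not> same_hyperplane K J}"
  \<comment> \<open>One height has to serve both wall circles and the torus; M adds up the bounds
    that all three require.\<close>
  define M where "M = (\<lambda>K. norm (coord_sum K n) + norm (coord_sum K v) + norm (coord_sum K n') + norm (coord_sum K v') + norm (coord_sum K l0) +
      2 * norm (coord_sum I l0 * coord_sum K e) + 2 * norm (coord_sum J l0 * coord_sum K e'))"
  have "\<exists>S>0. \<forall>K\<in>\<K>. M K < S * norm (coord_sum K \<eta>)"
    by (rule large_multiple) (simp_all add: \<K>_def \<eta>(5))
  then obtain S where S: "S > 0" "\<forall>K\<in>\<K>. M K < S * norm (coord_sum K \<eta>)" by (elim exE conjE)
  \<comment> \<open>e and e' are dual to the sums over I and J, so the first sum sees only turn s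
    and the second only turn t; every other sum is dominated by the height.\<close>
  define \<Theta> where "\<Theta> = (\<lambda>(s, t). l0 + (\<i> * of_real S) *s \<eta> + ((turn s - 1) * coord_sum I l0) *s e + ((turn t - 1) * coord_sum J l0) *s e')"
  have nIJ: "\<not> same_hyperplane I J" "\<not> same_hyperplane J I"
    using secant_not_same_hyperplane[OF sec] secant_not_same_hyperplane[OF sec'] .
  have "\<Theta> (s, t) \<in> nonresonant" for s t
  proof -
    have U: "coord_sum UNIV (\<Theta> (s, t)) = 0" using e e' \<eta> l0U by (simp add: \<Theta>_def)
    have nz: "coord_sum I l0 \<noteq> 0" "coord_sum J l0 \<noteq> 0" using l0(1) I J tube_nonresonant by (auto simp: nonresonant_def)
    have "coord_sum K (\<Theta> (s, t)) \<noteq> 0" if K: "proper_subset K" for K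
    proof -
      consider "same_hyperplane K I" | "same_hyperplane K J" | "K \<in> \<K>" using K by (auto simp: \<K>_def)
      then show ?thesis
      proof cases
        case 1
        have "coord_sum I (\<Theta> (s, t)) = turn s * coord_sum I l0" using e e' \<eta> by (simp add: \<Theta>_def algebra_simps)
        then show ?thesis using same_hyperplaneD[OF 1 U] nz by simp
      next
        case 2
        have "coord_sum J (\<Theta> (s, t)) = turn t * coord_sum J l0" using e e' \<eta> by (simp add: \<Theta>_def algebra_simps)
        then show ?thesis using same_hyperplaneD[OF 2 U] nz by simp
      next
        case 3
        let ?A = "coord_sum K l0 + (turn s - 1) * (coord_sum I l0 * coord_sum K e) + (turn t - 1) * (coord_sum J l0 * coord_sum K e')"
        have two: "norm ((turn r - 1) * c) \<le> 2 * norm c" for r c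
        proof -
          have "norm (turn r - 1) \<le> 2" using norm_triangle_ineq4[of "turn r" 1] by simp
          then show ?thesis unfolding norm_mult by (intro mult_right_mono) auto
        qed
        have "norm ?A \<le> norm (coord_sum K l0) + norm ((turn s - 1) * (coord_sum I l0 * coord_sum K e)) + norm ((turn t - 1) * (coord_sum J l0 * coord_sum K e'))"
          using norm_triangle_ineq[of "coord_sum K l0 + (turn s - 1) * (coord_sum I l0 * coord_sum K e)" "(turn t - 1) * (coord_sum J l0 * coord_sum K e')"]
            norm_triangle_ineq[of "coord_sum K l0" "(turn s - 1) * (coord_sum I l0 * coord_sum K e)"] by linarith
        also have "\<dots> \<le> norm (coord_sum K l0) + 2 * norm (coord_sum I l0 * coord_sum K e) + 2 * norm (coord_sum J l0 * coord_sum K e')"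
          by (intro add_mono two order.refl)
        also have "\<dots> \<le> M K" by (simp add: M_def)
        also have "\<dots> < S * norm (coord_sum K \<eta>)" using S(2) 3 by blast
        also have "\<dots> = norm (\<i> * of_real S * coord_sum K \<eta>)" using S(1) by (simp add: norm_mult)
        finally have "?A \<noteq> - (\<i> * of_real S * coord_sum K \<eta>)" by auto
        moreover have "coord_sum K (\<Theta> (s, t)) = ?A + \<i> * of_real S * coord_sum K \<eta>" by (simp add: \<Theta>_def algebra_simps)
        ultimately show ?thesis by (simp only: eq_neg_iff_add_eq_0 simp_thms)
      qed
    qed
    with U show ?thesis by (simp add: nonresonant_def)
  qed
  then have \<Theta>: "\<Theta> ` ({0..1} \<times> {0..1}) \<subseteq> nonresonant" by auto
  have cont\<Theta>: "continuous_on ({0..1} \<times> {0..1}) \<Theta>"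
    unfolding \<Theta>_def case_prod_beta by (intro continuous_intros)
  have P: "\<Theta> (0, 0) \<in> ?T"
    using l0 coord_sum_Im[OF \<eta>(1)] \<eta>(2) by (simp add: \<Theta>_def tube_def)
  define \<delta> where "\<delta> = (\<lambda>t. n + turn t *s v)"
  define \<delta>' where "\<delta>' = (\<lambda>t. n' + turn t *s v')"
  have toI: "transports \<sigma> \<tau> (\<lambda>s. \<Theta> (s, 0))"
    if "is_section ?T \<sigma>" "is_section ?T \<tau>" "transports \<sigma> \<tau> \<delta>" for \<sigma> \<tau>
  proof -
    have "transports \<sigma> \<tau> (\<lambda>t. l0 + (\<i> * of_real S) *s \<eta> + ((turn t - 1) * coord_sum I l0) *s e)"
    proof (rule transport_wall_disc[OF I1(1) l0 I J nIJ(2) \<eta>(1-4) e(2-4) S(1) _ that[unfolded \<delta>_def]])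
      fix K assume "proper_subset K" "\<not> same_hyperplane K I" "\<not> same_hyperplane K J"
      then have "M K < S * norm (coord_sum K \<eta>)" using S(2) by (simp add: \<K>_def)
      then show "norm (coord_sum K n) + norm (coord_sum K v) + norm (coord_sum K l0) + 2 * norm (coord_sum I l0 * coord_sum K e) < S * norm (coord_sum K \<eta>)"
        using norm_ge_zero[of "coord_sum K n'"] norm_ge_zero[of "coord_sum K v'"]
          norm_ge_zero[of "coord_sum J l0 * coord_sum K e'"]
        unfolding M_def by linarith
    qed
    then show ?thesis by (simp add: \<Theta>_def)
  qed
  have toJ: "transports \<sigma> \<tau> (\<lambda>t. \<Theta> (0, t))"
    if "is_section ?T \<sigma>" "is_section ?T \<tau>" "transports \<sigma> \<tau> \<delta>'" for \<sigma> \<tau>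
  proof -
    have "transports \<sigma> \<tau> (\<lambda>t. l0 + (\<i> * of_real S) *s \<eta> + ((turn t - 1) * coord_sum J l0) *s e')"
    proof (rule transport_wall_disc[OF J1(1) l0 J I nIJ(1) \<eta>(1,2,4,3) e'(2-4) S(1) _ that[unfolded \<delta>'_def]])
      fix K assume "proper_subset K" "\<not> same_hyperplane K J" "\<not> same_hyperplane K I"
      then have "M K < S * norm (coord_sum K \<eta>)" using S(2) by (simp add: \<K>_def)
      then show "norm (coord_sum K n') + norm (coord_sum K v') + norm (coord_sum K l0) + 2 * norm (coord_sum J l0 * coord_sum K e') < S * norm (coord_sum K \<eta>)"
        using norm_ge_zero[of "coord_sum K n"] norm_ge_zero[of "coord_sum K v"]
          norm_ge_zero[of "coord_sum I l0 * coord_sum K e"]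
        unfolding M_def by linarith
    qed
    then show ?thesis by (simp add: \<Theta>_def)
  qed
  have trI: "\<exists>\<tau>. is_section ?T \<tau> \<and> transports \<sigma> \<tau> \<delta>" if "is_section ?T \<sigma>" for \<sigma>
  proof -
    have "n + turn 0 *s v \<in> ?T" "n + turn 1 *s v = n + turn 0 *s v"
      using I1(1) by (simp_all add: wall_disc_def)
    then show ?thesis
    proof (rule transport_exists[OF convex_tube tube_nonresonant that wall_circle_path[OF I1(1) I]])
      fix \<tau> assume "is_section ?T \<tau>" "transports \<sigma> \<tau> (\<lambda>t. n + turn t *s v)"
      then show ?thesis unfolding \<delta>_def by blast
    qed
  qed
  have trJ: "\<exists>\<tau>. is_section ?T \<tau> \<and> transports \<sigma> \<tau> \<delta>'" if "is_section ?T \<sigma>" for \<sigma>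
  proof -
    have "n' + turn 0 *s v' \<in> ?T" "n' + turn 1 *s v' = n' + turn 0 *s v'"
      using J1(1) by (simp_all add: wall_disc_def)
    then show ?thesis
    proof (rule transport_exists[OF convex_tube tube_nonresonant that wall_circle_path[OF J1(1) J]])
      fix \<tau> assume "is_section ?T \<tau>" "transports \<sigma> \<tau> (\<lambda>t. n' + turn t *s v')"
      then show ?thesis unfolding \<delta>'_def by blast
    qed
  qed
  obtain \<sigma> where \<sigma>: "is_section ?T \<sigma>" "\<sigma> l0 = x"
    by (rule section_exists[OF convex_tube tube_nonresonant l0(1) x])
  obtain \<tau> where \<tau>: "is_section ?T \<tau>" "transports \<sigma> \<tau> \<delta>" using trI[OF \<sigma>(1)] by blast
  obtain \<sigma>' where \<sigma>': "is_section ?T \<sigma>'" "transports \<sigma> \<sigma>' \<delta>'" using trJ[OF \<sigma>(1)] by blast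
  obtain \<tau>' where \<tau>': "is_section ?T \<tau>'" "transports \<tau> \<tau>' \<delta>'" using trJ[OF \<tau>(1)] by blast
  obtain \<tau>'' where \<tau>'': "is_section ?T \<tau>''" "transports \<sigma>' \<tau>'' \<delta>" using trI[OF \<sigma>'(1)] by blast
  have per: "\<Theta> (1, t) = \<Theta> (0, t)" "\<Theta> (t, 1) = \<Theta> (t, 0)" for t by (simp_all add: \<Theta>_def)
  have A: "transports \<sigma>' \<tau>' (\<lambda>s. \<Theta> (s, 0))"
    by (rule transports_commute[OF cont\<Theta> \<Theta> per P \<sigma>(1) toI[OF \<sigma>(1) \<tau>] toJ[OF \<sigma>(1) \<sigma>'] toJ[OF \<tau>(1) \<tau>']])
  have "transports \<sigma>' \<tau>'' (\<lambda>s. \<Theta> (s, 0))" by (rule toI[OF \<sigma>'(1) \<tau>''])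
  with A have "\<tau>' (\<Theta> (1, 0)) = \<tau>'' (\<Theta> (1, 0))" unfolding transports_def by (rule lifts_unique)
  then have eq: "\<tau>'' l0 = \<tau>' l0"
    using section_unique[OF convex_tube \<tau>''(1) \<tau>'(1), of "\<Theta> (1, 0)" l0] per P l0(1) by simp
  have loopI: "lifts \<gamma> (\<rho> l0) (\<rho>' l0)" if "is_section ?T \<rho>" "is_section ?T \<rho>'" "transports \<rho> \<rho>' \<delta>" for \<rho> \<rho>'
    using lifts_loop[OF that I1(2,3)] I1(4,5,6) by (simp add: \<delta>_def)
  have loopJ: "lifts \<gamma>' (\<rho> l0) (\<rho>' l0)" if "is_section ?T \<rho>" "is_section ?T \<rho>'" "transports \<rho> \<rho>' \<delta>'" for \<rho> \<rho>'
    using lifts_loop[OF that J1(2,3)] J1(4,5,6) by (simp add: \<delta>'_def)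
  have "lifts \<gamma> x (\<tau> l0)" "lifts \<gamma>' x (\<sigma>' l0)" "lifts \<gamma>' (\<tau> l0) (\<tau>' l0)" "lifts \<gamma> (\<sigma>' l0) (\<tau>' l0)"
    using loopI[OF \<sigma>(1) \<tau>] loopJ[OF \<sigma>(1) \<sigma>'] loopJ[OF \<tau>(1) \<tau>'] loopI[OF \<sigma>'(1) \<tau>''] \<sigma>(2) eq
    by simp_all
  then show ?thesis by (intro exI conjI)
qed

end

section \<open>Isomorphisms of forms on the sphere\<close>

lemma cp1_inversion_simps [simp]:
  "cp1_inversion None = Some 0" "cp1_inversion (Some 0) = None"
  "z \<noteq> 0 \<Longrightarrow> cp1_inversion (Some z) = Some (inverse z)"
  "cp1_inversion (cp1_inversion P) = P"
  by (auto simp: cp1_inversion_def split: option.splits)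

lemma cp1_inversion_eq_None_iff [simp]: "cp1_inversion P = None \<longleftrightarrow> P = Some 0"
  by (auto simp: cp1_inversion_def split: option.splits)

text \<open>
  \<open>local_chart P\<close> is a standard chart that is finite at \<open>P\<close>; it is its own inverse.
\<close>

definition local_chart :: "cp1 \<Rightarrow> cp1 \<Rightarrow> cp1" where
  "local_chart P = (if P = None then cp1_inversion else id)"

lemma local_chart_simps [simp]:
  "local_chart P (local_chart P Q) = Q" "local_chart P P \<noteq> None" "local_chart P \<in> {id, cp1_inversion}"
  by (auto simp: local_chart_def)

definition local_coord :: "cp1 \<Rightarrow> complex" where
  "local_coord P = the (local_chart P P)"

lemma local_coord: "local_chart P P = Some (local_coord P)"
  by (simp add: local_coord_def)

lemma local_coord_simps [simp]: "local_coord (Some z) = z" "local_coord None = 0"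
  by (simp_all add: local_coord_def local_chart_def)

definition local_coeff :: "(complex \<Rightarrow> complex) \<Rightarrow> cp1 \<Rightarrow> complex \<Rightarrow> complex" where
  "local_coeff f P = (if P = None then coeff_at_infinity f else f)"

lemma form_residue_local: "form_residue f P = 2 * of_real pi * \<i> * residue (local_coeff f P) (local_coord P)"
  by (cases P) (simp_all add: form_residue_def local_coeff_def)

lemma local_coeff_meromorphic: "meromorphic_form f \<Longrightarrow> local_coeff f P meromorphic_on {local_coord P}"
  by (cases P) (auto simp: meromorphic_form_def local_coeff_def nicely_meromorphic_on_def intro: meromorphic_on_subset)

lemma cp1_holomorphicD:
  assumes "cp1_holomorphic \<phi>" "\<sigma> \<in> {id, cp1_inversion}" "\<tau> \<in> {id, cp1_inversion}"
  shows "open {z. \<tau> (\<phi> (\<sigma> (Some z))) \<noteq> None}"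
    "(\<lambda>z. the (\<tau> (\<phi> (\<sigma> (Some z))))) holomorphic_on {z. \<tau> (\<phi> (\<sigma> (Some z))) \<noteq> None}"
  using assms unfolding cp1_holomorphic_def by blast+

text \<open>Change of variables along a small circle. Its image under the injective h winds once
  around h z0, because h' / (h - h z0) has a simple pole of residue 1. The formula is assumed only
  off z0, where the coefficient may be singular.\<close>

lemma residue_pullback:
  assumes S: "open S" "z0 \<in> S" and h: "h holomorphic_on S" "inj_on h S"
    and F: "isolated_singularity_at F (h z0)"
    and eq: "\<And>z. z \<in> S \<Longrightarrow> z \<noteq> z0 \<Longrightarrow> f z = F (h z) * deriv h z"
  shows "residue f z0 = residue F (h z0)"
proof -
  obtain r where r: "r > 0" "F holomorphic_on ball (h z0) r - {h z0}"
    using F unfolding isolated_singularity_at_def by (meson analytic_imp_holomorphic)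
  have "isCont h z0" using holomorphic_on_imp_continuous_on[OF h(1)] S by (simp add: continuous_on_eq_continuous_at)
  then have "\<forall>\<^sub>F z in at z0. h z \<in> ball (h z0) r" using tendstoD[OF _ r(1), of h "h z0"] by (simp add: isCont_def dist_commute)
  then have "\<forall>\<^sub>F z in nhds z0. h z \<in> ball (h z0) r \<and> z \<in> S"
    using S r(1) by (auto simp: eventually_at_filter eventually_conj_iff eventually_nhds_in_open elim!: eventually_mono)
  then obtain e where e: "e > 0" "\<And>z. dist z z0 < e \<Longrightarrow> h z \<in> ball (h z0) r \<and> z \<in> S"
    unfolding eventually_nhds_metric by blast
  define d where "d = e / 2"
  have d: "d > 0" "d < e" using e by (auto simp: d_def)
  define U where "U = ball z0 e"
  have U: "open U" "z0 \<in> U" "cball z0 d \<subseteq> U" "U \<subseteq> S" using e d by (auto simp: U_def dist_commute)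
  have hU: "h ` U \<subseteq> ball (h z0) r" using e(2) by (auto simp: U_def dist_commute)
  have hne: "h z \<noteq> h z0" if "z \<in> U" "z \<noteq> z0" for z using h(2) that U S by (auto dest: inj_onD)
  have holh: "h holomorphic_on U" using h(1) U(4) by (rule holomorphic_on_subset)
  have d0: "deriv h z0 \<noteq> 0" by (rule holomorphic_injective_imp_regular[OF h(1) S(1) h(2) S(2)])
  let ?c = "circlepath z0 d"
  have vp: "valid_path (h \<circ> ?c)"
    by (rule valid_path_compose_holomorphic[OF _ holh U(1)]) (use U(3) d in \<open>auto simp: path_image_circlepath\<close>)
  have pim: "path_image (h \<circ> ?c) \<subseteq> ball (h z0) r - {h z0}"
  proof -
    have "path_image ?c \<subseteq> U - {z0}" using U(3) d by (auto simp: path_image_circlepath)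
    then show ?thesis using hU hne by (auto simp: path_image_compose)
  qed
  have closed: "pathfinish (h \<circ> ?c) = pathstart (h \<circ> ?c)" by (simp add: pathfinish_compose pathstart_compose)
  have compose: "contour_integral (h \<circ> ?c) G = contour_integral ?c (\<lambda>z. deriv h z * G (h z))" for G
    by (rule contour_integral_comp_analyticW[of _ U])
       (use U d holh in \<open>auto simp: path_image_circlepath analytic_on_open\<close>)
  have dh: "deriv h holomorphic_on U" by (rule holomorphic_deriv[OF holh U(1)])
  have holq: "(\<lambda>z. deriv h z / (h z - h z0)) holomorphic_on U - {z0}"
  proof (rule holomorphic_on_divide)
    show "deriv h holomorphic_on U - {z0}" by (rule holomorphic_on_subset[OF dh]) auto
    show "(\<lambda>z. h z - h z0) holomorphic_on U - {z0}"
      by (intro holomorphic_on_diff holomorphic_on_subset[OF holh] holomorphic_on_const) auto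
    show "h z - h z0 \<noteq> 0" if "z \<in> U - {z0}" for z using hne[of z] that by simp
  qed
  have wind: "winding_number (h \<circ> ?c) (h z0) = 1"
  proof -
    have "winding_number (h \<circ> ?c) (h z0) = 1 / (2 * pi * \<i>) * contour_integral (h \<circ> ?c) (\<lambda>w. 1 / (w - h z0))"
      by (rule winding_number_valid_path[OF vp]) (use pim in auto)
    also have "contour_integral (h \<circ> ?c) (\<lambda>w. 1 / (w - h z0)) = contour_integral ?c (\<lambda>z. deriv h z / (h z - h z0))"
      unfolding compose by simp
    also have "\<dots> = 2 * pi * \<i> * residue (\<lambda>z. deriv h z / (h z - h z0)) z0"
      by (rule contour_integral_unique, rule base_residue[OF U(1,2) d(1) _ U(3)])
         (rule holq)
    also have "residue (\<lambda>z. deriv h z / (h z - h z0)) z0 = deriv h z0 / deriv h z0"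
    proof (rule residue_simple_pole_deriv[where s = U])
      show "connected U" by (simp add: U_def)
      show "((\<lambda>z. h z - h z0) has_field_derivative deriv h z0) (at z0)"
        using holomorphic_derivI[OF holh U(1,2)] by (auto intro!: derivative_eq_intros)
      show "deriv h holomorphic_on U" by (rule dh)
      show "(\<lambda>z. h z - h z0) holomorphic_on U" by (intro holomorphic_on_diff holh holomorphic_on_const)
    qed (use U(1,2) d0 in simp_all)
    finally show ?thesis using d0 by (simp add: o_def)
  qed
  have "contour_integral ?c f = contour_integral ?c (\<lambda>z. deriv h z * F (h z))"
  proof (rule contour_integral_cong[OF refl])
    fix z assume "z \<in> path_image ?c"
    then have "z \<in> S" "z \<noteq> z0" using U d by (auto simp: path_image_circlepath)
    with eq show "f z = deriv h z * F (h z)" by simp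
  qed
  also have "\<dots> = contour_integral (h \<circ> ?c) F" by (rule compose[symmetric])
  also have "\<dots> = 2 * pi * \<i> * (\<Sum>p\<in>{h z0}. winding_number (h \<circ> ?c) p * residue F p)"
    by (rule Residue_theorem[of "ball (h z0) r"])
       (use r vp pim closed in \<open>auto intro!: winding_number_zero_outside[of _ "ball (h z0) r"] valid_path_imp_path\<close>)
  finally have 1: "contour_integral ?c f = 2 * pi * \<i> * residue F (h z0)" by (simp add: wind)
  have "(\<lambda>z. F (h z) * deriv h z) holomorphic_on U - {z0}"
  proof (rule holomorphic_on_mult)
    show "(\<lambda>z. F (h z)) holomorphic_on U - {z0}"
      using holomorphic_on_compose_gen[OF holomorphic_on_subset[OF holh] r(2), of "U - {z0}"] hU hne
      by (auto simp: o_def image_subset_iff)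
    show "deriv h holomorphic_on U - {z0}"
      by (rule holomorphic_on_subset[OF dh]) auto
  qed
  then have "f holomorphic_on U - {z0}"
    by (rule holomorphic_transform) (use eq U(4) in auto)
  from base_residue[OF U(1,2) d(1) this U(3)]
  have "contour_integral ?c f = 2 * pi * \<i> * residue f z0" by (rule contour_integral_unique)
  with 1 show ?thesis by simp
qed

text \<open>In a chart around the image point \<phi> becomes an injective holomorphic function, even
  if z0 goes to infinity. The pullback formula is claimed off z0 because at a point sent to infinity
  the formula for \<open>coeff_at_infinity\<close> divides by 0.\<close>

lemma form_iso_local:
  fixes f g :: "complex \<Rightarrow> complex"
  assumes \<phi>: "cp1_biholomorphic \<phi>"
    and eq: "\<forall>z u. \<phi> (Some z) = Some u \<longrightarrow> f z = g u * deriv (\<lambda>t. the (\<phi> (Some t))) z"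
  shows "\<exists>S h. open S \<and> z0 \<in> S \<and> h holomorphic_on S \<and> inj_on h S \<and> h z0 = local_coord (\<phi> (Some z0)) \<and>
    (\<forall>z\<in>S. \<phi> (Some z) = local_chart (\<phi> (Some z0)) (Some (h z))) \<and>
    (\<forall>z\<in>S. z \<noteq> z0 \<longrightarrow> f z = local_coeff g (\<phi> (Some z0)) (h z) * deriv h z)"
proof -
  define P where "P = \<phi> (Some z0)"
  define \<tau> where "\<tau> = local_chart P"
  define S where "S = {z. \<tau> (\<phi> (Some z)) \<noteq> None}"
  define h where "h = (\<lambda>z. the (\<tau> (\<phi> (Some z))))"
  have \<tau>: "\<tau> \<in> {id, cp1_inversion}" unfolding \<tau>_def by (rule local_chart_simps)
  have hol: "cp1_holomorphic \<phi>" and bij: "bij \<phi>" using \<phi> by (auto simp: cp1_biholomorphic_def)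
  have S: "open S" "h holomorphic_on S"
    using cp1_holomorphicD[OF hol _ \<tau>, of id] by (simp_all add: S_def h_def)
  have z0: "z0 \<in> S" unfolding S_def \<tau>_def P_def mem_Collect_eq by (rule local_chart_simps(2))
  have hz: "\<tau> (\<phi> (Some z)) = Some (h z)" if "z \<in> S" for z using that by (simp add: S_def h_def)
  have \<phi>z: "\<phi> (Some z) = \<tau> (Some (h z))" if "z \<in> S" for z
    using arg_cong[OF hz[OF that], of \<tau>] by (simp add: \<tau>_def)
  have inj: "inj_on h S"
  proof (rule inj_onI)
    fix z w assume "z \<in> S" "w \<in> S" "h z = h w"
    then have "\<phi> (Some z) = \<phi> (Some w)" using \<phi>z by simp
    then show "z = w" using bij by (simp add: bij_def inj_eq)
  qed
  have hz0: "h z0 = local_coord P" by (simp add: h_def \<tau>_def local_coord_def flip: P_def)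
  have fz: "f z = local_coeff g P (h z) * deriv h z" if z: "z \<in> S" "z \<noteq> z0" for z
  proof (cases "P = None")
    case False
    then have id: "\<tau> = id" by (auto simp: \<tau>_def local_chart_def)
    then have "\<phi> (Some z) = Some (h z)" using \<phi>z[OF z(1)] by simp
    then have "f z = g (h z) * deriv (\<lambda>t. the (\<phi> (Some t))) z" using eq by blast
    also have "(\<lambda>t. the (\<phi> (Some t))) = h" by (simp add: h_def id)
    finally show ?thesis using False by (auto simp: local_coeff_def)
  next
    case True
    then have inv: "\<tau> = cp1_inversion" by (simp add: \<tau>_def local_chart_def)
    have nz: "h t \<noteq> 0" if "t \<in> S - {z0}" for t
    proof
      assume "h t = 0"
      then have "h t = h z0" using hz0 True by simp
      then show False using inj_onD[OF inj] that z0 by blast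
    qed
    have \<phi>t: "\<phi> (Some t) = Some (inverse (h t))" if "t \<in> S - {z0}" for t
      using \<phi>z[of t] nz[OF that] that by (simp add: inv)
    have zz: "z \<in> S - {z0}" using z by simp
    have op: "open (S - {z0})" using S(1) by (simp add: open_delete)
    have "(h has_field_derivative deriv h z) (at z)"
      using holomorphic_derivI[OF S(2,1) z(1)] .
    then have "((\<lambda>t. inverse (h t)) has_field_derivative - deriv h z / (h z)\<^sup>2) (at z)"
      using nz[OF zz] by (auto intro!: derivative_eq_intros simp: power2_eq_square divide_inverse)
    then have "((\<lambda>t. the (\<phi> (Some t))) has_field_derivative - deriv h z / (h z)\<^sup>2) (at z)"
      by (rule has_field_derivative_transform_within_open[OF _ op zz]) (simp add: \<phi>t)
    then have "deriv (\<lambda>t. the (\<phi> (Some t))) z = - deriv h z / (h z)\<^sup>2" by (rule DERIV_imp_deriv)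
    moreover have "f z = g (inverse (h z)) * deriv (\<lambda>t. the (\<phi> (Some t))) z"
      using eq \<phi>t[OF zz] by blast
    ultimately show ?thesis using True by (simp add: local_coeff_def coeff_at_infinity_def)
  qed
  show ?thesis
    unfolding P_def[symmetric] \<tau>_def[symmetric]
    by (rule exI[of _ S], rule exI[of _ h]) (intro conjI ballI impI S z0 inj hz0 \<phi>z fz; assumption)
qed

text \<open>Finite z0 are enough: the poles of a normal form are finite, and g can be any form
  isomorphic to it.\<close>

lemma form_residue_pullback:
  assumes "cp1_biholomorphic \<phi>" "meromorphic_form g"
    and "\<forall>z u. \<phi> (Some z) = Some u \<longrightarrow> f z = g u * deriv (\<lambda>t. the (\<phi> (Some t))) z"
  shows "form_residue g (\<phi> (Some z0)) = 2 * of_real pi * \<i> * residue f z0"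
proof -
  obtain S h where S: "open S" "z0 \<in> S" "h holomorphic_on S" "inj_on h S" "h z0 = local_coord (\<phi> (Some z0))"
    "\<forall>z\<in>S. z \<noteq> z0 \<longrightarrow> f z = local_coeff g (\<phi> (Some z0)) (h z) * deriv h z"
    using form_iso_local[OF assms(1,3), of z0] by (elim exE conjE)
  have "isolated_singularity_at (local_coeff g (\<phi> (Some z0))) (h z0)"
    using local_coeff_meromorphic[OF assms(2), of "\<phi> (Some z0)"] S(5) by (simp add: meromorphic_at_iff)
  then have "residue f z0 = residue (local_coeff g (\<phi> (Some z0))) (h z0)"
    by (rule residue_pullback[OF S(1-4)]) (use S(6) in blast)
  then show ?thesis by (simp add: form_residue_local S(5))
qed

section \<open>Automorphisms of the sphere\<close>

lemma cp1_holomorphic_compose: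
  assumes \<phi>: "cp1_holomorphic \<phi>" and \<psi>: "cp1_holomorphic \<psi>"
  shows "cp1_holomorphic (\<psi> \<circ> \<phi>)"
  unfolding cp1_holomorphic_def
proof (intro ballI)
  fix \<sigma> \<tau> :: "cp1 \<Rightarrow> cp1" assume st: "\<sigma> \<in> {id, cp1_inversion}" "\<tau> \<in> {id, cp1_inversion}"
  let ?D = "{z. \<tau> ((\<psi> \<circ> \<phi>) (\<sigma> (Some z))) \<noteq> None}" and ?F = "\<lambda>z. the (\<tau> ((\<psi> \<circ> \<phi>) (\<sigma> (Some z))))"
  \<comment> \<open>Holomorphy is checked locally, through a middle chart that is finite at the
    image of z0.\<close>
  have loc: "\<exists>U. open U \<and> z0 \<in> U \<and> U \<subseteq> ?D \<and> ?F holomorphic_on U" if "z0 \<in> ?D" for z0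
  proof -
    define \<rho> where "\<rho> = local_chart (\<phi> (\<sigma> (Some z0)))"
    have \<rho>: "\<rho> \<in> {id, cp1_inversion}" "\<And>Q. \<rho> (\<rho> Q) = Q" "\<rho> (\<phi> (\<sigma> (Some z0))) \<noteq> None"
      unfolding \<rho>_def by (rule local_chart_simps)+
    define A where "A = {z. \<rho> (\<phi> (\<sigma> (Some z))) \<noteq> None}"
    define h where "h = (\<lambda>z. the (\<rho> (\<phi> (\<sigma> (Some z)))))"
    define B where "B = {w. \<tau> (\<psi> (\<rho> (Some w))) \<noteq> None}"
    define k where "k = (\<lambda>w. the (\<tau> (\<psi> (\<rho> (Some w)))))"
    have A: "open A" "h holomorphic_on A" using cp1_holomorphicD[OF \<phi> st(1) \<rho>(1)] by (simp_all add: A_def h_def)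
    have B: "open B" "k holomorphic_on B" using cp1_holomorphicD[OF \<psi> \<rho>(1) st(2)] by (simp_all add: B_def k_def)
    have \<phi>h: "\<phi> (\<sigma> (Some z)) = \<rho> (Some (h z))" if "z \<in> A" for z
      using that \<rho>(2)[of "\<phi> (\<sigma> (Some z))"] by (auto simp: A_def h_def)
    define U where "U = A \<inter> h -` B"
    have "open U" unfolding U_def using A B by (intro continuous_open_preimage holomorphic_on_imp_continuous_on)
    moreover have "z0 \<in> A" using \<rho>(3) by (simp add: A_def)
    then have "z0 \<in> U" using that \<phi>h[of z0] by (auto simp: U_def B_def)
    moreover have "U \<subseteq> ?D" using \<phi>h by (auto simp: U_def B_def)
    moreover have "?F holomorphic_on U"
    proof (rule holomorphic_transform)
      show "(k \<circ> h) holomorphic_on U"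
        by (rule holomorphic_on_compose_gen[OF holomorphic_on_subset[OF A(2)] B(2)]) (auto simp: U_def)
    qed (use \<phi>h in \<open>auto simp: U_def k_def\<close>)
    ultimately show ?thesis by blast
  qed
  have "open ?D" by (subst open_subopen) (use loc in blast)
  moreover have "?F holomorphic_on ?D"
    unfolding holomorphic_on_def
  proof
    fix z0 assume "z0 \<in> ?D"
    then obtain U where "open U" "z0 \<in> U" "?F holomorphic_on U" using loc by blast
    then show "?F field_differentiable at z0 within ?D"
      by (meson field_differentiable_at_within holomorphic_on_imp_differentiable_at)
  qed
  ultimately show "open ?D \<and> ?F holomorphic_on ?D" ..
qed

lemma cp1_biholomorphic_compose:
  assumes "cp1_biholomorphic \<phi>" "cp1_biholomorphic \<psi>"
  shows "cp1_biholomorphic (\<psi> \<circ> \<phi>)"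
  using assms cp1_holomorphic_compose[of \<phi> \<psi>] cp1_holomorphic_compose[of "inv \<psi>" "inv \<phi>"]
  by (auto simp: cp1_biholomorphic_def bij_comp o_inv_distrib)

lemma cp1_biholomorphic_inv: "cp1_biholomorphic \<phi> \<Longrightarrow> cp1_biholomorphic (inv \<phi>)"
  by (auto simp: cp1_biholomorphic_def bij_imp_bij_inv inv_inv_eq)

text \<open>In the chart at infinity the map k has a simple zero at 0 by injectivity, so the
  difference quotient of h tends to 1 / c at infinity; being entire, it is constant by
  Liouville.\<close>

lemma cp1_automorphism_affine:
  assumes \<phi>: "cp1_biholomorphic \<phi>" and inf: "\<phi> None = None"
  shows "\<exists>\<alpha> \<beta>. \<alpha> \<noteq> 0 \<and> (\<forall>z. \<phi> (Some z) = Some (\<alpha> * z + \<beta>))"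
proof -
  have hol: "cp1_holomorphic \<phi>" and bij: "bij \<phi>" using \<phi> by (auto simp: cp1_biholomorphic_def)
  define h where "h = (\<lambda>z. the (\<phi> (Some z)))"
  have ne: "\<phi> (Some z) \<noteq> None" for z
    using bij inf by (metis bij_is_inj injD option.distinct(1))
  then have h: "\<phi> (Some z) = Some (h z)" for z by (simp add: h_def)
  have holh: "h holomorphic_on UNIV"
    using cp1_holomorphicD(2)[OF hol, of id id] ne by (simp add: h_def)
  have injh: "inj h" using bij h by (metis bij_is_inj injD injI option.inject)
  define k where "k = (\<lambda>w. the (cp1_inversion (\<phi> (cp1_inversion (Some w)))))"
  define S where "S = {w. cp1_inversion (\<phi> (cp1_inversion (Some w))) \<noteq> None}"
  have S: "open S" "k holomorphic_on S"
    using cp1_holomorphicD[OF hol, of cp1_inversion cp1_inversion] by (simp_all add: S_def k_def)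
  have 0: "0 \<in> S" "k 0 = 0" by (simp_all add: S_def k_def inf)
  have kh: "k w = inverse (h (inverse w))" "h (inverse w) \<noteq> 0" if "w \<in> S" "w \<noteq> 0" for w
    using that h[of "inverse w"] by (auto simp: S_def k_def)
  have injk: "inj_on k S"
  proof (rule inj_onI)
    fix u v assume uv: "u \<in> S" "v \<in> S" "k u = k v"
    then have "cp1_inversion (\<phi> (cp1_inversion (Some u))) = cp1_inversion (\<phi> (cp1_inversion (Some v)))"
      unfolding S_def k_def mem_Collect_eq by (metis option.collapse)
    then have "\<phi> (cp1_inversion (Some u)) = \<phi> (cp1_inversion (Some v))" by (metis cp1_inversion_simps(4))
    then have "cp1_inversion (Some u) = cp1_inversion (Some v)" using bij by (simp add: bij_def inj_eq)
    then show "u = v" by (metis cp1_inversion_simps(4) option.inject)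
  qed
  define c where "c = deriv k 0"
  have c: "c \<noteq> 0" unfolding c_def by (rule holomorphic_injective_imp_regular[OF S(2,1) injk 0(1)])
  have "((\<lambda>w. (k w - k 0) / (w - 0)) \<longlongrightarrow> c) (at 0)"
    using holomorphic_derivI[OF S(2,1) 0(1)] unfolding c_def has_field_derivative_iff by simp
  then have lim: "((\<lambda>w. k w / w) \<longlongrightarrow> c) (at 0)" by (simp add: 0)
  define q where "q = (\<lambda>z. if z = 0 then deriv h 0 else (h z - h 0) / (z - 0))"
  have "q holomorphic_on UNIV" unfolding q_def by (rule pole_lemma_open[OF holh open_UNIV])
  moreover have "(q \<longlongrightarrow> 1 / c) at_infinity"
  proof -
    have lim': "((\<lambda>w. inverse (k w / w) - h 0 * w) \<longlongrightarrow> inverse c - h 0 * 0) (at 0)"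
      by (intro tendsto_intros lim c)
    have "\<forall>\<^sub>F w in at 0. w \<in> S - {0}" by (rule eventually_at_in_open[OF S(1) 0(1)])
    then have "\<forall>\<^sub>F w in at 0. inverse (k w / w) - h 0 * w = q (inverse w)"
    proof eventually_elim
      case (elim w)
      then have w: "w \<in> S" "w \<noteq> 0" by auto
      have "inverse (k w / w) = h (inverse w) * w" using kh(1)[OF w] by (simp add: divide_inverse)
      moreover have "q (inverse w) = (h (inverse w) - h 0) * w" using w by (simp add: q_def divide_inverse)
      ultimately show ?case by (simp add: algebra_simps)
    qed
    from Lim_transform_eventually[OF lim' this]
    have "((\<lambda>w. q (inverse w)) \<longlongrightarrow> inverse c) (at 0)" by simp
    then show ?thesis by (simp add: lim_at_infinity_0 o_def inverse_eq_divide)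
  qed
  ultimately have q: "q z = 1 / c" for z by (rule Liouville_weak)
  have "h z = 1 / c * z + h 0" for z
    using q[of z] by (cases "z = 0") (auto simp: q_def field_simps)
  then have "\<phi> (Some z) = Some (1 / c * z + h 0)" for z
    unfolding h[of z] by (rule arg_cong)
  then show ?thesis using c by (intro exI[of _ "1 / c"] exI[of _ "h 0"]) simp
qed

section \<open>Normal forms as points of the stratum\<close>

definition normal_marked :: "('p::finite \<Rightarrow> nat) \<Rightarrow> complex ^ 'p \<Rightarrow> 'p marked_form" where
  "normal_marked b x = (normal_form b x, \<lambda>j. Some (x $ j))"

lemma normal_form_eq_0_iff:
  assumes "\<And>j. b j \<ge> 1"
  shows "normal_form b x z = 0 \<longleftrightarrow> (\<exists>j. z = x $ j)"
proof -
  have "0 < b j" for j using assms[of j] by simp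
  then show ?thesis by (auto simp: normal_form_def)
qed

text \<open>With z = 1 / w the denominator contributes w ^ (a + 2) and dz takes away w ^ 2, which
  leaves a zero of order a at infinity.\<close>

lemma coeff_at_infinity_normal_form:
  assumes "(\<Sum>j\<in>UNIV. b j) = a + 2" "w \<noteq> 0"
  shows "coeff_at_infinity (normal_form b x) w = - (1 / (\<Prod>j\<in>UNIV. (1 - x $ j * w) ^ b j)) * w ^ a"
proof -
  have "(\<Prod>j\<in>UNIV. (inverse w - x $ j) ^ b j) = (\<Prod>j\<in>UNIV. (1 - x $ j * w) ^ b j * inverse w ^ b j)"
    using assms(2) by (intro prod.cong refl) (simp add: field_simps flip: power_mult_distrib)
  also have "\<dots> = (\<Prod>j\<in>UNIV. (1 - x $ j * w) ^ b j) * inverse w ^ (a + 2)"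
    by (simp only: prod.distrib power_sum[symmetric] assms(1))
  also have "inverse w ^ (a + 2) = 1 / (w ^ a * w ^ 2)"
    by (simp add: power_add power_inverse divide_inverse power2_eq_square)
  finally have eq: "(\<Prod>j\<in>UNIV. (inverse w - x $ j) ^ b j) = (\<Prod>j\<in>UNIV. (1 - x $ j * w) ^ b j) * (1 / (w ^ a * w ^ 2))" .
  show ?thesis
    unfolding coeff_at_infinity_def normal_form_def eq using assms(2) by simp
qed

lemma form_order_normal_form:
  fixes x :: "complex ^ 'p::finite"
  assumes b: "\<And>j. b j \<ge> 1" and B: "(\<Sum>j\<in>UNIV. b j) = a + 2" and x: "x \<in> config"
  shows "form_order (normal_form b x) (Some (x $ j)) = - int (b j)"
    and "form_order (normal_form b x) None = int a"
    and "(\<And>j. z \<noteq> x $ j) \<Longrightarrow> form_order (normal_form b x) (Some z) = 0"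
proof -
  define S where "S = (\<lambda>j. - ((\<lambda>i. x $ i) ` (UNIV - {j})))"
  have S: "open (S j)" "x $ j \<in> S j" for j
  proof -
    show "open (S j)" unfolding S_def by (intro open_Compl finite_imp_closed) auto
    show "x $ j \<in> S j" unfolding S_def using x by (auto simp: config_def) metis
  qed
  have "zorder (normal_form b x) (x $ j) = - int (b j)"
  proof (rule zorder_eqI[OF S, of "\<lambda>z. 1 / (\<Prod>i\<in>UNIV - {j}. (z - x $ i) ^ b i)"])
    show "(\<lambda>z. 1 / (\<Prod>i\<in>UNIV - {j}. (z - x $ i) ^ b i)) holomorphic_on S j"
      by (auto intro!: holomorphic_intros simp: S_def)
    show "1 / (\<Prod>i\<in>UNIV - {j}. (x $ j - x $ i) ^ b i) \<noteq> 0" using x by (auto simp: config_def)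
    fix w assume "w \<in> S j" "w \<noteq> x $ j"
    have "(\<Prod>i\<in>UNIV. (w - x $ i) ^ b i) = (w - x $ j) ^ b j * (\<Prod>i\<in>UNIV - {j}. (w - x $ i) ^ b i)"
      by (rule prod.remove) auto
    then show "normal_form b x w = 1 / (\<Prod>i\<in>UNIV - {j}. (w - x $ i) ^ b i) * (w - x $ j) powi (- int (b j))"
      by (simp add: normal_form_def power_int_minus field_simps)
  qed
  then show "form_order (normal_form b x) (Some (x $ j)) = - int (b j)" by (simp add: form_order_def)
  let ?g = "\<lambda>w. - (1 / (\<Prod>j\<in>UNIV. (1 - x $ j * w) ^ b j))"
  define T where "T = {w. \<forall>j. 1 - x $ j * w \<noteq> 0}"
  have T: "open T" "0 \<in> T"
  proof -
    have "T = (\<Inter>j. {w. 1 - x $ j * w \<noteq> 0})" by (auto simp: T_def)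
    also have "open \<dots>" by (intro open_INT) (auto intro!: open_Collect_neq continuous_intros)
    finally show "open T" .
  qed (simp add: T_def)
  have "zorder (coeff_at_infinity (normal_form b x)) 0 = int a"
    by (rule zorder_eqI[OF T, of ?g])
       (auto intro!: holomorphic_intros simp: T_def coeff_at_infinity_normal_form[OF B])
  then show "form_order (normal_form b x) None = int a" by (simp add: form_order_def)
  show "form_order (normal_form b x) (Some z) = 0" if z: "\<And>j. z \<noteq> x $ j"
  proof -
    have "open (- range (($) x))" by (intro open_Compl finite_imp_closed) auto
    then have "zorder (normal_form b x) z = 0"
      by (rule zorder_eqI[of _ _ "normal_form b x"])
         (use z in \<open>auto intro!: holomorphic_normal_form simp: normal_form_eq_0_iff[of b, OF b]\<close>)
    then show ?thesis by (simp add: form_order_def)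
  qed
qed

lemma meromorphic_form_normal_form:
  assumes b: "\<And>j. b j \<ge> 1"
  shows "meromorphic_form (normal_form b x)"
proof -
  have mero: "normal_form b x meromorphic_on UNIV"
    unfolding normal_form_def by (intro meromorphic_intros)
  have "(is_pole (normal_form b x) z \<and> normal_form b x z = 0) \<or> normal_form b x \<midarrow>z\<rightarrow> normal_form b x z" for z
  proof (cases "\<exists>j. z = x $ j")
    case True
    have "(\<lambda>z. \<Prod>j\<in>UNIV. (z - x $ j) ^ b j) \<midarrow>z\<rightarrow> (\<Prod>j\<in>UNIV. (z - x $ j) ^ b j)"
      by (intro tendsto_intros)
    also have "(\<Prod>j\<in>UNIV. (z - x $ j) ^ b j) = 0"
    proof -
      obtain j where "z = x $ j" using True by blast
      then have "(z - x $ j) ^ b j = 0" using b[of j] by simp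
      then show ?thesis by (intro prod_zero) auto
    qed
    finally have "(\<lambda>z. \<Prod>j\<in>UNIV. (z - x $ j) ^ b j) \<midarrow>z\<rightarrow> 0" .
    moreover have "\<forall>\<^sub>F w in at z. (\<Prod>j\<in>UNIV. (w - x $ j) ^ b j) \<noteq> 0"
    proof -
      have "\<forall>\<^sub>F w in at z. w \<notin> range (($) x)"
        using islimpt_finite[of "range (($) x)" z] by (auto simp: islimpt_iff_eventually)
      then show ?thesis by eventually_elim auto
    qed
    ultimately have "filterlim (\<lambda>z. \<Prod>j\<in>UNIV. (z - x $ j) ^ b j) (at 0) (at z)"
      by (simp add: filterlim_at)
    then have "is_pole (normal_form b x) z"
      unfolding is_pole_def normal_form_def
      by (intro filterlim_compose[OF filterlim_inverse_at_infinity, unfolded inverse_eq_divide])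
    with True normal_form_eq_0_iff[of b, OF b] show ?thesis by blast
  next
    case False
    then have "normal_form b x \<midarrow>z\<rightarrow> normal_form b x z"
      unfolding normal_form_def by (intro tendsto_intros) auto
    then show ?thesis ..
  qed
  then have "normal_form b x nicely_meromorphic_on UNIV"
    using mero by (auto simp: nicely_meromorphic_on_def)
  moreover have "coeff_at_infinity (normal_form b x) meromorphic_on {0}"
    unfolding coeff_at_infinity_def normal_form_def by (intro meromorphic_intros)
  ultimately show ?thesis by (simp add: meromorphic_form_def)
qed

lemma normal_marked_in_marked_forms:
  fixes x :: "complex ^ 'p::finite"
  assumes b: "\<And>j. b j \<ge> 1" and B: "(\<Sum>j\<in>UNIV. b j) = a + 2" and x: "x \<in> config"
  shows "normal_marked b x \<in> marked_forms a b"
proof -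
  note order = form_order_normal_form[OF b B x]
  obtain z where "z \<notin> range (($) x)" using ex_new_if_finite[OF infinite_UNIV_char_0, of "range (($) x)"] by auto
  then have "normal_form b x z \<noteq> 0" by (auto simp: normal_form_eq_0_iff[of b, OF b])
  then have ne: "normal_form b x \<noteq> (\<lambda>_. 0)" by auto
  have "inj (\<lambda>j. Some (x $ j))" using x by (auto simp: inj_def config_def)
  moreover have "form_order (normal_form b x) P = 0" if "P \<notin> insert None (range (\<lambda>j. Some (x $ j)))" for P
    using that order(3) by (cases P) auto
  ultimately show ?thesis
    unfolding normal_marked_def marked_forms_def
    using order(1,2) ne meromorphic_form_normal_form[of b, OF b]
    by (auto intro!: exI[of _ None])
qed

section \<open>Local behaviour of marked forms; isomorphism as an equivalence relation\<close>

lemma marked_form_nonzero_near: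
  assumes "(f, x) \<in> marked_forms a b"
  shows "\<forall>\<^sub>F w in at z. f w \<noteq> 0"
proof -
  have f: "f nicely_meromorphic_on UNIV" "f \<noteq> (\<lambda>_. 0)"
    using assms by (auto simp: marked_forms_def meromorphic_form_def)
  then have "\<forall>\<^sub>F w in cosparse UNIV. f w \<noteq> 0"
    using nicely_meromorphic_imp_constant_or_avoid[OF f(1), of 0] by auto
  then show ?thesis by (simp add: eventually_cosparse_open_eq)
qed

lemma marked_form_local:
  assumes m: "(f, x) \<in> marked_forms a b"
  shows "\<exists>g r. r > 0 \<and> g holomorphic_on cball z r \<and> g z \<noteq> 0 \<and>
    (\<forall>w\<in>cball z r - {z}. f w = g w * (w - z) powi form_order f (Some z))"
proof -
  have "f meromorphic_on {z}"
    using m by (auto simp: marked_forms_def meromorphic_form_def nicely_meromorphic_on_def intro: meromorphic_on_subset)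
  moreover have "\<exists>\<^sub>F w in at z. f w \<noteq> 0"
    using marked_form_nonzero_near[OF m, of z] by (intro eventually_frequently) auto
  ultimately have "zor_poly f z z \<noteq> 0 \<and> (\<exists>r>0. zor_poly f z holomorphic_on cball z r \<and>
      (\<forall>w\<in>cball z r - {z}. f w = zor_poly f z w * (w - z) powi (zorder f z) \<and> zor_poly f z w \<noteq> 0))"
    by (intro zorder_exist) (simp_all add: meromorphic_at_iff)
  then show ?thesis by (auto simp: form_order_def)
qed

text \<open>Together with limits this determines f at every point from its values nearby, so
  identities known off a finite set extend to all points.\<close>

lemma marked_form_value:
  assumes m: "(f, x) \<in> marked_forms a b" and b: "\<And>j. b j \<ge> 1"
  shows "Some z \<in> range x \<Longrightarrow> f z = 0" "Some z \<notin> range x \<Longrightarrow> isCont f z"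
proof -
  have nice: "(is_pole f z \<and> f z = 0) \<or> f \<midarrow>z\<rightarrow> f z"
    using m by (auto simp: marked_forms_def meromorphic_form_def nicely_meromorphic_on_def)
  obtain g r where g: "r > 0" "g holomorphic_on cball z r" "g z \<noteq> 0"
    "\<forall>w\<in>cball z r - {z}. f w = g w * (w - z) powi form_order f (Some z)"
    using marked_form_local[OF m, of z] by blast
  have "continuous_on (ball z r) g"
    by (rule continuous_on_subset[OF holomorphic_on_imp_continuous_on[OF g(2)]]) auto
  then have cont: "isCont g z" using g(1) by (simp add: continuous_on_eq_continuous_at)
  have ev: "\<forall>\<^sub>F w in at z. w \<in> cball z r - {z}"
  proof -
    have "\<forall>\<^sub>F w in at z. w \<in> ball z r - {z}" by (rule eventually_at_in_open) (use g(1) in auto)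
    then show ?thesis by (rule eventually_mono) auto
  qed
  have mero: "f meromorphic_on {z}"
    using m by (auto simp: marked_forms_def meromorphic_form_def nicely_meromorphic_on_def intro: meromorphic_on_subset)
  show "f z = 0" if "Some z \<in> range x"
  proof -
    obtain j where "x j = Some z" using \<open>Some z \<in> range x\<close> by auto
    moreover have "form_order f (x j) = - int (b j)" using m by (auto simp: marked_forms_def)
    ultimately have "form_order f (Some z) < 0" using b[of j] by simp
    then have "zorder f z < 0" by (simp add: form_order_def)
    then have "is_pole f z"
      using mero marked_form_nonzero_near[OF m, of z]
      by (intro neg_zorder_imp_is_pole) (auto simp: meromorphic_at_iff intro!: eventually_frequently)
    then have "\<not> f \<midarrow>z\<rightarrow> f z" unfolding is_pole_def using not_tendsto_and_filterlim_at_infinity trivial_limit_at by blast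
    with nice show "f z = 0" by blast
  qed
  show "isCont f z" if "Some z \<notin> range x"
  proof -
    have nn: "form_order f (Some z) \<ge> 0"
      using m that by (auto simp: marked_forms_def) (metis insert_iff of_nat_0_le_iff order_refl)
    have "(\<lambda>w. g w * (w - z) ^ nat (form_order f (Some z))) \<midarrow>z\<rightarrow> g z * (z - z) ^ nat (form_order f (Some z))"
      using cont by (intro tendsto_intros) (simp add: isCont_def)
    then have "f \<midarrow>z\<rightarrow> g z * (z - z) ^ nat (form_order f (Some z))"
      by (rule Lim_transform_eventually) (use ev g(4) nn in \<open>auto elim!: eventually_mono simp: power_int_def\<close>)
    then have "\<not> is_pole f z" unfolding is_pole_def using not_tendsto_and_filterlim_at_infinity trivial_limit_at by blast
    with nice show ?thesis by (simp add: isCont_def)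
  qed
qed

lemma form_iso_refl: "m \<in> marked_forms a b \<Longrightarrow> (m, m) \<in> form_iso a b"
proof -
  assume m: "m \<in> marked_forms a b"
  have dom: "{z. \<tau> (\<sigma> (Some z)) \<noteq> None} = (if \<sigma> = \<tau> then UNIV else - {0})"
      "\<And>z. \<tau> (\<sigma> (Some z)) \<noteq> None \<Longrightarrow> the (\<tau> (\<sigma> (Some z))) = (if \<sigma> = \<tau> then z else inverse z)"
    if "\<sigma> \<in> {id, cp1_inversion}" "\<tau> \<in> {id, cp1_inversion}" for \<sigma> \<tau>
  proof -
    have ne: "id \<noteq> cp1_inversion" by (metis cp1_inversion_simps(1) id_apply option.distinct(1))
    show "{z. \<tau> (\<sigma> (Some z)) \<noteq> None} = (if \<sigma> = \<tau> then UNIV else - {0})" using that ne by auto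
    show "the (\<tau> (\<sigma> (Some z))) = (if \<sigma> = \<tau> then z else inverse z)" if "\<tau> (\<sigma> (Some z)) \<noteq> None" for z
      using that \<open>\<sigma> \<in> {id, cp1_inversion}\<close> \<open>\<tau> \<in> {id, cp1_inversion}\<close> ne by (cases "z = 0") auto
  qed
  have "cp1_holomorphic id"
    unfolding cp1_holomorphic_def
  proof (intro ballI conjI)
    fix \<sigma> \<tau> :: "cp1 \<Rightarrow> cp1" assume st: "\<sigma> \<in> {id, cp1_inversion}" "\<tau> \<in> {id, cp1_inversion}"
    show "open {z. \<tau> (id (\<sigma> (Some z))) \<noteq> None}" using dom(1)[OF st] by (auto simp: open_Compl)
    have "(\<lambda>z. if \<sigma> = \<tau> then z else inverse z) holomorphic_on {z. \<tau> (\<sigma> (Some z)) \<noteq> None}"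
      unfolding dom(1)[OF st] by (auto intro!: holomorphic_intros)
    then show "(\<lambda>z. the (\<tau> (id (\<sigma> (Some z))))) holomorphic_on {z. \<tau> (id (\<sigma> (Some z))) \<noteq> None}"
      by (simp only: id_apply) (rule holomorphic_transform, use dom(2)[OF st] in simp_all)
  qed
  then have "cp1_biholomorphic id" by (simp add: cp1_biholomorphic_def)
  moreover have "deriv (\<lambda>t. the (id (Some t))) z = 1" for z :: complex by simp
  ultimately show ?thesis using m unfolding form_iso_def by (cases m) (auto intro!: exI[of _ id])
qed

lemma form_iso_sym: "(m, n) \<in> form_iso a b \<Longrightarrow> (n, m) \<in> form_iso a b"
proof -
  assume mn: "(m, n) \<in> form_iso a b"
  obtain f x where m: "m = (f, x)" by (cases m)
  obtain g y where n: "n = (g, y)" by (cases n)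
  from mn obtain \<phi> where in_m: "(f, x) \<in> marked_forms a b" and in_n: "(g, y) \<in> marked_forms a b"
    and \<phi>: "cp1_biholomorphic \<phi>" "\<forall>j. \<phi> (x j) = y j"
    and eq: "\<forall>z u. \<phi> (Some z) = Some u \<longrightarrow> f z = g u * deriv (\<lambda>t. the (\<phi> (Some t))) z"
    unfolding m n form_iso_def by auto
  have bij: "bij \<phi>" and hol: "cp1_holomorphic \<phi>" "cp1_holomorphic (inv \<phi>)"
    using \<phi>(1) by (auto simp: cp1_biholomorphic_def)
  have lab: "inv \<phi> (y j) = x j" for j using \<phi>(2) bij by (metis bij_inv_eq_iff)
  have "g u = f z * deriv (\<lambda>t. the (inv \<phi> (Some t))) u" if zu: "inv \<phi> (Some u) = Some z" for u z
  proof -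
    have \<phi>z: "\<phi> (Some z) = Some u" using zu bij by (metis bij_inv_eq_iff)
    let ?H = "\<lambda>t. the (\<phi> (Some t))" and ?K = "\<lambda>t. the (inv \<phi> (Some t))"
    define A where "A = {t. \<phi> (Some t) \<noteq> None}"
    define B where "B = {t. inv \<phi> (Some t) \<noteq> None}"
    have A: "open A" "?H holomorphic_on A" using cp1_holomorphicD[OF hol(1), of id id] by (simp_all add: A_def)
    have B: "open B" "?K holomorphic_on B" using cp1_holomorphicD[OF hol(2), of id id] by (simp_all add: B_def)
    have in_AB: "z \<in> A" "u \<in> B" using \<phi>z zu by (simp_all add: A_def B_def)
    have KH: "(?K \<circ> ?H) t = t" if "t \<in> A" for t
      using that bij by (auto simp: A_def bij_is_inj inv_f_f)
    have "((?K \<circ> ?H) has_field_derivative deriv ?K (?H z) * deriv ?H z) (at z)"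
      using holomorphic_derivI[OF A(2,1) in_AB(1)] holomorphic_derivI[OF B(2,1) in_AB(2)] \<phi>z
      by (intro DERIV_chain) simp_all
    moreover have "((?K \<circ> ?H) has_field_derivative 1) (at z)"
      by (rule has_field_derivative_transform_within_open[OF DERIV_ident A(1) in_AB(1)]) (rule KH[symmetric])
    ultimately have "deriv ?K u * deriv ?H z = 1" using DERIV_unique \<phi>z by fastforce
    moreover have "f z = g u * deriv ?H z" using eq \<phi>z by blast
    ultimately show ?thesis by (simp add: mult.assoc mult.commute)
  qed
  then show ?thesis
    using in_m in_n cp1_biholomorphic_inv[OF \<phi>(1)] lab unfolding m n form_iso_def by auto
qed

text \<open>The chain rule proves the formula wherever \<phi> is finite. The one remaining point may
  go to infinity and on to a finite v; there both sides are 0 at a pole, and otherwise the formula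
  follows by continuity.\<close>

lemma form_iso_trans:
  assumes mn: "(m, n) \<in> form_iso a b" and nl: "(n, l) \<in> form_iso a b" and b: "\<And>j. b j \<ge> 1"
  shows "(m, l) \<in> form_iso a b"
proof -
  obtain f x where m: "m = (f, x)" by (cases m)
  obtain g y where n: "n = (g, y)" by (cases n)
  obtain h w where l: "l = (h, w)" by (cases l)
  from mn obtain \<phi> where in_m: "(f, x) \<in> marked_forms a b"
    and \<phi>: "cp1_biholomorphic \<phi>" "\<forall>j. \<phi> (x j) = y j"
    and eq1: "\<forall>z u. \<phi> (Some z) = Some u \<longrightarrow> f z = g u * deriv (\<lambda>t. the (\<phi> (Some t))) z"
    unfolding m n form_iso_def by auto
  from nl obtain \<psi> where in_l: "(h, w) \<in> marked_forms a b"
    and \<psi>: "cp1_biholomorphic \<psi>" "\<forall>j. \<psi> (y j) = w j"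
    and eq2: "\<forall>z u. \<psi> (Some z) = Some u \<longrightarrow> g z = h u * deriv (\<lambda>t. the (\<psi> (Some t))) z"
    unfolding n l form_iso_def by auto
  let ?\<chi> = "\<psi> \<circ> \<phi>"
  have \<chi>: "cp1_biholomorphic ?\<chi>" by (rule cp1_biholomorphic_compose[OF \<phi>(1) \<psi>(1)])
  have bij: "bij \<phi>" "bij ?\<chi>" using \<phi>(1) \<chi> by (auto simp: cp1_biholomorphic_def)
  have hol: "cp1_holomorphic \<phi>" "cp1_holomorphic \<psi>" "cp1_holomorphic ?\<chi>"
    using \<phi>(1) \<psi>(1) \<chi> by (auto simp: cp1_biholomorphic_def)
  let ?X = "\<lambda>t. the (?\<chi> (Some t))" and ?H = "\<lambda>t. the (\<phi> (Some t))" and ?K = "\<lambda>t. the (\<psi> (Some t))"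
  define A where "A = {t. \<phi> (Some t) \<noteq> None}"
  define B where "B = {t. \<psi> (Some t) \<noteq> None}"
  define D where "D = {t. ?\<chi> (Some t) \<noteq> None}"
  have A: "open A" "?H holomorphic_on A" using cp1_holomorphicD[OF hol(1), of id id] by (simp_all add: A_def)
  have B: "open B" "?K holomorphic_on B" using cp1_holomorphicD[OF hol(2), of id id] by (simp_all add: B_def)
  have D: "open D" "?X holomorphic_on D" using cp1_holomorphicD[OF hol(3), of id id] by (simp_all add: D_def)
  have regular: "f z = h v * deriv ?X z" if zv: "?\<chi> (Some z) = Some v" and z: "z \<in> A" for z v
  proof -
    obtain u where u: "\<phi> (Some z) = Some u" using z by (auto simp: A_def)
    then have v: "\<psi> (Some u) = Some v" using zv by simp
    have in_AB: "u \<in> B" using v by (simp add: B_def)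
    have "((?K \<circ> ?H) has_field_derivative deriv ?K (?H z) * deriv ?H z) (at z)"
      using holomorphic_derivI[OF A(2,1) z] holomorphic_derivI[OF B(2,1) in_AB] u
      by (intro DERIV_chain) simp_all
    then have "(?X has_field_derivative deriv ?K u * deriv ?H z) (at z)"
      using u by (elim has_field_derivative_transform_within_open[OF _ A(1) z, THEN DERIV_cong]) (auto simp: A_def)
    then have "deriv ?X z = deriv ?K u * deriv ?H z" by (rule DERIV_imp_deriv)
    moreover have "f z = g u * deriv ?H z" "g u = h v * deriv ?K u" using eq1 eq2 u v by blast+
    ultimately show ?thesis by simp
  qed
  have "f z = h v * deriv ?X z" if zv: "?\<chi> (Some z) = Some v" for z v
  proof (cases "z \<in> A")
    case True
    with regular zv show ?thesis by blast
  next
    case False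
    have lab: "?\<chi> (x j) = w j" for j using \<phi>(2) \<psi>(2) by simp
    have iff: "Some z \<in> range x \<longleftrightarrow> Some v \<in> range w"
    proof -
      have "Some z = x j \<longleftrightarrow> Some v = w j" for j
        using lab[of j] zv bij(2) by (metis bij_def inj_eq)
      then show ?thesis by auto
    qed
    show ?thesis
    proof (cases "Some z \<in> range x")
      case True
      then show ?thesis using marked_form_value(1)[OF in_m b] marked_form_value(1)[OF in_l b] iff by simp
    next
      case notpole: False
      have zD: "z \<in> D" using zv by (simp add: D_def)
      have Xz: "?X z = v" using zv by simp
      have "?X \<midarrow>z\<rightarrow> v"
        using holomorphic_on_imp_continuous_on[OF D(2)] D(1) zD Xz
        by (metis continuous_on_eq_continuous_at isCont_def)
      moreover have "isCont h v" using marked_form_value(2)[OF in_l b] notpole iff by simp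
      ultimately have "(\<lambda>t. h (?X t)) \<midarrow>z\<rightarrow> h v" by (rule isCont_tendsto_compose[rotated])
      moreover have "deriv ?X \<midarrow>z\<rightarrow> deriv ?X z"
        using holomorphic_on_imp_continuous_on[OF holomorphic_deriv[OF D(2,1)]] D(1) zD
        by (metis continuous_on_eq_continuous_at isCont_def)
      ultimately have "(\<lambda>t. h (?X t) * deriv ?X t) \<midarrow>z\<rightarrow> h v * deriv ?X z" by (rule tendsto_mult)
      moreover have "\<forall>\<^sub>F t in at z. h (?X t) * deriv ?X t = f t"
      proof -
        have "\<forall>\<^sub>F t in at z. t \<in> D - {z}" by (rule eventually_at_in_open[OF D(1) zD])
        then show ?thesis
        proof eventually_elim
          case (elim t)
          have "\<phi> (Some z) = None" using False by (simp add: A_def)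
          then have "\<phi> (Some t) \<noteq> None" using elim bij(1) by (metis DiffD2 bij_def inj_eq option.inject singletonI)
          then have "t \<in> A" by (simp add: A_def)
          moreover have "?\<chi> (Some t) = Some (?X t)" using elim by (auto simp: D_def)
          ultimately show ?case using regular by simp
        qed
      qed
      ultimately have "f \<midarrow>z\<rightarrow> h v * deriv ?X z" by (rule Lim_transform_eventually)
      moreover have "f \<midarrow>z\<rightarrow> f z" using marked_form_value(2)[OF in_m b notpole] by (simp add: isCont_def)
      ultimately show ?thesis using LIM_unique by blast
    qed
  qed
  then show ?thesis
    using in_m in_l \<chi> \<phi>(2) \<psi>(2) unfolding m l form_iso_def by auto
qed

lemma equiv_form_iso:
  assumes "\<And>j. b j \<ge> 1"
  shows "equiv (marked_forms a b) (form_iso a b)"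
proof (rule equivI)
  show "form_iso a b \<subseteq> marked_forms a b \<times> marked_forms a b" by (auto simp: form_iso_def)
  show "refl_on (marked_forms a b) (form_iso a b)" by (rule refl_onI) (rule form_iso_refl)
  show "sym (form_iso a b)" by (rule symI) (rule form_iso_sym)
  show "trans (form_iso a b)" by (rule transI) (rule form_iso_trans[OF _ _ assms])
qed

text \<open>
  If \<open>\<phi>\<close> moved infinity, then the form on the left would vanish at the finite preimage of infinity,
  while the only zero of a normal form is at infinity.
\<close>

lemma normal_marked_iso_affine:
  fixes x y :: "complex ^ 'p::finite"
  assumes iso: "(normal_marked b x, normal_marked b y) \<in> form_iso a b"
    and b: "\<And>j. b j \<ge> 1" and B: "(\<Sum>j\<in>UNIV. b j) = a + 2" and a: "a \<ge> 1"
  shows "\<exists>\<alpha> \<beta>. \<alpha> \<noteq> 0 \<and> (\<forall>j. y $ j = \<alpha> * x $ j + \<beta>)"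
proof -
  from iso obtain \<phi> where \<phi>: "cp1_biholomorphic \<phi>" "\<forall>j. \<phi> (Some (x $ j)) = Some (y $ j)"
    and eq: "\<forall>z u. \<phi> (Some z) = Some u \<longrightarrow> normal_form b x z = normal_form b y u * deriv (\<lambda>t. the (\<phi> (Some t))) z"
    unfolding normal_marked_def form_iso_def by auto
  have "\<phi> None = None"
  proof (rule ccontr)
    assume "\<phi> None \<noteq> None"
    moreover obtain P where P: "\<phi> P = None" using \<phi>(1) unfolding cp1_biholomorphic_def by (metis bij_pointE)
    ultimately obtain z0 where z0: "\<phi> (Some z0) = None" by (cases P) auto
    obtain S h where S: "open S" "z0 \<in> S" "h holomorphic_on S" "inj_on h S" "h z0 = local_coord (\<phi> (Some z0))"
      "\<forall>z\<in>S. z \<noteq> z0 \<longrightarrow> normal_form b x z = local_coeff (normal_form b y) (\<phi> (Some z0)) (h z) * deriv h z"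
      using form_iso_local[OF \<phi>(1) eq, of z0] by (elim exE conjE)
    have h0: "h z0 = 0" using S(5) z0 by simp
    have conth: "h \<midarrow>z0\<rightarrow> 0"
      using holomorphic_on_imp_continuous_on[OF S(3)] S(1,2) h0 by (metis continuous_on_eq_continuous_at isCont_def)
    have contd: "deriv h \<midarrow>z0\<rightarrow> deriv h z0"
      using holomorphic_on_imp_continuous_on[OF holomorphic_deriv[OF S(3,1)]] S(1,2)
      by (metis continuous_on_eq_continuous_at isCont_def)
    have "(\<lambda>z. - (1 / (\<Prod>j\<in>UNIV. (1 - y $ j * h z) ^ b j)) * h z ^ a * deriv h z) \<midarrow>z0\<rightarrow>
        - (1 / (\<Prod>j\<in>UNIV. (1 - y $ j * 0) ^ b j)) * 0 ^ a * deriv h z0"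
      by (intro tendsto_intros conth contd) simp
    moreover have "\<forall>\<^sub>F z in at z0. - (1 / (\<Prod>j\<in>UNIV. (1 - y $ j * h z) ^ b j)) * h z ^ a * deriv h z = normal_form b x z"
    proof -
      have "\<forall>\<^sub>F z in at z0. z \<in> S - {z0}" by (rule eventually_at_in_open[OF S(1,2)])
      then show ?thesis
      proof eventually_elim
        case (elim z)
        then have "h z \<noteq> 0" using S(2,4) h0 by (metis DiffD1 DiffD2 inj_onD singletonI)
        then show ?case
          using S(6) elim z0 coeff_at_infinity_normal_form[OF B] by (simp add: local_coeff_def)
      qed
    qed
    ultimately have "normal_form b x \<midarrow>z0\<rightarrow> 0"
      using a Lim_transform_eventually by (fastforce simp: power_0_left)
    moreover have np: "z0 \<noteq> x $ j" for j using \<phi>(2) z0 by auto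
    then have "normal_form b x \<midarrow>z0\<rightarrow> normal_form b x z0"
      unfolding normal_form_def by (intro tendsto_intros) auto
    ultimately have "normal_form b x z0 = 0" using LIM_unique by blast
    then show False using np normal_form_eq_0_iff[of b x z0, OF b] by blast
  qed
  then obtain \<alpha> \<beta> where "\<alpha> \<noteq> 0" "\<forall>z. \<phi> (Some z) = Some (\<alpha> * z + \<beta>)"
    using cp1_automorphism_affine[OF \<phi>(1)] by blast
  moreover from this \<phi>(2) have "y $ j = \<alpha> * x $ j + \<beta>" for j by (metis option.inject)
  ultimately show ?thesis by blast
qed

section \<open>Reduction of every form to a normal form\<close>

definition pole_product :: "('p::finite \<Rightarrow> nat) \<Rightarrow> ('p \<Rightarrow> cp1) \<Rightarrow> complex \<Rightarrow> complex" where
  "pole_product b x z = (\<Prod>j\<in>{j. x j \<noteq> None}. (z - the (x j)) ^ b j)"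

definition zero_factor :: "nat \<Rightarrow> cp1 \<Rightarrow> complex \<Rightarrow> complex" where
  "zero_factor a P z = (case P of None \<Rightarrow> 1 | Some \<zeta> \<Rightarrow> (z - \<zeta>) ^ a)"

lemma marked_formsD:
  assumes "(f, x) \<in> marked_forms a b"
  shows "meromorphic_form f" "f \<noteq> (\<lambda>_. 0)" "inj x" "\<And>j. form_order f (x j) = - int (b j)"
    "\<exists>z0. z0 \<notin> range x \<and> form_order f z0 = int a \<and> (\<forall>P. P \<notin> insert z0 (range x) \<longrightarrow> form_order f P = 0)"
  using assms unfolding marked_forms_def by blast+

text \<open>The exponent exceeds the order at infinity by 2 because \<open>coeff_at_infinity\<close>
  divides f (1 / w) by w ^ 2.\<close>

lemma form_coeff_at_infinity_near:
  assumes m: "(f, x) \<in> marked_forms a b"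
  shows "\<exists>g r. r > 0 \<and> g holomorphic_on cball 0 r \<and> g 0 \<noteq> 0 \<and>
    (\<forall>w\<in>cball 0 r - {0}. f (inverse w) = - g w * w powi (form_order f None + 2))"
proof -
  obtain h where Lh: "h = coeff_at_infinity f" by blast
  have mero: "h meromorphic_on {0}" using marked_formsD(1)[OF m] by (simp add: meromorphic_form_def Lh)
  have f: "f nicely_meromorphic_on UNIV" using marked_formsD(1)[OF m] by (simp add: meromorphic_form_def)
  have "\<exists>\<^sub>F w in at 0. h w \<noteq> 0"
  proof (rule ccontr)
    assume "\<not> ?thesis"
    then have "\<forall>\<^sub>F w in at 0. h w = 0" by (simp add: not_frequently)
    then obtain d where d: "d > 0" "\<And>w. w \<noteq> 0 \<Longrightarrow> dist w 0 < d \<Longrightarrow> h w = 0"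
      unfolding eventually_at by auto
    define w where "w = complex_of_real (d / 2)"
    have w: "w \<noteq> 0" "norm w < d" using d by (auto simp: w_def)
    have "\<forall>\<^sub>F t in at (inverse w). f t = 0"
    proof -
      have "open {t :: complex. t \<noteq> 0 \<and> 1 < norm t * d}"
        by (intro open_Collect_conj open_Collect_neq open_Collect_less continuous_intros)
      moreover have "inverse w \<in> {t. t \<noteq> 0 \<and> 1 < norm t * d}"
      proof -
        have "norm w > 0" using w(1) by simp
        then have "1 < inverse (norm w) * d" using w(2) by (simp add: field_simps)
        then show ?thesis using w(1) by (simp add: norm_inverse)
      qed
      ultimately have "\<forall>\<^sub>F t in at (inverse w). t \<in> {t. t \<noteq> 0 \<and> 1 < norm t * d} - {inverse w}"
        by (rule eventually_at_in_open)
      then show ?thesis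
      proof eventually_elim
        case (elim t)
        then have t: "t \<noteq> 0" "1 < norm t * d" by auto
        have "norm t > 0" using t(1) by simp
        then have "inverse (norm t) < d" using t(2) by (simp add: field_simps)
        then have "norm (inverse t) < d" by (simp only: norm_inverse)
        then have "h (inverse t) = 0" using d(2)[of "inverse t"] t(1) by simp
        with t(1) show ?case by (simp add: Lh coeff_at_infinity_def)
      qed
    qed
    then have "\<forall>\<^sub>F t in at (inverse w). False"
      using marked_form_nonzero_near[OF m, of "inverse w"] by eventually_elim simp
    then show False by simp
  qed
  then have "zor_poly h 0 0 \<noteq> 0 \<and> (\<exists>r>0. zor_poly h 0 holomorphic_on cball 0 r \<and>
      (\<forall>w\<in>cball 0 r - {0}. h w = zor_poly h 0 w * (w - 0) powi (zorder h 0) \<and> zor_poly h 0 w \<noteq> 0))"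
    using mero by (intro zorder_exist) (simp_all add: meromorphic_at_iff)
  then obtain r where r: "zor_poly h 0 0 \<noteq> 0" "r > 0" "zor_poly h 0 holomorphic_on cball 0 r"
      "\<And>w. w \<in> cball 0 r - {0} \<Longrightarrow> h w = zor_poly h 0 w * w powi (zorder h 0)"
    by auto
  have "f (inverse w) = - zor_poly h 0 w * w powi (form_order f None + 2)" if w: "w \<in> cball 0 r - {0}" for w
  proof -
    have "w \<noteq> 0" using w by simp
    have "f (inverse w) = - h w * w ^ 2" using \<open>w \<noteq> 0\<close> by (simp add: Lh coeff_at_infinity_def)
    also have "\<dots> = - zor_poly h 0 w * (w powi zorder h 0 * w powi 2)" using r(4)[OF w] by simp
    also have "w powi zorder h 0 * w powi 2 = w powi (zorder h 0 + 2)" using \<open>w \<noteq> 0\<close> by (simp add: power_int_add)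
    finally show ?thesis by (simp add: form_order_def Lh)
  qed
  with r show ?thesis by blast
qed

text \<open>Multiplying f by its expected denominator and dividing by its expected numerator removes
  all zeros and poles. The quotient q extends to an entire function with a finite limit at infinity,
  so it is constant by Liouville.\<close>

lemma marked_form_explicit:
  fixes b :: "'p::finite \<Rightarrow> nat"
  assumes m: "(f, x) \<in> marked_forms a b" and b: "\<And>j. b j \<ge> 1" and B: "(\<Sum>j\<in>UNIV. b j) = a + 2"
    and z0: "z0 \<notin> range x" "form_order f z0 = int a" "\<forall>P. P \<notin> insert z0 (range x) \<longrightarrow> form_order f P = 0"
  shows "\<exists>L. L \<noteq> 0 \<and> (\<forall>z. f z = L * zero_factor a z0 z / pole_product b x z)"
proof -
  let ?D = "pole_product b x" and ?N = "zero_factor a z0"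
  define J where "J = {j. x j \<noteq> None}"
  define p where "p = (\<lambda>j. the (x j))"
  have D: "?D z = (\<Prod>j\<in>J. (z - p j) ^ b j)" for z by (simp add: pole_product_def J_def p_def)
  have xp: "x j = Some (p j)" if "j \<in> J" for j using that by (auto simp: J_def p_def)
  have inj: "inj x" by (rule marked_formsD(3)[OF m])
  define W where "W = {z. Some z \<in> insert z0 (range x)}"
  have "W \<subseteq> the ` (insert z0 (range x))"
  proof
    fix z assume "z \<in> W"
    then show "z \<in> the ` (insert z0 (range x))" unfolding W_def by (metis imageI mem_Collect_eq option.sel)
  qed
  then have finW: "finite W" by (rule finite_subset) simp
  have Dnz: "?D z \<noteq> 0" if "Some z \<notin> range x" for z
    using that xp by (auto simp: D) (metis rangeI)
  have Nnz: "?N z \<noteq> 0" if "Some z \<noteq> z0" for z using that by (auto simp: zero_factor_def split: option.splits)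
  have contD: "?D \<midarrow>z\<rightarrow> ?D z" for z unfolding D by (intro tendsto_intros)
  have contN: "?N \<midarrow>z\<rightarrow> ?N z" for z
    unfolding zero_factor_def by (cases z0) (auto intro!: tendsto_intros)
  define q where "q = (\<lambda>z. f z * ?D z / ?N z)"
  have lim: "\<exists>c. q \<midarrow>z\<rightarrow> c" for z
  proof -
    obtain g r where g: "r > 0" "g holomorphic_on cball z r" "g z \<noteq> 0"
      "\<forall>w\<in>cball z r - {z}. f w = g w * (w - z) powi form_order f (Some z)"
      using marked_form_local[OF m, of z] by blast
    have "continuous_on (ball z r) g"
      by (rule continuous_on_subset[OF holomorphic_on_imp_continuous_on[OF g(2)]]) auto
    then have "isCont g z" using g(1) by (simp add: continuous_on_eq_continuous_at)
    then have contg: "g \<midarrow>z\<rightarrow> g z" by (simp add: isCont_def)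
    have "\<forall>\<^sub>F w in at z. w \<in> ball z r - {z}" by (rule eventually_at_in_open) (use g(1) in auto)
    then have ev: "\<forall>\<^sub>F w in at z. w \<noteq> z \<and> f w = g w * (w - z) powi form_order f (Some z)"
      by (rule eventually_mono) (use g(4) in auto)
    consider j where "Some z = x j" | "Some z = z0" | "Some z \<notin> insert z0 (range x)" by auto
    then show ?thesis
    proof cases
      case 1
      then have "x j = Some z" by simp
      then have j: "j \<in> J" "p j = z" by (simp_all add: J_def p_def)
      have ord: "form_order f (Some z) = - int (b j)" using marked_formsD(4)[OF m, of j] 1 by simp
      have zz: "Some z \<noteq> z0" using z0(1) 1 by auto
      let ?D1 = "\<lambda>w. \<Prod>i\<in>J - {j}. (w - p i) ^ b i"
      have DD: "?D w = (w - z) ^ b j * ?D1 w" for w unfolding D using j by (subst prod.remove[of J j]) auto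
      have "(\<lambda>w. g w * ?D1 w / ?N w) \<midarrow>z\<rightarrow> g z * ?D1 z / ?N z"
        by (intro tendsto_divide tendsto_mult contg contN Nnz zz tendsto_intros)
      moreover have "\<forall>\<^sub>F w in at z. g w * ?D1 w / ?N w = q w"
        using ev by (rule eventually_mono) (auto simp: q_def DD ord power_int_minus field_simps)
      ultimately show ?thesis using Lim_transform_eventually by blast
    next
      case 2
      have NN: "?N w = (w - z) ^ a" for w by (simp add: zero_factor_def flip: 2)
      have "(\<lambda>w. g w * ?D w) \<midarrow>z\<rightarrow> g z * ?D z" by (intro tendsto_mult contg contD)
      moreover have "\<forall>\<^sub>F w in at z. g w * ?D w = q w"
        using ev by (rule eventually_mono) (use 2 z0(2) in \<open>auto simp: q_def NN\<close>)
      ultimately show ?thesis using Lim_transform_eventually by blast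
    next
      case 3
      have "(\<lambda>w. g w * ?D w / ?N w) \<midarrow>z\<rightarrow> g z * ?D z / ?N z"
        by (intro tendsto_divide tendsto_mult contg contD contN Nnz) (use 3 in auto)
      moreover have "\<forall>\<^sub>F w in at z. g w * ?D w / ?N w = q w"
        using ev by (rule eventually_mono) (use 3 z0(3) in \<open>auto simp: q_def\<close>)
      ultimately show ?thesis using Lim_transform_eventually by blast
    qed
  qed
  have f_mero: "f meromorphic_on UNIV"
    using marked_formsD(1)[OF m] by (auto simp: meromorphic_form_def nicely_meromorphic_on_def)
  have "q meromorphic_on UNIV"
    unfolding q_def D zero_factor_def by (cases z0) (auto intro!: meromorphic_intros f_mero)
  then have qz: "q meromorphic_on {z}" for z by (rule meromorphic_on_subset) auto
  have "remove_sings q analytic_on {z}" for z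
    using lim[of z] qz[of z] by (auto simp: meromorphic_at_iff intro: remove_sings_analytic_at)
  then have hol: "remove_sings q holomorphic_on UNIV"
    by (meson analytic_imp_holomorphic analytic_on_analytic_at)
  have rq: "remove_sings q z = q z" if "z \<notin> W" for z
  proof -
    have zz: "Some z \<notin> range x" "Some z \<noteq> z0" using that by (auto simp: W_def)
    have "f \<midarrow>z\<rightarrow> f z" using marked_form_value(2)[OF m b zz(1)] by (simp add: isCont_def)
    then have "q \<midarrow>z\<rightarrow> q z" unfolding q_def by (intro tendsto_divide tendsto_mult contD contN Nnz zz)
    then show ?thesis by (rule remove_sings_eqI)
  qed
  obtain g r where g: "r > 0" "g holomorphic_on cball 0 r" "g 0 \<noteq> 0"
      "\<forall>w\<in>cball 0 r - {0}. f (inverse w) = - g w * w powi (form_order f None + 2)"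
    using form_coeff_at_infinity_near[OF m] by blast
  have "continuous_on (ball 0 r) g"
    by (rule continuous_on_subset[OF holomorphic_on_imp_continuous_on[OF g(2)]]) auto
  then have "isCont g 0" using g(1) by (simp add: continuous_on_eq_continuous_at)
  then have contg: "g \<midarrow>0\<rightarrow> g 0" by (simp add: isCont_def)
  define E where "E = (\<lambda>w. \<Prod>j\<in>J. (1 - p j * w) ^ b j)"
  define M where "M = (\<lambda>w. case z0 of None \<Rightarrow> 1 | Some \<zeta> \<Rightarrow> (1 - \<zeta> * w) ^ a)"
  define n where "n = (\<Sum>j\<in>J. b j)"
  define k where "k = (if z0 = None then 0 else a)"
  have Dinv: "?D (inverse w) = E w * w powi (- int n)" if "w \<noteq> 0" for w
  proof -
    have "?D (inverse w) = (\<Prod>j\<in>J. (1 - p j * w) ^ b j * inverse w ^ b j)"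
      unfolding D using that by (intro prod.cong refl) (simp add: field_simps flip: power_mult_distrib)
    also have "\<dots> = E w * inverse w ^ n" by (simp add: prod.distrib E_def n_def power_sum)
    finally show ?thesis by (simp add: power_int_minus power_inverse)
  qed
  have Ninv: "?N (inverse w) = M w * w powi (- int k)" if "w \<noteq> 0" for w
  proof (cases z0)
    case (Some \<zeta>)
    have "(inverse w - \<zeta>) ^ a = (1 - \<zeta> * w) ^ a * inverse w ^ a"
      using that by (simp add: field_simps flip: power_mult_distrib)
    with Some show ?thesis by (simp add: zero_factor_def M_def k_def power_int_minus power_inverse)
  qed (simp add: zero_factor_def M_def k_def)
  \<comment> \<open>The degree -2 of a 1-form on the sphere, in the guise of the hypothesis on the
    sum of the b j: the exponent of w in q at infinity is 0, whether infinity is a pole, the zero or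
    neither.\<close>
  have expo: "form_order f None + 2 - int n + int k = 0"
  proof (cases "None \<in> range x")
    case True
    then obtain i where i: "x i = None" by (metis rangeE)
    have "j \<in> J \<longleftrightarrow> j \<noteq> i" for j
      unfolding J_def mem_Collect_eq using inj_eq[OF inj, of j i] i by metis
    then have "J = UNIV - {i}" by auto
    then have "a + 2 = b i + n" using B sum.remove[of UNIV i b] by (simp add: n_def)
    moreover have "form_order f None = - int (b i)" using marked_formsD(4)[OF m, of i] i by simp
    moreover have "k = a" using z0(1) True unfolding k_def by metis
    ultimately show ?thesis by linarith
  next
    case False
    then have "j \<in> J" for j unfolding J_def mem_Collect_eq by (metis rangeI)
    then have "J = UNIV" by auto
    then have "n = a + 2" using B by (simp add: n_def)
    moreover have "form_order f None + int k = int a"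
      using False z0(2,3) unfolding k_def by (cases "z0 = None") auto
    ultimately show ?thesis by linarith
  qed
  have "\<forall>\<^sub>F w in at 0. w \<in> ball 0 r - {0}" by (rule eventually_at_in_open) (use g(1) in auto)
  moreover have "\<forall>\<^sub>F w in at (0::complex). inverse w \<notin> W"
  proof -
    have "finite (inverse ` W)" using finW by simp
    then have "\<forall>\<^sub>F w in at 0. w \<notin> inverse ` W" using islimpt_finite by (auto simp: islimpt_iff_eventually)
    then show ?thesis by (rule eventually_mono) (metis image_eqI inverse_inverse_eq)
  qed
  ultimately have ev_inf: "\<forall>\<^sub>F w in at 0. - g w * E w / M w = remove_sings q (inverse w)"
  proof eventually_elim
    case (elim w)
    then have w: "w \<noteq> 0" "w \<in> cball 0 r - {0}" by auto
    have "remove_sings q (inverse w) = f (inverse w) * ?D (inverse w) / ?N (inverse w)"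
      using rq[OF elim(2)] by (simp add: q_def)
    also have "\<dots> = (- g w * E w / M w) * (w powi (form_order f None + 2) * w powi (- int n) * w powi int k)"
      using g(4) w by (simp add: Dinv Ninv power_int_minus divide_inverse)
    also have "w powi (form_order f None + 2) * w powi (- int n) * w powi int k =
        w powi (form_order f None + 2 + - int n + int k)"
      by (simp only: power_int_add[OF disjI1[OF w(1)]])
    also have "form_order f None + 2 + - int n + int k = 0" using expo by simp
    finally show ?case by simp
  qed
  have "(\<lambda>w. - g w * E w / M w) \<midarrow>0\<rightarrow> - g 0 * E 0 / M 0"
  proof -
    have "E \<midarrow>0\<rightarrow> E 0" unfolding E_def by (intro tendsto_intros)
    moreover have "M \<midarrow>0\<rightarrow> M 0" unfolding M_def by (cases z0; simp only: option.case; intro tendsto_intros)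
    moreover have "M 0 \<noteq> 0" by (cases z0) (simp_all add: M_def)
    ultimately show ?thesis by (intro tendsto_intros contg)
  qed
  from Lim_transform_eventually[OF this ev_inf]
  have "(\<lambda>w. remove_sings q (inverse w)) \<midarrow>0\<rightarrow> - g 0 * E 0 / M 0" .
  then have lim_inf: "(remove_sings q \<longlongrightarrow> - g 0 * E 0 / M 0) at_infinity"
    unfolding lim_at_infinity_0 o_def .
  define L where "L = - g 0 * E 0 / M 0"
  have L: "remove_sings q z = L" for z unfolding L_def by (rule Liouville_weak[OF hol lim_inf])
  have off: "f z = L * ?N z / ?D z" if "z \<notin> W" for z
  proof -
    have "q z = L" using rq[OF that] L[of z] by (rule trans[OF sym])
    moreover have "?D z \<noteq> 0" "?N z \<noteq> 0" using that Dnz Nnz by (auto simp: W_def)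
    ultimately show ?thesis unfolding q_def by (metis nonzero_divide_eq_eq times_divide_eq_left)
  qed
  have notW: "\<forall>\<^sub>F w in at z. w \<notin> W" for z
    using islimpt_finite[OF finW] by (auto simp: islimpt_iff_eventually)
  have "L \<noteq> 0"
  proof
    assume L0: "L = 0"
    have "\<forall>\<^sub>F w in at (0 :: complex). False"
      using eventually_conj[OF marked_form_nonzero_near[OF m, of 0] notW[of 0]]
      by (rule eventually_mono) (auto simp: off L0)
    then show False by simp
  qed
  moreover have "f z = L * ?N z / ?D z" for z
  proof (cases "Some z \<in> range x")
    case True
    then obtain j where "Some z = x j" by auto
    then have "x j = Some z" by simp
    then have j: "j \<in> J" "p j = z" by (simp_all add: J_def p_def)
    have "(z - p j) ^ b j = 0" using j b[of j] by simp
    then have "?D z = 0" unfolding D using j(1) by (intro prod_zero) auto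
    then show ?thesis using marked_form_value(1)[OF m b True] by simp
  next
    case False
    have "(\<lambda>w. L * ?N w / ?D w) \<midarrow>z\<rightarrow> L * ?N z / ?D z"
      by (intro tendsto_divide tendsto_mult tendsto_const contN contD Dnz False)
    moreover have "\<forall>\<^sub>F w in at z. L * ?N w / ?D w = f w" using notW[of z] by (rule eventually_mono) (simp add: off)
    ultimately have "f \<midarrow>z\<rightarrow> L * ?N z / ?D z" by (rule Lim_transform_eventually)
    moreover have "f \<midarrow>z\<rightarrow> f z" using marked_form_value(2)[OF m b False] by (simp add: isCont_def)
    ultimately show ?thesis using LIM_unique by blast
  qed
  ultimately show ?thesis by blast
qed

definition cp1_affine :: "complex \<Rightarrow> complex \<Rightarrow> cp1 \<Rightarrow> cp1" where
  "cp1_affine \<kappa> \<beta> = map_option (\<lambda>z. \<kappa> * z + \<beta>)"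

lemma cp1_affine_simps [simp]: "cp1_affine \<kappa> \<beta> None = None" "cp1_affine \<kappa> \<beta> (Some z) = Some (\<kappa> * z + \<beta>)"
  by (simp_all add: cp1_affine_def)

lemma cp1_holomorphic_affine:
  assumes \<kappa>: "\<kappa> \<noteq> 0" shows "cp1_holomorphic (cp1_affine \<kappa> \<beta>)"
proof -
  let ?\<phi> = "cp1_affine \<kappa> \<beta>"
  have op: "open {z. \<kappa> * z + \<beta> \<noteq> 0}" "open {w. \<kappa> + \<beta> * w \<noteq> 0}"
    by (intro open_Collect_neq continuous_intros)+
  have 1: "{z. id (?\<phi> (id (Some z))) \<noteq> None} = UNIV" by simp
  have 2: "{z. cp1_inversion (?\<phi> (id (Some z))) \<noteq> None} = {z. \<kappa> * z + \<beta> \<noteq> 0}" by auto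
  have 3: "{z. id (?\<phi> (cp1_inversion (Some z))) \<noteq> None} = - {0}"
    by (auto simp: cp1_inversion_def)
  have eq4: "cp1_inversion (?\<phi> (cp1_inversion (Some w))) = (if \<kappa> + \<beta> * w = 0 then None else Some (w / (\<kappa> + \<beta> * w)))" for w
  proof (cases "w = 0")
    case False
    have "\<kappa> * inverse w + \<beta> = (\<kappa> + \<beta> * w) / w" using False by (simp add: field_simps)
    then show ?thesis using False by (auto simp: cp1_inversion_def)
  qed (use \<kappa> in simp)
  have 4: "{z. cp1_inversion (?\<phi> (cp1_inversion (Some z))) \<noteq> None} = {w. \<kappa> + \<beta> * w \<noteq> 0}"
    by (auto simp: eq4)
  have h2: "(\<lambda>z. the (cp1_inversion (?\<phi> (id (Some z))))) holomorphic_on {z. \<kappa> * z + \<beta> \<noteq> 0}"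
    by (rule holomorphic_transform[of "\<lambda>z. inverse (\<kappa> * z + \<beta>)"]) (auto intro!: holomorphic_intros)
  have h3: "(\<lambda>z. the (id (?\<phi> (cp1_inversion (Some z))))) holomorphic_on - {0}"
    by (rule holomorphic_transform[of "\<lambda>z. \<kappa> * inverse z + \<beta>"]) (auto intro!: holomorphic_intros)
  have h4: "(\<lambda>z. the (cp1_inversion (?\<phi> (cp1_inversion (Some z))))) holomorphic_on {w. \<kappa> + \<beta> * w \<noteq> 0}"
    by (rule holomorphic_transform[of "\<lambda>w. w / (\<kappa> + \<beta> * w)"]) (auto intro!: holomorphic_intros simp: eq4)
  have h1: "(\<lambda>z. the (id (?\<phi> (id (Some z))))) holomorphic_on UNIV"
    by (simp, intro holomorphic_intros)
  let ?ok = "\<lambda>\<sigma> \<tau>. open {z. \<tau> (?\<phi> (\<sigma> (Some z))) \<noteq> None} \<and>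
        (\<lambda>z. the (\<tau> (?\<phi> (\<sigma> (Some z))))) holomorphic_on {z. \<tau> (?\<phi> (\<sigma> (Some z))) \<noteq> None}"
  have ok: "?ok id id" "?ok id cp1_inversion" "?ok cp1_inversion id" "?ok cp1_inversion cp1_inversion"
    unfolding 1 2 3 4 by (intro conjI h1 h2 h3 h4 op open_UNIV open_Compl closed_singleton)+
  show ?thesis
    unfolding cp1_holomorphic_def
    using ok by blast
qed

lemma cp1_biholomorphic_affine: "\<kappa> \<noteq> 0 \<Longrightarrow> cp1_biholomorphic (cp1_affine \<kappa> \<beta>)"
proof -
  assume \<kappa>: "\<kappa> \<noteq> 0"
  let ?\<psi> = "cp1_affine (1 / \<kappa>) (- \<beta> / \<kappa>)"
  have 1: "?\<psi> (cp1_affine \<kappa> \<beta> P) = P" "cp1_affine \<kappa> \<beta> (?\<psi> P) = P" for P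
    using \<kappa> by (cases P; simp add: field_simps)+
  have 2: "?\<psi> \<circ> cp1_affine \<kappa> \<beta> = id" "cp1_affine \<kappa> \<beta> \<circ> ?\<psi> = id"
    by (simp_all only: fun_eq_iff comp_apply id_apply 1 simp_thms)
  have "bij (cp1_affine \<kappa> \<beta>)" "inv (cp1_affine \<kappa> \<beta>) = ?\<psi>"
    by (rule o_bij[OF 2], rule inv_unique_comp[OF 2(2,1)])
  then show ?thesis using \<kappa> by (simp add: cp1_biholomorphic_def cp1_holomorphic_affine)
qed

lemma cp1_biholomorphic_inversion: "cp1_biholomorphic cp1_inversion"
proof -
  have hid: "cp1_holomorphic id"
    using cp1_holomorphic_affine[of 1 0] by (simp add: cp1_affine_def option.map_id0 flip: id_def)
  have "cp1_holomorphic cp1_inversion"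
    unfolding cp1_holomorphic_def
  proof (intro ballI)
    fix \<sigma> \<tau> :: "cp1 \<Rightarrow> cp1" assume st: "\<sigma> \<in> {id, cp1_inversion}" "\<tau> \<in> {id, cp1_inversion}"
    define \<rho> where "\<rho> = (if \<sigma> = id then cp1_inversion else id)"
    have "cp1_inversion (\<sigma> P) = \<rho> P" for P using st(1) by (auto simp: \<rho>_def)
    moreover have "\<rho> \<in> {id, cp1_inversion}" by (simp add: \<rho>_def)
    ultimately show "open {z. \<tau> (cp1_inversion (\<sigma> (Some z))) \<noteq> None} \<and>
        (\<lambda>z. the (\<tau> (cp1_inversion (\<sigma> (Some z))))) holomorphic_on {z. \<tau> (cp1_inversion (\<sigma> (Some z))) \<noteq> None}"
      using cp1_holomorphicD[OF hid _ st(2), of \<rho>] by simp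
  qed
  moreover have comp: "cp1_inversion \<circ> cp1_inversion = id" by (simp add: fun_eq_iff)
  moreover have "bij cp1_inversion" "inv cp1_inversion = cp1_inversion"
    by (rule o_bij[OF comp comp], rule inv_unique_comp[OF comp comp])
  ultimately show ?thesis by (simp add: cp1_biholomorphic_def)
qed

text \<open>Homogeneous coordinates: \<open>bracket\<close> is the determinant of the coordinate vectors.\<close>

definition hom_coord :: "cp1 \<Rightarrow> complex \<times> complex" where
  "hom_coord P = (case P of None \<Rightarrow> (1, 0) | Some z \<Rightarrow> (z, 1))"

definition bracket :: "complex \<times> complex \<Rightarrow> complex \<times> complex \<Rightarrow> complex" where
  "bracket u v = fst u * snd v - snd u * fst v"

lemma bracket_eq_0_iff: "bracket (hom_coord P) (hom_coord Q) = 0 \<longleftrightarrow> P = Q"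
  by (cases P; cases Q) (auto simp: bracket_def hom_coord_def)

text \<open>An affine map, or \<kappa> / (z - \<zeta>) up to translation, takes the zero to
  infinity; \<kappa> absorbs the constant factor and the translation puts the pole j0 at 0. The
  bracket formula for differences of poles holds uniformly, wherever the zero and the poles lie, and
  turns their ratios into cross ratios.\<close>

lemma form_iso_normal_marked:
  fixes b :: "'p::finite \<Rightarrow> nat"
  assumes m: "(f, x) \<in> marked_forms a b" and b: "\<And>j. b j \<ge> 1" and B: "(\<Sum>j\<in>UNIV. b j) = a + 2"
    and z0: "z0 \<notin> range x" "form_order f z0 = int a" "\<forall>P. P \<notin> insert z0 (range x) \<longrightarrow> form_order f P = 0"
  shows "\<exists>y c. y \<in> config \<and> y $ j0 = 0 \<and> c \<noteq> 0 \<and> ((f, x), normal_marked b y) \<in> form_iso a b \<and>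
    (\<forall>i j. y $ i - y $ j = c * bracket (hom_coord (x i)) (hom_coord (x j)) /
        (bracket (hom_coord (x i)) (hom_coord z0) * bracket (hom_coord (x j)) (hom_coord z0)))"
proof -
  obtain L where L: "L \<noteq> 0" "\<And>z. f z = L * zero_factor a z0 z / pole_product b x z"
    using marked_form_explicit[OF m b B z0] by blast
  have inj: "inj x" by (rule marked_formsD(3)[OF m])
  have finish: ?thesis
    if \<phi>: "cp1_biholomorphic \<phi>" and y: "\<And>j. \<phi> (x j) = Some (y $ j)" and y0: "y $ j0 = 0" and c: "c \<noteq> 0"
      and eq: "\<forall>z u. \<phi> (Some z) = Some u \<longrightarrow> f z = normal_form b y u * deriv (\<lambda>t. the (\<phi> (Some t))) z"
      and diff: "\<And>i j. y $ i - y $ j = c * bracket (hom_coord (x i)) (hom_coord (x j)) /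
        (bracket (hom_coord (x i)) (hom_coord z0) * bracket (hom_coord (x j)) (hom_coord z0))" for \<phi> y c
  proof -
    have "y $ i \<noteq> y $ j" if "i \<noteq> j" for i j
    proof
      assume "y $ i = y $ j"
      then have "\<phi> (x i) = \<phi> (x j)" using y by simp
      then have "x i = x j" using \<phi> by (simp add: cp1_biholomorphic_def bij_def inj_eq)
      then show False using inj that by (simp add: inj_eq)
    qed
    then have "y \<in> config" by (auto simp: config_def)
    moreover have "((f, x), normal_marked b y) \<in> form_iso a b"
      using m normal_marked_in_marked_forms[of b a y, OF b B \<open>y \<in> config\<close>] \<phi> y eq
      unfolding form_iso_def normal_marked_def by blast
    ultimately show ?thesis using y0 c diff by blast
  qed
  show ?thesis
  proof (cases z0)
    case None
    have fin: "x j \<noteq> None" for j using z0(1) None by (metis rangeI)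
    define p where "p = (\<lambda>j. the (x j))"
    have xp: "x j = Some (p j)" for j using fin[of j] by (simp add: p_def)
    \<comment> \<open>Scaling by \<kappa> multiplies the denominator by \<kappa> ^ (a + 2) and dz by
      \<kappa>, so an (a + 1)-th root is needed.\<close>
    obtain \<kappa> where \<kappa>: "\<kappa> \<noteq> 0" "1 / L = \<kappa> ^ (a + 1)" using exists_complex_root_nonzero[of "1 / L" "a + 1"] L(1) by auto
    define y where "y = (\<chi> j. \<kappa> * p j + (- \<kappa> * p j0))"
    show ?thesis
    proof (rule finish[of "cp1_affine \<kappa> (- \<kappa> * p j0)" y \<kappa>])
      show "\<forall>z u. cp1_affine \<kappa> (- \<kappa> * p j0) (Some z) = Some u \<longrightarrow>
          f z = normal_form b y u * deriv (\<lambda>t. the (cp1_affine \<kappa> (- \<kappa> * p j0) (Some t))) z"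
      proof (intro allI impI)
        fix z u assume "cp1_affine \<kappa> (- \<kappa> * p j0) (Some z) = Some u"
        then have u: "u = \<kappa> * z - \<kappa> * p j0" by simp
        have "deriv (\<lambda>t. \<kappa> * t + - \<kappa> * p j0) z = \<kappa>"
          by (rule DERIV_imp_deriv) (auto intro!: derivative_eq_intros)
        moreover have "(\<Prod>j\<in>UNIV. (u - y $ j) ^ b j) = \<kappa> ^ (a + 2) * pole_product b x z"
        proof -
          have "(\<Prod>j\<in>UNIV. (u - y $ j) ^ b j) = (\<Prod>j\<in>UNIV. \<kappa> ^ b j * (z - p j) ^ b j)"
            by (intro prod.cong refl) (simp add: u y_def flip: power_mult_distrib right_diff_distrib)
          then show ?thesis using fin
            by (simp add: prod.distrib pole_product_def p_def B flip: power_sum)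
        qed
        ultimately have "normal_form b y u * deriv (\<lambda>t. the (cp1_affine \<kappa> (- \<kappa> * p j0) (Some t))) z =
            1 / (\<kappa> ^ (a + 2) * pole_product b x z) * \<kappa>" by (simp add: normal_form_def)
        also have "\<dots> = 1 / \<kappa> ^ (a + 1) / pole_product b x z" using \<kappa>(1) by simp
        also have "1 / \<kappa> ^ (a + 1) = L" using L(1) by (simp only: \<kappa>(2)[symmetric]) simp
        finally show "f z = normal_form b y u * deriv (\<lambda>t. the (cp1_affine \<kappa> (- \<kappa> * p j0) (Some t))) z"
          by (simp add: L(2) None zero_factor_def)
      qed
    qed (use \<kappa> xp None in \<open>simp_all add: cp1_biholomorphic_affine y_def bracket_def hom_coord_def algebra_simps\<close>)
  next
    case (Some \<zeta>)
    define J where "J = {j. x j \<noteq> None}"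
    define p where "p = (\<lambda>j. the (x j))"
    have xp: "x j = Some (p j)" if "j \<in> J" for j using that by (auto simp: J_def p_def)
    have xn: "x j = None" if "j \<notin> J" for j using that by (auto simp: J_def)
    have p\<zeta>: "p j \<noteq> \<zeta>" if "j \<in> J" for j using z0(1) Some xp[OF that] by (metis rangeI)
    \<comment> \<open>For a finite pole the new factor u - y j is \<kappa> / (z - \<zeta>) times z -
      p j times - 1 / (p j - \<zeta>); G collects the last of these, which a pole at infinity
      lacks.\<close>
    define G where "G = (\<Prod>j\<in>J. (- 1 / (p j - \<zeta>)) ^ b j)"
    have G: "G \<noteq> 0" using p\<zeta> by (auto simp: G_def)
    obtain \<kappa> where \<kappa>: "\<kappa> \<noteq> 0" "- 1 / (G * L) = \<kappa> ^ (a + 1)"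
      using exists_complex_root_nonzero[of "- 1 / (G * L)" "a + 1"] L(1) G by auto
    \<comment> \<open>The images of the poles under \<kappa> / (z - \<zeta>); a pole at infinity
      goes to 0.\<close>
    define v where "v = (\<lambda>j. if j \<in> J then \<kappa> / (p j - \<zeta>) else 0)"
    define y where "y = (\<chi> j. v j - v j0)"
    define \<phi> where "\<phi> = cp1_affine \<kappa> (- v j0) \<circ> (cp1_inversion \<circ> cp1_affine 1 (- \<zeta>))"
    have \<phi>z: "\<phi> (Some z) = (if z = \<zeta> then None else Some (\<kappa> / (z - \<zeta>) - v j0))" for z
      by (auto simp: \<phi>_def cp1_inversion_def divide_inverse)
    have \<phi>n: "\<phi> None = Some (- v j0)" by (simp add: \<phi>_def)
    show ?thesis
    proof (rule finish[of \<phi> y "- \<kappa>"])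
      show "cp1_biholomorphic \<phi>"
        unfolding \<phi>_def using \<kappa>(1)
        by (intro cp1_biholomorphic_compose cp1_biholomorphic_affine cp1_biholomorphic_inversion) auto
      show "\<phi> (x j) = Some (y $ j)" for j
        using xp[of j] xn[of j] p\<zeta>[of j] by (cases "j \<in> J") (simp_all add: \<phi>z \<phi>n y_def v_def)
      show "\<forall>z u. \<phi> (Some z) = Some u \<longrightarrow> f z = normal_form b y u * deriv (\<lambda>t. the (\<phi> (Some t))) z"
      proof (intro allI impI)
        fix z u assume "\<phi> (Some z) = Some u"
        then have z: "z \<noteq> \<zeta>" and u: "u = \<kappa> / (z - \<zeta>) - v j0" by (auto simp: \<phi>z split: if_splits)
        have "((\<lambda>t. \<kappa> / (t - \<zeta>) - v j0) has_field_derivative - \<kappa> / (z - \<zeta>) ^ 2) (at z)"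
          using z by (auto intro!: derivative_eq_intros simp: power2_eq_square)
        then have "((\<lambda>t. the (\<phi> (Some t))) has_field_derivative - \<kappa> / (z - \<zeta>) ^ 2) (at z)"
          by (rule has_field_derivative_transform_within_open[of _ _ _ "- {\<zeta>}"]) (use z in \<open>auto simp: \<phi>z\<close>)
        then have d: "deriv (\<lambda>t. the (\<phi> (Some t))) z = - \<kappa> / (z - \<zeta>) ^ 2" by (rule DERIV_imp_deriv)
        have "(\<Prod>j\<in>UNIV. (u - y $ j) ^ b j) = (\<Prod>j\<in>UNIV. (\<kappa> / (z - \<zeta>)) ^ b j *
            (if j \<in> J then (z - p j) ^ b j * (- 1 / (p j - \<zeta>)) ^ b j else 1))"
        proof (intro prod.cong refl)
          fix j
          have "u - y $ j = \<kappa> / (z - \<zeta>) * ((z - p j) * (- 1 / (p j - \<zeta>)))" if "j \<in> J"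
          proof -
            have "\<kappa> / A - \<kappa> / (A - B) = \<kappa> / A * (B * (- 1 / (A - B)))" if "A \<noteq> 0" "A - B \<noteq> 0" for A B
              using that by (simp add: divide_simps) (simp add: algebra_simps)
            from this[of "z - \<zeta>" "z - p j"] show ?thesis using that z p\<zeta>[OF that] by (simp add: u y_def v_def)
          qed
          moreover have "u - y $ j = \<kappa> / (z - \<zeta>)" if "j \<notin> J" using that by (simp add: u y_def v_def)
          ultimately have "u - y $ j = \<kappa> / (z - \<zeta>) * (if j \<in> J then (z - p j) * (- 1 / (p j - \<zeta>)) else 1)"
            by (simp only: mult_1_right split: if_split) blast
          then have "(u - y $ j) ^ b j = (\<kappa> / (z - \<zeta>)) ^ b j * (if j \<in> J then (z - p j) * (- 1 / (p j - \<zeta>)) else 1) ^ b j"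
            by (simp only: power_mult_distrib)
          also have "(if j \<in> J then (z - p j) * (- 1 / (p j - \<zeta>)) else 1) ^ b j =
              (if j \<in> J then (z - p j) ^ b j * (- 1 / (p j - \<zeta>)) ^ b j else 1)"
            by (simp only: power_mult_distrib power_one split: if_split) blast
          finally show "(u - y $ j) ^ b j = (\<kappa> / (z - \<zeta>)) ^ b j *
            (if j \<in> J then (z - p j) ^ b j * (- 1 / (p j - \<zeta>)) ^ b j else 1)" .
        qed
        also have "\<dots> = (\<kappa> / (z - \<zeta>)) ^ (a + 2) * (pole_product b x z * G)"
          by (simp add: prod.distrib prod.If_cases J_def p_def pole_product_def G_def B flip: power_sum)
        finally have "normal_form b y u * deriv (\<lambda>t. the (\<phi> (Some t))) z =
           1 / ((\<kappa> / (z - \<zeta>)) ^ (a + 2) * (pole_product b x z * G)) * (- \<kappa> / (z - \<zeta>) ^ 2)"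
          by (simp add: normal_form_def d)
        also have "\<dots> = (z - \<zeta>) ^ a * (- 1 / (\<kappa> ^ (a + 1) * G)) / pole_product b x z"
          using z \<kappa>(1) G by (simp add: power_divide power_add power2_eq_square)
        also have "- 1 / (\<kappa> ^ (a + 1) * G) = L"
          using L(1) G by (simp only: \<kappa>(2)[symmetric]) (simp add: field_simps)
        finally show "f z = normal_form b y u * deriv (\<lambda>t. the (\<phi> (Some t))) z"
          by (simp add: L(2) Some zero_factor_def)
      qed
      show "y $ i - y $ j = - \<kappa> * bracket (hom_coord (x i)) (hom_coord (x j)) /
        (bracket (hom_coord (x i)) (hom_coord z0) * bracket (hom_coord (x j)) (hom_coord z0))" for i j
      proof -
        have h: "hom_coord (x j) = (if j \<in> J then (p j, 1) else (1, 0))" for j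
          using xp[of j] xn[of j] by (cases "j \<in> J") (simp_all add: hom_coord_def)
        have hz: "hom_coord z0 = (\<zeta>, 1)" using Some by (simp add: hom_coord_def)
        have "p j - \<zeta> \<noteq> 0" if "j \<in> J" for j using p\<zeta>[OF that] by simp
        then show ?thesis
          by (cases "i \<in> J"; cases "j \<in> J") (simp_all add: h hz y_def v_def bracket_def field_simps)
      qed
    qed (use \<kappa> in \<open>simp_all add: y_def\<close>)
  qed
qed

section \<open>The topology of the stratum\<close>

lemma topspace_cp1_top: "topspace cp1_top = UNIV"
proof -
  have "topspace (Alexandroff_compactification (euclidean :: complex topology)) = insert None (Some ` topspace euclidean)"
    by (rule topspace_Alexandroff_compactification)
  also have "\<dots> = UNIV" by (simp only: topspace_euclidean UNIV_option_conv[symmetric])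
  finally show ?thesis by (simp only: cp1_top_def)
qed

lemma openin_cp1_top_Some: "openin cp1_top (Some ` U) \<longleftrightarrow> open U"
  by (simp add: cp1_top_def)

lemma openin_cp1_top_None: "compact C \<Longrightarrow> openin cp1_top (insert None (Some ` (- C)))"
  unfolding cp1_top_def openin_Alexandroff_compactification topspace_euclidean Compl_eq_Diff_UNIV
  by (intro disjI2 exI[of _ C] conjI refl) (simp_all add: compact_imp_closed)

lemma open_vimage_Some: "openin cp1_top V \<Longrightarrow> open (Some -` V)"
proof -
  assume "openin cp1_top V"
  then consider U where "open U" "V = Some ` U" | C where "closed C" "V = insert None (Some ` (UNIV - C))"
    unfolding cp1_top_def openin_Alexandroff_compactification by auto
  then show ?thesis
  proof cases
    case 1
    then have "Some -` V = U" by auto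
    with 1 show ?thesis by simp
  next
    case 2
    then have "Some -` V = - C" by auto
    with 2 show ?thesis by (simp add: open_Compl)
  qed
qed

lemma form_zero_eqI:
  assumes m: "(f, x) \<in> marked_forms a b" and a: "a \<ge> 1"
    and z0: "z0 \<notin> range x" "form_order f z0 = int a" "\<forall>P. P \<notin> insert z0 (range x) \<longrightarrow> form_order f P = 0"
  shows "form_zero f = z0"
  unfolding form_zero_def
proof (rule the_equality)
  show "form_order f z0 > 0" using z0(2) a by simp
  fix P assume P: "form_order f P > 0"
  show "P = z0"
  proof (rule ccontr)
    assume ne: "P \<noteq> z0"
    show False
    proof (cases "P \<in> range x")
      case True
      then obtain j where "P = x j" by (rule rangeE)
      then show False using P marked_formsD(4)[OF m, of j] by simp
    next
      case False
      then show False using P ne z0(3) by simp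
    qed
  qed
qed

lemma form_zero:
  assumes m: "(f, x) \<in> marked_forms a b" and a: "a \<ge> 1"
  shows "form_zero f \<notin> range x" "form_order f (form_zero f) = int a"
    "\<forall>P. P \<notin> insert (form_zero f) (range x) \<longrightarrow> form_order f P = 0"
proof -
  obtain z0 where z0: "z0 \<notin> range x" "form_order f z0 = int a" "\<forall>P. P \<notin> insert z0 (range x) \<longrightarrow> form_order f P = 0"
    using marked_formsD(5)[OF m] by (elim exE conjE)
  have "form_zero f = z0" by (rule form_zero_eqI[OF m a z0])
  with z0 show "form_zero f \<notin> range x" "form_order f (form_zero f) = int a"
    "\<forall>P. P \<notin> insert (form_zero f) (range x) \<longrightarrow> form_order f P = 0" by simp_all
qed

lemma form_zero_normal_form:
  assumes b: "\<And>j. b j \<ge> 1" and B: "(\<Sum>j\<in>UNIV. b j) = a + 2" and a: "a \<ge> 1" and x: "x \<in> config"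
  shows "form_zero (normal_form b x) = None"
proof -
  note order = form_order_normal_form[OF b B x]
  have m: "(normal_form b x, \<lambda>j. Some (x $ j)) \<in> marked_forms a b"
    using normal_marked_in_marked_forms[of b a x, OF b B x] by (simp add: normal_marked_def)
  have "form_order (normal_form b x) P = 0" if "P \<notin> insert None (range (\<lambda>j. Some (x $ j)))" for P
  proof (cases P)
    case (Some z)
    then have "z \<noteq> x $ j" for j using that by blast
    then show ?thesis using order(3) Some by blast
  qed (use that in blast)
  then have "\<forall>P. P \<notin> insert None (range (\<lambda>j. Some (x $ j))) \<longrightarrow> form_order (normal_form b x) P = 0" by blast
  moreover have "None \<notin> range (\<lambda>j. Some (x $ j))" by blast
  ultimately show ?thesis using form_zero_eqI[OF m a _ order(2)] by blast
qed

section \<open>Continuous maps to and from spaces of forms and classes\<close>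

lemma topspace_marked_forms_top: "topspace (marked_forms_top a b) = marked_forms a b"
  unfolding marked_forms_top_def topology_generated_by_topspace
proof (intro equalityI Union_least subsetI)
  fix m assume m: "m \<in> marked_forms a b"
  have "{(f, x) \<in> marked_forms a b. Some ` {} \<inter> range x = {} \<and> f ` {} \<subseteq> UNIV} \<in>
     {{(f, x) \<in> marked_forms a b. Some ` K \<inter> range x = {} \<and> f ` K \<subseteq> U} | K U. compact K \<and> open U}"
    by (rule CollectI, rule exI[of _ "{}"], rule exI[of _ UNIV]) simp
  moreover have "m \<in> {(f, x) \<in> marked_forms a b. Some ` {} \<inter> range x = {} \<and> f ` {} \<subseteq> UNIV}" using m by auto
  ultimately show "m \<in> \<Union> ({{(f, x) \<in> marked_forms a b. x j \<in> V} | j V. openin cp1_top V} \<union>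
      {{(f, x) \<in> marked_forms a b. form_zero f \<in> V} | V. openin cp1_top V} \<union>
      {{(f, x) \<in> marked_forms a b. Some ` K \<inter> range x = {} \<and> f ` K \<subseteq> U} | K U. compact K \<and> open U})"
    by (meson UnI2 UnionI)
qed auto

lemma continuous_map_pole: "continuous_map (marked_forms_top a b) cp1_top (\<lambda>m. snd m j)"
  unfolding continuous_map topspace_marked_forms_top topspace_cp1_top
proof (intro conjI allI impI)
  fix V assume V: "openin cp1_top V"
  have "openin (marked_forms_top a b) {(f, x) \<in> marked_forms a b. x j \<in> V}"
    unfolding marked_forms_top_def
    by (rule topology_generated_by_Basis) (intro UnI1 CollectI exI[of _ j] exI[of _ V] conjI refl V)
  also have "{(f, x) \<in> marked_forms a b. x j \<in> V} = {m \<in> marked_forms a b. snd m j \<in> V}" by auto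
  finally show "openin (marked_forms_top a b) {m \<in> marked_forms a b. snd m j \<in> V}" .
qed simp

lemma continuous_map_form_zero: "continuous_map (marked_forms_top a b) cp1_top (\<lambda>m. form_zero (fst m))"
  unfolding continuous_map topspace_marked_forms_top topspace_cp1_top
proof (intro conjI allI impI)
  fix V assume V: "openin cp1_top V"
  have "openin (marked_forms_top a b) {(f, x) \<in> marked_forms a b. form_zero f \<in> V}"
    unfolding marked_forms_top_def
    by (rule topology_generated_by_Basis, rule UnI1, rule UnI2) (intro CollectI exI[of _ V] conjI refl V)
  also have "{(f, x) \<in> marked_forms a b. form_zero f \<in> V} = {m \<in> marked_forms a b. form_zero (fst m) \<in> V}" by auto
  finally show "openin (marked_forms_top a b) {m \<in> marked_forms a b. form_zero (fst m) \<in> V}" .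
qed simp

text \<open>For a generator of compact-open type, the configurations outside the preimage are the
  projection of a closed set along the compact K, hence closed. The zero of a normal form stays at
  infinity, so the generators for the zero impose an all-or-nothing condition.\<close>

lemma continuous_map_normal_marked:
  fixes b :: "'p::finite \<Rightarrow> nat"
  assumes b: "\<And>j. b j \<ge> 1" and B: "(\<Sum>j\<in>UNIV. b j) = a + 2" and a: "a \<ge> 1"
  shows "continuous_map (top_of_set config) (marked_forms_top a b) (normal_marked b)"
proof -
  let ?M = "marked_forms a b"
  have in_M: "(normal_form b x, \<lambda>j. Some (x $ j)) \<in> ?M" if "x \<in> config" for x
    using normal_marked_in_marked_forms[of b a x, OF b B that] by (simp add: normal_marked_def)
  have pre: "normal_marked b -` {(f, x) \<in> ?M. P f x} \<inter> config = {x \<in> config. P (normal_form b x) (\<lambda>j. Some (x $ j))}" for P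
    using in_M by (auto simp: normal_marked_def)
  have op: "openin (top_of_set config) {x \<in> config. x \<in> A}" if "open A" for A :: "(complex ^ 'p) set"
  proof -
    have "{x \<in> config. x \<in> A} = config \<inter> A" by auto
    then show ?thesis using that by (simp add: openin_open_Int)
  qed
  have 1: "openin (top_of_set config) (normal_marked b -` {(f, x) \<in> ?M. x j \<in> V} \<inter> config)" if V: "openin cp1_top V" for j V
  proof -
    have "open ((\<lambda>x. x $ j) -` (Some -` V))" by (intro open_vimage open_vimage_Some V continuous_intros)
    from op[OF this] show ?thesis unfolding pre by simp
  qed
  have 2: "openin (top_of_set config) (normal_marked b -` {(f, x) \<in> ?M. form_zero f \<in> V} \<inter> config)" for V
  proof -
    have "{x \<in> config. form_zero (normal_form b x) \<in> V} = {x \<in> config. x \<in> (if None \<in> V then UNIV else {})}"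
      using form_zero_normal_form[of b a, OF b B a] by auto
    moreover have "open (if None \<in> V then UNIV else {} :: (complex ^ 'p) set)" by simp
    ultimately show ?thesis unfolding pre using op by (simp only:)
  qed
  have 3: "openin (top_of_set config) (normal_marked b -` {(f, x) \<in> ?M. Some ` K \<inter> range x = {} \<and> f ` K \<subseteq> U} \<inter> config)"
    if K: "compact K" and U: "open U" for K U
  proof -
    define A where "A = {p :: complex \<times> (complex ^ 'p). \<forall>j. fst p \<noteq> snd p $ j}"
    have "A = (\<Inter>j. {p. fst p \<noteq> snd p $ j})" by (auto simp: A_def)
    also have "open \<dots>" by (intro open_INT ballI open_Collect_neq continuous_intros) auto
    finally have A: "open A" .
    have "continuous_on A (\<lambda>p. normal_form b (snd p) (fst p))"
      unfolding normal_form_def by (intro continuous_intros) (auto simp: A_def)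
    from closed_Compl[OF continuous_open_preimage[OF this A U]]
    have "closed (- (A \<inter> (\<lambda>p. normal_form b (snd p) (fst p)) -` U))" .
    from closed_compact_projection[OF K this]
    have "open (- {x. \<exists>z. z \<in> K \<and> (z, x) \<in> - (A \<inter> (\<lambda>p. normal_form b (snd p) (fst p)) -` U)})" by (rule open_Compl)
    from op[OF this] have "openin (top_of_set config) {x \<in> config. x \<in>
        - {x. \<exists>z. z \<in> K \<and> (z, x) \<in> - (A \<inter> (\<lambda>p. normal_form b (snd p) (fst p)) -` U)}}" .
    also have "{x \<in> config. x \<in> - {x. \<exists>z. z \<in> K \<and> (z, x) \<in> - (A \<inter> (\<lambda>p. normal_form b (snd p) (fst p)) -` U)}} =
        {x \<in> config. \<forall>z\<in>K. (\<forall>j. z \<noteq> x $ j) \<and> normal_form b x z \<in> U}"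
      unfolding A_def by (simp only: Compl_iff mem_Collect_eq Int_iff vimage_eq fst_conv snd_conv) blast
    also have "{x \<in> config. \<forall>z\<in>K. (\<forall>j. z \<noteq> x $ j) \<and> normal_form b x z \<in> U} =
      {x \<in> config. Some ` K \<inter> range (\<lambda>j. Some (x $ j)) = {} \<and> normal_form b x ` K \<subseteq> U}" by blast
    finally show ?thesis unfolding pre .
  qed
  have into: "normal_marked b ` config \<subseteq> topspace (marked_forms_top a b)"
    unfolding topspace_marked_forms_top using normal_marked_in_marked_forms[of b a, OF b B] by blast
  show ?thesis
    unfolding marked_forms_top_def continuous_on_generated_topo_iff topspace_euclidean_subtopology
  proof (intro conjI allI impI)
    show "normal_marked b ` config \<subseteq> \<Union> ({{(f, x) \<in> marked_forms a b. x j \<in> V} | j V. openin cp1_top V} \<union>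
      {{(f, x) \<in> marked_forms a b. form_zero f \<in> V} | V. openin cp1_top V} \<union>
      {{(f, x) \<in> marked_forms a b. Some ` K \<inter> range x = {} \<and> f ` K \<subseteq> U} | K U. compact K \<and> open U})"
      using into unfolding marked_forms_top_def topology_generated_by_topspace .
  next
    fix S assume "S \<in> {{(f, x) \<in> marked_forms a b. x j \<in> V} | j V. openin cp1_top V} \<union>
      {{(f, x) \<in> marked_forms a b. form_zero f \<in> V} | V. openin cp1_top V} \<union>
      {{(f, x) \<in> marked_forms a b. Some ` K \<inter> range x = {} \<and> f ` K \<subseteq> U} | K U. compact K \<and> open U}"
    then show "openin (top_of_set config) (normal_marked b -` S \<inter> config)"
      by (elim UnE CollectE exE conjE) (simp_all only: 1 2 3)
  qed
qed

lemma class_in_stratum: "m \<in> marked_forms a b \<Longrightarrow> form_iso a b `` {m} \<in> stratum a b"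
  unfolding stratum_def by (rule quotientI)

lemma topspace_stratum_top: "topspace (stratum_top a b) = stratum a b"
proof (rule antisym)
  show "topspace (stratum_top a b) \<subseteq> stratum a b"
    using openin_topspace[of "stratum_top a b"] unfolding openin_stratum_top by (rule conjunct1)
  have "{m \<in> marked_forms a b. form_iso a b `` {m} \<in> stratum a b} = topspace (marked_forms_top a b)"
    unfolding topspace_marked_forms_top using class_in_stratum by blast
  then have "openin (stratum_top a b) (stratum a b)" unfolding openin_stratum_top by simp
  then show "stratum a b \<subseteq> topspace (stratum_top a b)" by (rule openin_subset)
qed

lemma continuous_map_class: "continuous_map (marked_forms_top a b) (stratum_top a b) (\<lambda>m. form_iso a b `` {m})"
  unfolding continuous_map topspace_marked_forms_top topspace_stratum_top
  using class_in_stratum by (auto simp: openin_stratum_top)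

lemma continuous_map_from_stratum:
  assumes "continuous_map (marked_forms_top a b) Y (\<lambda>m. g (form_iso a b `` {m}))"
  shows "continuous_map (stratum_top a b) Y g"
proof -
  have g: "g (form_iso a b `` {m}) \<in> topspace Y" if "m \<in> marked_forms a b" for m
    using assms that unfolding continuous_map topspace_marked_forms_top by blast
  have "g c \<in> topspace Y" if "c \<in> stratum a b" for c
    using that g unfolding stratum_def by (auto elim!: quotientE)
  moreover have "openin (stratum_top a b) {c \<in> stratum a b. g c \<in> U}" if "openin Y U" for U
  proof -
    have "openin (marked_forms_top a b) {m \<in> marked_forms a b. g (form_iso a b `` {m}) \<in> U}"
      using assms that unfolding continuous_map topspace_marked_forms_top by blast
    also have "{m \<in> marked_forms a b. g (form_iso a b `` {m}) \<in> U} =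
        {m \<in> marked_forms a b. form_iso a b `` {m} \<in> {c \<in> stratum a b. g c \<in> U}}"
      using class_in_stratum by blast
    finally show ?thesis unfolding openin_stratum_top by blast
  qed
  ultimately show ?thesis unfolding continuous_map topspace_stratum_top by blast
qed

text \<open>Residues are invariant under isomorphism, so the image of a class is a singleton, as
  \<open>the_elem\<close> requires.\<close>

lemma residual_map_class:
  assumes b: "\<And>j. b j \<ge> 1" and B: "(\<Sum>j\<in>UNIV. b j) = a + 2" and x: "x \<in> config"
  shows "residual_map (form_iso a b `` {normal_marked b x}) = residues b x"
proof -
  have "(\<chi> j. form_residue f (y j)) = residues b x" if "(normal_marked b x, (f, y)) \<in> form_iso a b" for f y
  proof -
    from that obtain \<phi> where \<phi>: "cp1_biholomorphic \<phi>" "\<forall>j. \<phi> (Some (x $ j)) = y j" and f: "(f, y) \<in> marked_forms a b"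
      and eq: "\<forall>z u. \<phi> (Some z) = Some u \<longrightarrow> normal_form b x z = f u * deriv (\<lambda>t. the (\<phi> (Some t))) z"
      unfolding normal_marked_def form_iso_def by auto
    have "form_residue f (y j) = res_at b x j" for j
      using form_residue_pullback[OF \<phi>(1) marked_formsD(1)[OF f] eq, of "x $ j"] \<phi>(2) by (simp add: res_at_def)
    then show ?thesis by (simp add: residues_def)
  qed
  then have const: "(case m of (f, y) \<Rightarrow> \<chi> j. form_residue f (y j)) = residues b x"
    if "m \<in> form_iso a b `` {normal_marked b x}" for m
    using that by (cases m) (simp only: Image_singleton_iff prod.case)
  have "(normal_marked b x, normal_marked b x) \<in> form_iso a b"
    by (rule form_iso_refl[OF normal_marked_in_marked_forms[of b a x, OF b B x]])
  then have "normal_marked b x \<in> form_iso a b `` {normal_marked b x}" by (simp only: Image_singleton_iff)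
  then have "(\<lambda>m. residues b x) ` (form_iso a b `` {normal_marked b x}) = {residues b x}" by (rule image_constant)
  with const have "(\<lambda>(f, y). \<chi> j. form_residue f (y j)) ` (form_iso a b `` {normal_marked b x}) = {residues b x}"
    by (simp only: cong: image_cong)
  then show ?thesis by (simp add: residual_map_def)
qed

text \<open>
  The homogeneous coordinates of a convergent family of points of the sphere converge after a
  rescaling, so that expressions of degree zero in them are continuous.
\<close>

lemma hom_coord_limit:
  assumes u: "limitin cp1_top u P F"
  shows "\<exists>k s. (k \<longlongrightarrow> hom_coord P) F \<and> (\<forall>\<^sub>F m in F. s m \<noteq> 0 \<and> hom_coord (u m) = (s m * fst (k m), s m * snd (k m)))"
proof (cases P)
  case (Some z)
  define v where "v = (\<lambda>m. the (u m))"
  have ev: "\<forall>\<^sub>F m in F. u m \<in> Some ` W" if "open W" "z \<in> W" for W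
    using limitinD[OF u, of "Some ` W"] that Some by (simp add: openin_cp1_top_Some)
  have "(v \<longlongrightarrow> z) F"
  proof (rule topological_tendstoI)
    fix W :: "complex set" assume "open W" "z \<in> W"
    from ev[OF this] show "\<forall>\<^sub>F m in F. v m \<in> W" by eventually_elim (auto simp: v_def)
  qed
  then have "((\<lambda>m. (v m, 1)) \<longlongrightarrow> hom_coord P) F" unfolding Some hom_coord_def by (auto intro!: tendsto_intros)
  moreover have "\<forall>\<^sub>F m in F. 1 \<noteq> (0::complex) \<and> hom_coord (u m) = (1 * fst (v m, 1::complex), 1 * snd (v m, 1::complex))"
    using ev[OF open_UNIV UNIV_I] by eventually_elim (auto simp: hom_coord_def v_def)
  ultimately show ?thesis by (intro exI[of _ "\<lambda>m. (v m, 1)"] exI[of _ "\<lambda>_. 1"] conjI)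
next
  case None
  define v where "v = (\<lambda>m. case u m of None \<Rightarrow> 0 | Some w \<Rightarrow> inverse w)"
  \<comment> \<open>Near infinity the coordinates (w, 1) are replaced by (1, 1 / w), with w as the
    factor s.\<close>
  define s where "s = (\<lambda>m. case u m of None \<Rightarrow> 1 | Some w \<Rightarrow> w)"
  have ev: "\<forall>\<^sub>F m in F. u m \<in> insert None (Some ` (- C))" if "compact C" for C
    using limitinD[OF u, of "insert None (Some ` (- C))"] that None by (simp add: openin_cp1_top_None)
  have "(v \<longlongrightarrow> 0) F"
  proof (rule tendstoI)
    fix e :: real assume e: "e > 0"
    show "\<forall>\<^sub>F m in F. dist (v m) 0 < e"
      using ev[OF compact_cball[of 0 "1 / e"]]
    proof eventually_elim
      case (elim m)
      show ?case
      proof (cases "u m")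
        case (Some w)
        then have w: "1 / e < norm w" using elim by auto
        moreover have "0 < 1 / e" using e by simp
        ultimately have "norm w > 0" by linarith
        then have "inverse (norm w) < e" using w e by (simp add: field_simps)
        then show ?thesis using Some by (simp add: v_def norm_inverse)
      qed (use e in \<open>simp add: v_def\<close>)
    qed
  qed
  then have "((\<lambda>m. (1, v m)) \<longlongrightarrow> hom_coord P) F" unfolding None hom_coord_def by (auto intro!: tendsto_intros)
  moreover have "\<forall>\<^sub>F m in F. s m \<noteq> 0 \<and> hom_coord (u m) = (s m * fst (1::complex, v m), s m * snd (1::complex, v m))"
    using ev[of "{0}"] by (simp, elim eventually_mono) (auto simp: hom_coord_def v_def s_def)
  ultimately show ?thesis by (intro exI[of _ "\<lambda>m. (1, v m)"] exI[of _ s] conjI)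
qed

section \<open>Cross ratios\<close>

text \<open>Each argument occurs once above and once below, so the value depends on the points only
  and not on the choice of homogeneous coordinates.\<close>

definition cross_ratio :: "complex \<times> complex \<Rightarrow> complex \<times> complex \<Rightarrow> complex \<times> complex \<Rightarrow> complex \<times> complex \<Rightarrow> complex" where
  "cross_ratio p q r s = bracket p q * bracket r s / (bracket r q * bracket p s)"

lemma cross_ratio_scale:
  assumes "c1 \<noteq> 0" "c2 \<noteq> 0" "c3 \<noteq> 0" "c4 \<noteq> 0"
  shows "cross_ratio (c1 * fst p, c1 * snd p) (c2 * fst q, c2 * snd q) (c3 * fst r, c3 * snd r) (c4 * fst s, c4 * snd s) =
    cross_ratio p q r s"
proof -
  have b: "bracket (c * fst v, c * snd v) (d * fst w, d * snd w) = c * d * bracket v w" for c d v w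
    by (simp add: bracket_def algebra_simps)
  show ?thesis unfolding cross_ratio_def b using assms by simp
qed

lemma cross_ratio_limit:
  assumes u: "limitin cp1_top u1 P F" "limitin cp1_top u2 Q F" "limitin cp1_top u3 R F" "limitin cp1_top u4 S F"
    and ne: "R \<noteq> Q" "P \<noteq> S"
  shows "((\<lambda>m. cross_ratio (hom_coord (u1 m)) (hom_coord (u2 m)) (hom_coord (u3 m)) (hom_coord (u4 m))) \<longlongrightarrow>
    cross_ratio (hom_coord P) (hom_coord Q) (hom_coord R) (hom_coord S)) F"
proof -
  obtain k1 s1 where 1: "(k1 \<longlongrightarrow> hom_coord P) F"
    "\<forall>\<^sub>F m in F. s1 m \<noteq> 0 \<and> hom_coord (u1 m) = (s1 m * fst (k1 m), s1 m * snd (k1 m))"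
    using hom_coord_limit[OF u(1)] by (elim exE conjE)
  obtain k2 s2 where 2: "(k2 \<longlongrightarrow> hom_coord Q) F"
    "\<forall>\<^sub>F m in F. s2 m \<noteq> 0 \<and> hom_coord (u2 m) = (s2 m * fst (k2 m), s2 m * snd (k2 m))"
    using hom_coord_limit[OF u(2)] by (elim exE conjE)
  obtain k3 s3 where 3: "(k3 \<longlongrightarrow> hom_coord R) F"
    "\<forall>\<^sub>F m in F. s3 m \<noteq> 0 \<and> hom_coord (u3 m) = (s3 m * fst (k3 m), s3 m * snd (k3 m))"
    using hom_coord_limit[OF u(3)] by (elim exE conjE)
  obtain k4 s4 where 4: "(k4 \<longlongrightarrow> hom_coord S) F"
    "\<forall>\<^sub>F m in F. s4 m \<noteq> 0 \<and> hom_coord (u4 m) = (s4 m * fst (k4 m), s4 m * snd (k4 m))"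
    using hom_coord_limit[OF u(4)] by (elim exE conjE)
  have "bracket (hom_coord R) (hom_coord Q) \<noteq> 0" "bracket (hom_coord P) (hom_coord S) \<noteq> 0"
    using ne by (simp_all add: bracket_eq_0_iff)
  then have "((\<lambda>m. cross_ratio (k1 m) (k2 m) (k3 m) (k4 m)) \<longlongrightarrow>
      cross_ratio (hom_coord P) (hom_coord Q) (hom_coord R) (hom_coord S)) F"
    unfolding cross_ratio_def bracket_def by (intro tendsto_intros 1(1) 2(1) 3(1) 4(1)) simp
  moreover have "\<forall>\<^sub>F m in F. cross_ratio (k1 m) (k2 m) (k3 m) (k4 m) =
      cross_ratio (hom_coord (u1 m)) (hom_coord (u2 m)) (hom_coord (u3 m)) (hom_coord (u4 m))"
    using 1(2) 2(2) 3(2) 4(2) by eventually_elim (simp only: cross_ratio_scale simp_thms)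
  ultimately show ?thesis by (rule Lim_transform_eventually)
qed

section \<open>Scaling of normal forms and roots of unity\<close>

lemma normal_form_scale:
  fixes y :: "complex ^ 'p::finite"
  assumes B: "(\<Sum>j\<in>UNIV. b j) = a + 2" and s: "s \<noteq> 0"
  shows "normal_form b y z = s ^ (a + 1) * normal_form b (s *s y) (s * z) * s"
proof -
  have "(\<Prod>j\<in>UNIV. (s * z - (s *s y) $ j) ^ b j) = (\<Prod>j\<in>UNIV. s ^ b j * (z - y $ j) ^ b j)"
    by (rule prod.cong) (simp_all flip: power_mult_distrib right_diff_distrib)
  also have "\<dots> = s ^ (a + 2) * (\<Prod>j\<in>UNIV. (z - y $ j) ^ b j)" by (simp only: prod.distrib power_sum[symmetric] B)
  also have "s ^ (a + 2) = s ^ (a + 1) * s" by simp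
  finally have "normal_form b (s *s y) (s * z) = 1 / (s ^ (a + 1) * s * (\<Prod>j\<in>UNIV. (z - y $ j) ^ b j))"
    by (simp only: normal_form_def)
  then show ?thesis using s by (simp add: normal_form_def)
qed

lemma config_scale: "y \<in> config \<Longrightarrow> s \<noteq> 0 \<Longrightarrow> s *s y \<in> config"
  by (simp add: config_def)

lemma res_at_scale:
  fixes y :: "complex ^ 'p::finite"
  assumes B: "(\<Sum>j\<in>UNIV. b j) = a + 2" and y: "y \<in> config" and s: "s \<noteq> 0"
  shows "res_at b y j = s ^ (a + 1) * res_at b (s *s y) j"
proof -
  let ?F = "\<lambda>u. s ^ (a + 1) * normal_form b (s *s y) u"
  define S where "S = - ((\<lambda>i. (s *s y) $ i) ` (UNIV - {j}))"
  have "normal_form b (s *s y) meromorphic_on {s * y $ j}"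
    unfolding normal_form_def by (intro meromorphic_intros)
  then have "?F meromorphic_on {s * y $ j}" by (intro meromorphic_intros)
  then have sing: "isolated_singularity_at ?F (s * y $ j)" by (simp add: meromorphic_at_iff)
  have "residue (normal_form b y) (y $ j) = residue ?F (s * y $ j)"
  proof (rule residue_pullback[of UNIV "y $ j" "\<lambda>z. s * z"])
    have "deriv (\<lambda>z. s * z) z = s" for z by (rule DERIV_imp_deriv) (auto intro!: derivative_eq_intros)
    then show "normal_form b y z = s ^ (a + 1) * normal_form b (s *s y) (s * z) * deriv ((*) s) z" for z
      using normal_form_scale[OF B s, of y z] by simp
    show "inj_on ((*) s) UNIV" using s by (intro inj_onI) simp
    show "(*) s holomorphic_on UNIV" by (intro holomorphic_intros)
  qed (rule sing open_UNIV UNIV_I)+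
  also have "\<dots> = s ^ (a + 1) * residue (normal_form b (s *s y)) (s * y $ j)"
  proof (rule residue_lmul[of S])
    show "open S" unfolding S_def by (intro open_Compl finite_imp_closed) auto
    have "s * y $ j \<noteq> (s *s y) $ i" if "i \<noteq> j" for i
      using y s that unfolding config_def vector_smult_component by simp
    then show "s * y $ j \<in> S" unfolding S_def by blast
    show "normal_form b (s *s y) holomorphic_on S - {s * y $ j}"
    proof (rule holomorphic_normal_form)
      have "(s *s y) $ i \<notin> S - {s * y $ j}" for i
        by (cases "i = j") (simp, unfold S_def, blast)
      then show "range (($) (s *s y)) \<inter> (S - {s * y $ j}) = {}" by blast
    qed
  qed
  finally show ?thesis by (simp add: res_at_def)
qed

lemma residues_scale_root:
  fixes y :: "complex ^ 'p::finite"
  assumes B: "(\<Sum>j\<in>UNIV. b j) = a + 2" and y: "y \<in> config" and \<zeta>: "\<zeta> ^ (a + 1) = 1"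
  shows "residues b (\<zeta> *s y) = residues b y"
proof -
  have "\<zeta> \<noteq> 0" using \<zeta> by auto
  then have "res_at b y j = res_at b (\<zeta> *s y) j" for j
    using res_at_scale[OF B y, of \<zeta> j] unfolding \<zeta> mult_1 by blast
  then show ?thesis by (simp add: residues_def)
qed

text \<open>Scaling by an (a + 1)-th root of unity is an isomorphism of normal forms. A class may
  therefore have several configurations in \<open>X0\<close>, and lifting a path from the stratum
  involves the choice of a root.\<close>

lemma class_scale_root:
  fixes y :: "complex ^ 'p::finite"
  assumes b: "\<And>j. b j \<ge> 1" and B: "(\<Sum>j\<in>UNIV. b j) = a + 2" and y: "y \<in> config" and \<zeta>: "\<zeta> ^ (a + 1) = 1"
  shows "form_iso a b `` {normal_marked b (\<zeta> *s y)} = form_iso a b `` {normal_marked b y}"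
proof -
  have nz: "\<zeta> \<noteq> 0" using \<zeta> by auto
  have "(normal_marked b y, normal_marked b (\<zeta> *s y)) \<in> form_iso a b"
  proof -
    have 1: "normal_form b y z = normal_form b (\<zeta> *s y) u * deriv (\<lambda>t. the (cp1_affine \<zeta> 0 (Some t))) z"
      if "cp1_affine \<zeta> 0 (Some z) = Some u" for z u
    proof -
      have "deriv (\<lambda>z. \<zeta> * z) z = \<zeta>" for z by (rule DERIV_imp_deriv) (auto intro!: derivative_eq_intros)
      then show ?thesis using that normal_form_scale[OF B nz, of y z] \<zeta> by simp
    qed
    show ?thesis
      using normal_marked_in_marked_forms[of b a, OF b B y]
        normal_marked_in_marked_forms[of b a, OF b B config_scale[OF y nz]] cp1_biholomorphic_affine[OF nz, of 0] 1
      unfolding form_iso_def normal_marked_def by (auto intro!: exI[of _ "cp1_affine \<zeta> 0"])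
  qed
  then show ?thesis by (rule equiv_class_eq[OF equiv_form_iso[of b, OF b], symmetric])
qed

text \<open>
  Translating and scaling a normal form changes its poles by an affine map, so the ratios of
  differences of poles depend only on the class. They are cross ratios of the zero and three poles
  of an arbitrary representative, hence continuous.
\<close>

locale isoresidual = residue_covering b j0 for b :: "'p::finite \<Rightarrow> nat" and j0 +
  fixes a :: nat and j1 :: 'p
  assumes a: "a \<ge> 1" and degree: "(\<Sum>j\<in>UNIV. b j) = a + 2" and j1: "j1 \<noteq> j0"
begin

definition normal_class :: "complex ^ 'p \<Rightarrow> 'p marked_form set" where
  "normal_class x = form_iso a b `` {normal_marked b x}"

lemma normal_class_eqD:
  assumes "x \<in> config" "y \<in> config" "normal_class x = normal_class y"
  shows "\<exists>\<alpha> \<beta>. \<alpha> \<noteq> 0 \<and> (\<forall>j. y $ j = \<alpha> * x $ j + \<beta>)"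
proof -
  have "(normal_marked b x, normal_marked b y) \<in> form_iso a b"
    by (rule eq_equiv_class[OF _ equiv_form_iso[of b, OF b]])
      (use assms normal_marked_in_marked_forms[of b a, OF b degree] in \<open>simp_all add: normal_class_def\<close>)
  then show ?thesis by (rule normal_marked_iso_affine[OF _ b degree a])
qed

lemma residual_map_normal_class:
  assumes "x \<in> config"
  shows "residual_map (normal_class x) = residues b x"
  using residual_map_class[of b a x, OF b degree assms] by (simp only: normal_class_def)

lemma normal_class_scale_root:
  assumes "x \<in> config" "\<zeta> ^ (a + 1) = 1"
  shows "normal_class (\<zeta> *s x) = normal_class x"
  using class_scale_root[of b a x \<zeta>, OF b degree assms] by (simp only: normal_class_def)

lemma marked_form_normal_class:
  assumes m: "m \<in> marked_forms a b"
  shows "\<exists>y c. y \<in> config \<and> y $ j0 = 0 \<and> c \<noteq> 0 \<and> form_iso a b `` {m} = normal_class y \<and>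
    (\<forall>i j. y $ i - y $ j = c * bracket (hom_coord (snd m i)) (hom_coord (snd m j)) /
        (bracket (hom_coord (snd m i)) (hom_coord (form_zero (fst m))) *
         bracket (hom_coord (snd m j)) (hom_coord (form_zero (fst m)))))"
proof -
  obtain f x where fx: "m = (f, x)" by (cases m)
  note m' = m[unfolded fx]
  from form_iso_normal_marked[OF m' b degree form_zero[OF m' a], of j0]
  obtain y c where y: "y \<in> config" "y $ j0 = 0" "c \<noteq> 0" "((f, x), normal_marked b y) \<in> form_iso a b"
    "\<forall>i j. y $ i - y $ j = c * bracket (hom_coord (x i)) (hom_coord (x j)) /
        (bracket (hom_coord (x i)) (hom_coord (form_zero f)) * bracket (hom_coord (x j)) (hom_coord (form_zero f)))"
    by (elim exE conjE)
  have "form_iso a b `` {m} = normal_class y"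
    unfolding normal_class_def fx by (rule equiv_class_eq[OF equiv_form_iso[of b, OF b] y(4)])
  with y show ?thesis unfolding fx fst_conv snd_conv by (intro exI[of _ y] exI[of _ c] conjI)
qed

text \<open>The configuration with pole j0 moved to 0 and pole j1 to 1. The choice of y does not
  matter, as configurations of one class differ by an affine map; translation and scale are
  lost.\<close>

definition pole_ratio :: "'p marked_form set \<Rightarrow> complex ^ 'p" where
  "pole_ratio c = (let y = SOME y. y \<in> config \<and> c = normal_class y in
     \<chi> j. (y $ j - y $ j0) / (y $ j1 - y $ j0))"

lemma pole_ratio_normal_class:
  assumes y: "y \<in> config"
  shows "pole_ratio (normal_class y) = (\<chi> j. (y $ j - y $ j0) / (y $ j1 - y $ j0))"
proof -
  define y' where "y' = (SOME y'. y' \<in> config \<and> normal_class y = normal_class y')"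
  have "y' \<in> config \<and> normal_class y = normal_class y'" unfolding y'_def by (rule someI[of _ y]) (use y in blast)
  then obtain \<alpha> \<beta> where \<alpha>: "\<alpha> \<noteq> 0" "\<forall>j. y' $ j = \<alpha> * y $ j + \<beta>"
    using normal_class_eqD[OF y] by blast
  have d: "y' $ i - y' $ j = \<alpha> * (y $ i - y $ j)" for i j using \<alpha>(2) by (simp add: algebra_simps)
  have "pole_ratio (normal_class y) = (\<chi> j. (y' $ j - y' $ j0) / (y' $ j1 - y' $ j0))"
    unfolding pole_ratio_def Let_def y'_def ..
  also have "\<dots> = (\<chi> j. (y $ j - y $ j0) / (y $ j1 - y $ j0))"
    unfolding d using \<alpha>(1) by simp
  finally show ?thesis .
qed

lemma pole_ratio_marked:
  assumes m: "m \<in> marked_forms a b"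
  shows "pole_ratio (form_iso a b `` {m}) = (\<chi> j. cross_ratio (hom_coord (snd m j)) (hom_coord (snd m j0))
    (hom_coord (snd m j1)) (hom_coord (form_zero (fst m))))"
proof -
  obtain y c where y: "y \<in> config" "c \<noteq> 0" "form_iso a b `` {m} = normal_class y"
    "\<forall>i j. y $ i - y $ j = c * bracket (hom_coord (snd m i)) (hom_coord (snd m j)) /
        (bracket (hom_coord (snd m i)) (hom_coord (form_zero (fst m))) *
         bracket (hom_coord (snd m j)) (hom_coord (form_zero (fst m))))"
    using marked_form_normal_class[OF m] by (elim exE conjE)
  have m': "(fst m, snd m) \<in> marked_forms a b" using m by simp
  have nz: "bracket (hom_coord (snd m j)) (hom_coord (form_zero (fst m))) \<noteq> 0" for j
    using form_zero(1)[OF m' a] unfolding bracket_eq_0_iff by (metis rangeI)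
  have "(y $ j - y $ j0) / (y $ j1 - y $ j0) = cross_ratio (hom_coord (snd m j)) (hom_coord (snd m j0))
    (hom_coord (snd m j1)) (hom_coord (form_zero (fst m)))" for j
  proof -
    have "(c * u / (p * q)) / (c * v / (r * q)) = u * r / (v * p)" if "p \<noteq> 0" "q \<noteq> 0" "r \<noteq> 0" for u v p q r
      using that y(2) by (simp add: divide_simps)
    from this[OF nz nz nz] show ?thesis unfolding cross_ratio_def using y(4) by simp
  qed
  then show ?thesis unfolding y(3) pole_ratio_normal_class[OF y(1)] by simp
qed

lemma continuous_pole_ratio: "continuous_map (stratum_top a b) euclidean pole_ratio"
proof (rule continuous_map_from_stratum)
  let ?R = "\<lambda>m. (\<chi> j. cross_ratio (hom_coord (snd m j)) (hom_coord (snd m j0))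
    (hom_coord (snd m j1)) (hom_coord (form_zero (fst m)))) :: complex ^ 'p"
  have "continuous_map (marked_forms_top a b) euclidean ?R"
    unfolding continuous_map_atin limitin_canonical_iff
  proof (rule ballI, rule vec_tendstoI)
    fix m j assume m: "m \<in> topspace (marked_forms_top a b)"
    then have m': "(fst m, snd m) \<in> marked_forms a b" by (simp add: topspace_marked_forms_top)
    have pole: "limitin cp1_top (\<lambda>m. snd m i) (snd m i) (atin (marked_forms_top a b) m)" for i
      by (rule limitin_continuous_map[OF continuous_map_pole m refl])
    have zero: "limitin cp1_top (\<lambda>m. form_zero (fst m)) (form_zero (fst m)) (atin (marked_forms_top a b) m)"
      by (rule limitin_continuous_map[OF continuous_map_form_zero m refl])
    have "snd m j1 \<noteq> snd m j0" using marked_formsD(3)[OF m'] j1 by (simp add: inj_eq)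
    moreover have "snd m j \<noteq> form_zero (fst m)" using form_zero(1)[OF m' a] by (metis rangeI)
    ultimately show "((\<lambda>m. ?R m $ j) \<longlongrightarrow> ?R m $ j) (atin (marked_forms_top a b) m)"
      unfolding vec_lambda_beta by (intro cross_ratio_limit pole zero)
  qed
  then show "continuous_map (marked_forms_top a b) euclidean (\<lambda>m. pole_ratio (form_iso a b `` {m}))"
    by (rule continuous_map_eq) (simp add: topspace_marked_forms_top pole_ratio_marked)
qed

lemma nonresonant_nth: "l \<in> nonresonant \<Longrightarrow> l $ j1 \<noteq> 0"
proof -
  assume l: "l \<in> nonresonant"
  have "{j1} \<noteq> UNIV" using j1 by (metis UNIV_I singletonD)
  then have "coord_sum {j1} l \<noteq> 0" using l by (auto simp: nonresonant_def proper_subset_def)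
  then show ?thesis by (simp add: coord_sum_def)
qed

lemma stratum_normal_class:
  assumes "c \<in> stratum a b"
  shows "\<exists>y. y \<in> config \<and> y $ j0 = 0 \<and> c = normal_class y"
proof -
  from assms obtain m where "m \<in> marked_forms a b" "c = form_iso a b `` {m}"
    unfolding stratum_def by (rule quotientE)
  with marked_form_normal_class[OF this(1)] show ?thesis by metis
qed

text \<open>The pole ratios give a continuous path Y of configurations that is right up to scale.
  Scaling changes residues by an (a + 1)-th power, so the scale is an (a + 1)-th root of the
  quotient q of residues, continuous through a logarithm on the interval. A constant root of unity
  adjusts the starting point.\<close>

lemma stratum_path_lift:
  assumes g: "pathin (stratum_top a b) g" and res: "\<And>t. t \<in> {0..1} \<Longrightarrow> residual_map (g t) = \<gamma> t"
    and \<gamma>: "continuous_on {0..1} \<gamma>" "\<And>t. t \<in> {0..1} \<Longrightarrow> \<gamma> t \<in> nonresonant"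
    and x: "x \<in> X0" "g 0 = normal_class x"
  shows "\<exists>y. lifts \<gamma> x y \<and> g 1 = normal_class y"
proof -
  define Y where "Y = (\<lambda>t. pole_ratio (g t))"
  have contY: "continuous_on {0..1} Y"
    using pathin_compose[OF g continuous_pole_ratio] by (simp add: pathin_def o_def Y_def)
  have repr: "\<exists>\<sigma>. \<sigma> \<noteq> 0 \<and> Y t \<in> config \<and> Y t $ j0 = 0 \<and> g t = normal_class (\<sigma> *s Y t)" if t: "t \<in> {0..1}" for t
  proof -
    have "g t \<in> stratum a b"
      using g t unfolding pathin_def continuous_map topspace_stratum_top by auto
    from stratum_normal_class[OF this]
    obtain y where y: "y \<in> config" "y $ j0 = 0" "g t = normal_class y" by (elim exE conjE)
    have "y $ j1 \<noteq> y $ j0" using y(1) j1 unfolding config_def by blast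
    then have nz: "y $ j1 \<noteq> 0" using y(2) by simp
    have Yt: "Y t = (1 / y $ j1) *s y"
      unfolding Y_def y(3) pole_ratio_normal_class[OF y(1)] y(2) by (simp add: vec_eq_iff)
    have "y $ j1 *s Y t = y" unfolding Yt using nz by (simp add: vec_eq_iff)
    moreover have "Y t \<in> config" unfolding Yt by (rule config_scale[OF y(1)]) (use nz in simp)
    moreover have "Y t $ j0 = 0" unfolding Yt using y(2) by simp
    ultimately show ?thesis using nz y(3) by (intro exI[of _ "y $ j1"]) simp
  qed
  \<comment> \<open>The residue at j1 alone fixes the power of the scale; it never vanishes, since
    {j1} is a proper subset.\<close>
  define q where "q = (\<lambda>t. res_at b (Y t) j1 / \<gamma> t $ j1)"
  have q: "q t = \<sigma> ^ (a + 1)"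
    if "t \<in> {0..1}" "\<sigma> \<noteq> 0" "Y t \<in> config" "g t = normal_class (\<sigma> *s Y t)" for t \<sigma>
  proof -
    have "\<gamma> t = residues b (\<sigma> *s Y t)"
      using res[OF that(1)] that(4) residual_map_normal_class[OF config_scale[OF that(3,2)]] by simp
    then have "\<gamma> t $ j1 = res_at b (\<sigma> *s Y t) j1" by (simp add: residues_def)
    moreover have "\<gamma> t $ j1 \<noteq> 0" by (rule nonresonant_nth[OF \<gamma>(2)[OF that(1)]])
    ultimately show ?thesis unfolding q_def res_at_scale[OF degree that(3,2), of j1] by simp
  qed
  have qnz: "q t \<noteq> 0" if t: "t \<in> {0..1}" for t
  proof -
    obtain \<sigma> where \<sigma>: "\<sigma> \<noteq> 0" "Y t \<in> config" "g t = normal_class (\<sigma> *s Y t)" using repr[OF t] by (elim exE conjE)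
    then show ?thesis using q[OF t \<sigma>] by simp
  qed
  have "continuous_on {0..1} (\<lambda>t. res_at b (Y t) j1)"
    by (rule continuous_on_compose2[OF continuous_on_res_at contY]) (use repr in blast)
  then have contq: "continuous_on {0..1} q"
    unfolding q_def using nonresonant_nth[OF \<gamma>(2)] by (intro continuous_intros \<gamma>(1)) auto
  have "contractible {0..1::real}" by (intro convex_imp_contractible) auto
  then have "\<exists>l. continuous_on {0..1} l \<and> (\<forall>t\<in>{0..1}. q t = exp (l t))"
  proof (rule continuous_logarithm_on_contractible[OF contq _ qnz])
    fix g assume "continuous_on {0..1} g" "\<And>t. t \<in> {0..1} \<Longrightarrow> q t = exp (g t)"
    then show ?thesis by blast
  qed
  then obtain l where l: "continuous_on {0..1} l" "\<forall>t\<in>{0..1}. q t = exp (l t)" by (elim exE conjE)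
  have nz: "(of_nat (a + 1) :: complex) \<noteq> 0" unfolding of_nat_eq_0_iff by simp
  define s where "s = (\<lambda>t. exp (l t / of_nat (a + 1)))"
  have sq: "s t ^ (a + 1) = q t" if "t \<in> {0..1}" for t
  proof -
    have "s t ^ (a + 1) = exp (of_nat (a + 1) * (l t / of_nat (a + 1)))" unfolding s_def by (rule exp_of_nat_mult[symmetric])
    also have "of_nat (a + 1) * (l t / of_nat (a + 1)) = l t"
      unfolding times_divide_eq_right by (rule nonzero_mult_div_cancel_left[OF nz])
    finally show ?thesis using bspec[OF l(2) that] by simp
  qed
  define X where "X = (\<lambda>t. s t *s Y t)"
  have contX: "continuous_on {0..1} X"
    unfolding X_def s_def by (intro continuous_intros l(1) contY ballI nz)
  have X: "X t \<in> config" "X t $ j0 = 0" "normal_class (X t) = g t" if t: "t \<in> {0..1}" for t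
  proof -
    obtain \<sigma> where \<sigma>: "\<sigma> \<noteq> 0" "Y t \<in> config" "Y t $ j0 = 0" "g t = normal_class (\<sigma> *s Y t)"
      using repr[OF t] by (elim exE conjE)
    show "X t \<in> config" unfolding X_def by (rule config_scale[OF \<sigma>(2)]) (simp add: s_def)
    show "X t $ j0 = 0" using \<sigma>(3) by (simp add: X_def)
    \<comment> \<open>At each time s t differs by a root of unity from a scale \<sigma> known to be
      right, and this does not change the class.\<close>
    have "(s t / \<sigma>) ^ (a + 1) = 1"
      unfolding power_divide sq[OF t] q[OF t \<sigma>(1,2,4)] using \<sigma>(1) by simp
    from normal_class_scale_root[OF config_scale[OF \<sigma>(2,1)] this]
    have "normal_class ((s t / \<sigma>) *s (\<sigma> *s Y t)) = g t" using \<sigma>(4) by simp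
    moreover have "(s t / \<sigma>) *s (\<sigma> *s Y t) = X t" using \<sigma>(1) by (simp add: X_def vec_eq_iff)
    ultimately show "normal_class (X t) = g t" by simp
  qed
  have "x \<in> config" "x $ j0 = 0" using x(1) by (auto simp: X0_def)
  have zero: "(0 :: real) \<in> {0..1}" by simp
  have "normal_class (X 0) = normal_class x" unfolding X(3)[OF zero] by (rule x(2))
  from normal_class_eqD[OF X(1)[OF zero] \<open>x \<in> config\<close> this]
  obtain \<alpha> \<beta> where \<alpha>: "\<alpha> \<noteq> 0" "\<forall>j. x $ j = \<alpha> * X 0 $ j + \<beta>" by (elim exE conjE)
  have "\<beta> = 0" using \<alpha>(2)[rule_format, of j0] X(2)[OF zero] \<open>x $ j0 = 0\<close> by simp
  then have xX: "x = \<alpha> *s X 0" using \<alpha>(2) by (simp add: vec_eq_iff)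
  have resX: "residues b (X t) = \<gamma> t" if "t \<in> {0..1}" for t
    using residual_map_normal_class[OF X(1)[OF that]] X(3)[OF that] res[OF that] by simp
  \<comment> \<open>Both configurations have the residues \<gamma> 0, and the one at j1 is
    nonzero.\<close>
  have "\<alpha> ^ (a + 1) = 1"
  proof -
    have "residues b x = \<gamma> 0"
      using residual_map_normal_class[OF \<open>x \<in> config\<close>] unfolding x(2)[symmetric] res[OF zero] by (rule sym)
    then have e1: "res_at b x j1 = \<gamma> 0 $ j1" unfolding residues_def by (auto simp: vec_eq_iff)
    have e2: "res_at b (X 0) j1 = \<gamma> 0 $ j1" using resX[OF zero] unfolding residues_def by (auto simp: vec_eq_iff)
    have "\<gamma> 0 $ j1 \<noteq> 0" by (rule nonresonant_nth[OF \<gamma>(2)[OF zero]])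
    moreover have "\<gamma> 0 $ j1 = \<alpha> ^ (a + 1) * \<gamma> 0 $ j1"
      using res_at_scale[OF degree X(1)[OF zero] \<alpha>(1), of j1] unfolding xX[symmetric] e1 e2 .
    ultimately show ?thesis by simp
  qed
  note root = this
  define h where "h = (\<lambda>t. \<alpha> *s X t)"
  have h: "h t \<in> config" "h t $ j0 = 0" "residues b (h t) = \<gamma> t" "normal_class (h t) = g t" if "t \<in> {0..1}" for t
    using X[OF that] resX[OF that] config_scale[OF X(1)[OF that] \<alpha>(1)]
      residues_scale_root[OF degree X(1)[OF that] root] normal_class_scale_root[OF X(1)[OF that] root]
    by (simp_all add: h_def)
  have "path h" unfolding path_def h_def by (intro continuous_intros contX)
  moreover have "path_image h \<subseteq> X0" using h \<gamma>(2) by (auto simp: path_image_def X0_def)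
  moreover have "h 0 = x" by (simp add: h_def xX)
  ultimately have "lifts \<gamma> x (h 1)" using h(3) unfolding lifts_def by blast
  then show ?thesis using h(4)[of 1] by auto
qed

text \<open>The definite description is resolved in two halves: a lift in \<open>X0\<close> projects
  to a lift in the stratum, and every lift in the stratum comes from one in \<open>X0\<close>
  starting at x, where lifts are unique.\<close>

lemma monodromy_lifts:
  assumes x: "x \<in> X0" and y: "lifts \<gamma> x y"
  shows "monodromy a b \<gamma> (normal_class x) = normal_class y"
proof -
  obtain h where h: "path h" "path_image h \<subseteq> X0" "\<forall>t\<in>{0..1}. residues b (h t) = \<gamma> t" "h 0 = x" "h 1 = y"
    using y unfolding lifts_def by (elim exE conjE)
  have hX: "h t \<in> X0" if "t \<in> {0..1}" for t using h(2) that by (auto simp: path_image_def)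
  have hc: "h t \<in> config" if "t \<in> {0..1}" for t using hX[OF that] by (simp add: X0_def)
  have conth: "continuous_on {0..1} h" using h(1) by (simp add: path_def)
  have "continuous_on {0..1} (\<lambda>t. residues b (h t))"
    unfolding residues_def
    by (intro continuous_on_vec_lambda continuous_on_compose2[OF continuous_on_res_at conth]) (use hc in blast)
  then have \<gamma>: "continuous_on {0..1} \<gamma>" by (rule continuous_on_eq) (use h(3) in blast)
  have \<gamma>n: "\<gamma> t \<in> nonresonant" if "t \<in> {0..1}" for t
    using hX[OF that] h(3) that by (auto simp: X0_def)
  have "continuous_map (top_of_set {0..1}) (top_of_set config) h"
    using conth hc by (auto simp: continuous_map_in_subtopology)
  from continuous_map_compose[OF continuous_map_compose[OF this continuous_map_normal_marked[of b a, OF b degree a]] continuous_map_class]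
  have "pathin (stratum_top a b) (\<lambda>t. normal_class (h t))"
    unfolding pathin_def normal_class_def o_def .
  then have lift: "is_lift a b \<gamma> (\<lambda>t. normal_class (h t))"
    using residual_map_normal_class[OF hc] h(3) by (simp add: is_lift_def)
  show ?thesis
    unfolding monodromy_def
  proof (rule the_equality)
    show "\<exists>g. is_lift a b \<gamma> g \<and> g 0 = normal_class x \<and> g 1 = normal_class y"
      using lift h(4,5) by (intro exI[of _ "\<lambda>t. normal_class (h t)"]) simp
    fix d assume "\<exists>g. is_lift a b \<gamma> g \<and> g 0 = normal_class x \<and> g 1 = d"
    then obtain g where g: "is_lift a b \<gamma> g" "g 0 = normal_class x" "g 1 = d" by (elim exE conjE)
    have "pathin (stratum_top a b) g" and r: "\<forall>t\<in>{0..1}. residual_map (g t) = \<gamma> t" using g(1) by (auto simp: is_lift_def)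
    have "\<exists>y'. lifts \<gamma> x y' \<and> g 1 = normal_class y'"
      by (rule stratum_path_lift[OF \<open>pathin (stratum_top a b) g\<close> bspec[OF r] \<gamma> \<gamma>n x g(2)])
    then obtain y' where "lifts \<gamma> x y'" "g 1 = normal_class y'" by (elim exE conjE)
    then show "d = normal_class y" using lifts_unique[OF y] g(3) by metis
  qed
qed

lemma lifts_end: "lifts \<gamma> x y \<Longrightarrow> y \<in> X0"
  unfolding lifts_def path_image_def by force

end

theorem lemma5p7:
  fixes a :: nat and b :: "'p::finite \<Rightarrow> nat" and I J :: "'p set"
    and C :: "(complex ^ 'p) set" and l0 :: "complex ^ 'p"
    and \<gamma>\<^sub>I \<gamma>\<^sub>J :: "real \<Rightarrow> complex ^ 'p"
  assumes "a \<ge> 1" and "\<And>j. b j \<ge> 1" and "int a - (\<Sum>j\<in>UNIV. int (b j)) = -2"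
    and "secant I J"
    and "C \<in> real_chambers" and "adjacent C I" and "adjacent C J" and "l0 \<in> C"
    and "resonance_loop C I l0 \<gamma>\<^sub>I" and "resonance_loop C J l0 \<gamma>\<^sub>J"
  shows "\<forall>c\<in>residual_fiber a b l0.
           monodromy a b \<gamma>\<^sub>I (monodromy a b \<gamma>\<^sub>J c) = monodromy a b \<gamma>\<^sub>J (monodromy a b \<gamma>\<^sub>I c)"
proof
  fix c assume c: "c \<in> residual_fiber a b l0"
  \<comment> \<open>Secancy supplies two distinct poles to normalise with: j0 goes to 0, and j1
    fixes the scale.\<close>
  obtain j0 j1 where j: "j0 \<in> I \<inter> J" "j1 \<in> - I \<inter> J" using assms(4) unfolding secant_def by blast
  then have ne: "j1 \<noteq> j0" by blast
  have "card {j0, j1} \<le> CARD('p)" by (rule card_mono) simp_all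
  then have card: "CARD('p) \<ge> 2" using ne by simp
  have "int (\<Sum>j\<in>UNIV. b j) = int (a + 2)" using assms(3) by simp
  then have sum: "(\<Sum>j\<in>UNIV. b j) = a + 2" by (simp only: of_nat_eq_iff)
  interpret isoresidual b j0 a j1 by unfold_locales (use assms(1,2) sum card ne in simp_all)
  have "l0 \<in> nonresonant" using chamber_tube(1)[OF assms(5,8)] tube_nonresonant assms(8) by blast
  moreover obtain x where x: "x \<in> config" "x $ j0 = 0" "c = normal_class x"
    using c stratum_normal_class unfolding residual_fiber_def by blast
  moreover have l0: "residues b x = l0"
    using c residual_map_normal_class[OF x(1)] x(3) by (simp add: residual_fiber_def)
  ultimately have X: "x \<in> X0" by (simp add: X0_def)
  \<comment> \<open>Starting at x, both orders of the two loops end at the same configuration w,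
    hence in the same class.\<close>
  from loops_commute[OF assms(5,8,4,9,10) X l0]
  obtain y z w where "lifts \<gamma>\<^sub>I x y" "lifts \<gamma>\<^sub>J x z" "lifts \<gamma>\<^sub>J y w" "lifts \<gamma>\<^sub>I z w"
    by (elim exE conjE)
  with X show "monodromy a b \<gamma>\<^sub>I (monodromy a b \<gamma>\<^sub>J c) = monodromy a b \<gamma>\<^sub>J (monodromy a b \<gamma>\<^sub>I c)"
    using lifts_end unfolding x(3) by (simp add: monodromy_lifts)
qed

end
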